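(* Let $f_1\in\mathcal{H}(\Lambda)^{m\times n}$ and $f_2\in\mathcal{H}(\Lambda)^{n\times k}$ be rational DA functions with given realizations $$f_j(z)=D_j+C_j(I-zA_j)^{-\odot}\odot(zB_j),\qquad j=1,2.$$ Then $$(f_1\odot f_2)(z)=D+C(I-zA)^{-\odot}\odot(zB),$$ where $$A=\begin{pmatrix}A_2&0\\ B_1C_2&A_1\end{pmatrix},\quad B=\begin{pmatrix}B_2\\ B_1D_2\end{pmatrix},\quad C=\begin{pmatrix}D_1C_2&C_1\end{pmatrix},\quad D=D_1D_2.$$
   Context: **Lattice.** $\Lambda$ is a rhombic lattice in the complex plane $\mathbb{C}$: a monohedral (all tiles congruent), edge-to-edge tessellation of $\mathbb{C}$ with rhombi of side length $1$. $V(\Lambda)$, $E(\Lambda)$, $F(\Lambda)$ denote its sets of vertices, edges and faces; $(a,b)\in E(\Lambda)$ means that $a,b\in V(\Lambda)$ are adjacent, and edges are taken in both orientations, so $(a,b)\in E(\Lambda)$ iff $(b,a)\in E(\Lambda)$. A path in $\Lambda$ from $a$ to $b$ is a finite sequence $(z_0,\dots,z_N)$ of vertices with $z_0=a$, $z_N=b$ and $z_{n-1},z_n$ adjacent for $n=1,\dots,N$; it is closed if $a=b$. Standing assumptions on $\Lambda$: (i) $0\in V(\Lambda)$; (ii) for every $z\in V(\Lambda)$ there are $N\in\mathbb{N}$ and a path $(z_0,\dots,z_N)$ with $z_0=z$, $z_n-z_{n-1}\neq\pm1$ for $n=1,\dots,N-1$, and $z_N-z_{N-1}=1$. **Discrete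 analyticity.** For $f:V(\Lambda)\to\mathbb{C}$ and a path $\gamma=(z_0,\dots,z_N)$, $\int_\gamma f\,\delta z=\sum_{n=1}^N\frac{f(z_{n-1})+f(z_n)}{2}(z_n-z_{n-1})$. $f$ is discrete analytic (DA) if $\int_\gamma f\,\delta z=0$ for every closed path $\gamma$; then $\int_a^b f\,\delta z$ denotes $\int_\gamma f\,\delta z$ for any path $\gamma$ from $a$ to $b$. $\mathcal{H}(\Lambda)$ is the complex vector space of DA functions. **Shift operators.** $Z_+:\mathcal{H}(\Lambda)\to\mathcal{H}(\Lambda)$ is $(Z_+f)(z)=\frac{f(0)-f(z)}{2}+\int_0^z f\,\delta z$. It is injective with range $\{g\in\mathcal{H}(\Lambda):g(0)=0\}$, so one may define $Z_-:\mathcal{H}(\Lambda)\to\mathcal{H}(\Lambda)$ by letting $Z_-f$ be the unique element of $\mathcal{H}(\Lambda)$ with $(Z_+Z_-f)(z)=f(z)-f(0)$. **The set $S(\Lambda)$.** $S(\Lambda)=\{t\in\mathbb{C}: t(1+b-a)=-2\text{ for some }(a,b)\in E(\Lambda)\}$. Standing assumption: no element of $S(\Lambda)$ is an eigenvalue of $Z_-$ on $\mathcal{H}(\Lambda)$. **DA polynomials.** $z^{(0)}=1$ and $z^{(n)}=Z_+z^{(n-1)}$ for $n\ge1$ (so $z^{(1)}=z$). DA polynomials are finite linear combinations of the functions $z^{(n)}$. **Matrix-valued functions.** $\mathcal{H}(\Lambda)^{m\times n}$ is the space of $\mathbb{C}^{m\times n}$-valued functions on $V(\Lambda)$ with DA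 entries; integrals and $Z_\pm$ act entrywise. $\mathbb{C}^{m\times n}$-valued DA polynomials are sums $\sum_{n=0}^N A_nz^{(n)}$ with matrix coefficients. For such a polynomial $p=\sum_{n=0}^N A_nz^{(n)}$ and DA matrix-valued functions $f,g$ of suitable sizes, the convolution product is $(p\odot f)(z)=\sum_{n=0}^N A_n(Z_+^nf)(z)$ and $(g\odot p)(z)=\sum_{n=0}^N(Z_+^ng)(z)A_n$. **Rational DA functions.** For $A\in\mathbb{C}^{\ell\times\ell}$ with spectrum $\sigma(A)$ satisfying $S(\Lambda)\cap\sigma(A)=\emptyset$, the DA polynomial $I-zA$ has a unique two-sided $\odot$-inverse in $\mathcal{H}(\Lambda)^{\ell\times\ell}$, denoted $(I-zA)^{-\odot}$. A matrix-valued DA function $f$ is called rational if it can be written as $f(z)=D+C(I-zA)^{-\odot}\odot(zB)$, i.e. $f(z)=D+C\big(Z_+(I-zA)^{-\odot}\big)(z)B$, with complex matrices $A,B,C,D$ of suitable dimensions and $S(\Lambda)\cap\sigma(A)=\emptyset$; such a representation is called a realization of $f$. **Convolution product of rational DA functions.** For a rational DA function $f$ let $\tau f(t)=\sum_{k=0}^\infty(Z_-^kf)(0)t^k$. For each matrix size, $\tau$ is a linear bijection from the rational DA functions onto the rational matrix functions of $t$ having no poles in $P(\Lambda)=\{t\in\mathbb{C}:t=0\text{ or }1/t\in S(\Lambda)\}$. For rational DA functions $f_1\in\mathcal{H}(\Lambda)^{m\times n}$, $f_2\in\mathcal{H}(\Lambda)^{n\times k}$ one defines $f_1\odot f_2=\tau^{-1}(\tau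 f_1\cdot\tau f_2)$; this agrees with the convolution product above when one factor is a DA polynomial. *)

theory Defs
  imports
    "HOL-Analysis.Analysis"
    "HOL-Computational_Algebra.Formal_Power_Series"
    "Jordan_Normal_Form.Matrix"
    "Jordan_Normal_Form.Spectral_Radius"
begin

hide_const (open) Finite_Cartesian_Product.mat Finite_Cartesian_Product.vec

section \<open>Rhombic lattices\<close>

text \<open>A lattice is given by its set of faces \<open>L\<close>, each face being a closed rhombus. The condition
  \<open>u \<noteq> v \<and> u \<noteq> -v\<close> says that the unit vectors \<open>u\<close>, \<open>v\<close> are linearly independent over the reals.\<close>

definition unit_rhombus :: "complex set \<Rightarrow> bool" where
  "unit_rhombus T \<longleftrightarrow> (\<exists>a u v. norm u = 1 \<and> norm v = 1 \<and> u \<noteq> v \<and> u \<noteq> - v \<and>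
     T = convex hull {a, a + u, a + u + v, a + v})"

definition congruent_sets :: "complex set \<Rightarrow> complex set \<Rightarrow> bool" where
  "congruent_sets S T \<longleftrightarrow> (\<exists>g. (\<forall>x y. dist (g x) (g y) = dist x y) \<and> g ` S = T)"

text \<open>Edge-to-edge: any two tiles meet in a common face, in the sense of convex geometry (possibly
  empty, a common vertex or a common edge).\<close>

definition rhombic_lattice :: "complex set set \<Rightarrow> bool" where
  "rhombic_lattice L \<longleftrightarrow>
     (\<forall>T\<in>L. unit_rhombus T) \<and>
     (\<forall>S\<in>L. \<forall>T\<in>L. congruent_sets S T) \<and>
     \<Union>L = UNIV \<and>
     (\<forall>S\<in>L. \<forall>T\<in>L. S \<noteq> T \<longrightarrow> interior S \<inter> interior T = {}) \<and>
     (\<forall>S\<in>L. \<forall>T\<in>L. (S \<inter> T) face_of S \<and> (S \<inter> T) face_of T)"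

definition vertices :: "complex set set \<Rightarrow> complex set" where
  "vertices L = {z. \<exists>T\<in>L. z extreme_point_of T}"

definition edges :: "complex set set \<Rightarrow> (complex \<times> complex) set" where
  "edges L = {(a, b). \<exists>T\<in>L. closed_segment a b edge_of T}"

definition is_path :: "complex set set \<Rightarrow> complex list \<Rightarrow> bool" where
  "is_path L zs \<longleftrightarrow> zs \<noteq> [] \<and> set zs \<subseteq> vertices L \<and> successively (\<lambda>a b. (a, b) \<in> edges L) zs"

definition is_path_between :: "complex set set \<Rightarrow> complex \<Rightarrow> complex \<Rightarrow> complex list \<Rightarrow> bool" where
  "is_path_between L a b zs \<longleftrightarrow> is_path L zs \<and> hd zs = a \<and> last zs = b"

section \<open>Discrete analytic functions\<close>

definition path_sum :: "(complex \<Rightarrow> complex) \<Rightarrow> complex list \<Rightarrow> complex" where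
  "path_sum f zs = (\<Sum>n = 1..length zs - 1.
     (f (zs ! (n - 1)) + f (zs ! n)) / 2 * (zs ! n - zs ! (n - 1)))"

definition discrete_analytic :: "complex set set \<Rightarrow> (complex \<Rightarrow> complex) \<Rightarrow> bool" where
  "discrete_analytic L f \<longleftrightarrow> (\<forall>a zs. is_path_between L a a zs \<longrightarrow> path_sum f zs = 0)"

text \<open>A function on the vertex set is represented by its extension by zero to the whole plane, so that
  equality in \<open>DA L\<close> is equality of functions.\<close>

definition DA :: "complex set set \<Rightarrow> (complex \<Rightarrow> complex) set" where
  "DA L = {f. (\<forall>z. z \<notin> vertices L \<longrightarrow> f z = 0) \<and> discrete_analytic L f}"

definition dint :: "complex set set \<Rightarrow> complex \<Rightarrow> complex \<Rightarrow> (complex \<Rightarrow> complex) \<Rightarrow> complex" where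
  "dint L a b f = path_sum f (SOME zs. is_path_between L a b zs)"

definition Zplus :: "complex set set \<Rightarrow> (complex \<Rightarrow> complex) \<Rightarrow> complex \<Rightarrow> complex" where
  "Zplus L f z = (if z \<in> vertices L then (f 0 - f z) / 2 + dint L 0 z f else 0)"

definition Zminus :: "complex set set \<Rightarrow> (complex \<Rightarrow> complex) \<Rightarrow> complex \<Rightarrow> complex" where
  "Zminus L f = (THE h. h \<in> DA L \<and> (\<forall>z\<in>vertices L. Zplus L h z = f z - f 0))"

definition S_set :: "complex set set \<Rightarrow> complex set" where
  "S_set L = {t. \<exists>(a, b)\<in>edges L. t * (1 + b - a) = - 2}"

definition Zminus_eigenvalue :: "complex set set \<Rightarrow> complex \<Rightarrow> bool" where
  "Zminus_eigenvalue L t \<longleftrightarrow> (\<exists>f\<in>DA L. f \<noteq> (\<lambda>z. 0) \<and> Zminus L f = (\<lambda>z. t * f z))"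

section \<open>Matrix-valued functions and convolution with polynomials\<close>

definition DA_mat :: "complex set set \<Rightarrow> nat \<Rightarrow> nat \<Rightarrow> (complex \<Rightarrow> complex mat) set" where
  "DA_mat L m n = {f. (\<forall>z. f z \<in> carrier_mat m n) \<and>
     (\<forall>i<m. \<forall>j<n. (\<lambda>z. f z $$ (i, j)) \<in> DA L)}"

definition Zplus_mat :: "complex set set \<Rightarrow> (complex \<Rightarrow> complex mat) \<Rightarrow> complex \<Rightarrow> complex mat" where
  "Zplus_mat L f z = Matrix.mat (dim_row (f z)) (dim_col (f z))
     (\<lambda>(i, j). Zplus L (\<lambda>w. f w $$ (i, j)) z)"

text \<open>A polynomial \<open>\<Sum>n\<le>N. A\<^sub>n z\<^sup>(\<^sup>n\<^sup>)\<close> enters the convolution product through its list of coefficients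
  \<open>[A\<^sub>0, \<dots>, A\<^sub>N]\<close>. Below, \<open>poly_conv L m n p f\<close> is the \<open>m \<times> n\<close> matrix function \<open>p \<odot> f\<close>, and
  \<open>conv_poly L m n g p\<close> is \<open>g \<odot> p\<close>.\<close>

definition poly_conv ::
  "complex set set \<Rightarrow> nat \<Rightarrow> nat \<Rightarrow> complex mat list \<Rightarrow> (complex \<Rightarrow> complex mat) \<Rightarrow> complex \<Rightarrow> complex mat" where
  "poly_conv L m n p f z = Matrix.mat m n
     (\<lambda>(i, j). \<Sum>r<length p. (p ! r * (Zplus_mat L ^^ r) f z) $$ (i, j))"

definition conv_poly ::
  "complex set set \<Rightarrow> nat \<Rightarrow> nat \<Rightarrow> (complex \<Rightarrow> complex mat) \<Rightarrow> complex mat list \<Rightarrow> complex \<Rightarrow> complex mat" where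
  "conv_poly L m n g p z = Matrix.mat m n
     (\<lambda>(i, j). \<Sum>r<length p. ((Zplus_mat L ^^ r) g z * p ! r) $$ (i, j))"

text \<open>\<open>resolvent L A\<close> is the two-sided inverse \<open>(I - zA)\<^sup>-\<^sup>\<odot>\<close>; the polynomial \<open>I - zA\<close> has the
  coefficients \<open>I\<close> and \<open>-A\<close>.\<close>

definition resolvent :: "complex set set \<Rightarrow> complex mat \<Rightarrow> complex \<Rightarrow> complex mat" where
  "resolvent L A = (let l = dim_row A in
     THE R. R \<in> DA_mat L l l \<and>
       (\<forall>z\<in>vertices L. poly_conv L l l [1\<^sub>m l, - A] R z = 1\<^sub>m l) \<and>
       (\<forall>z\<in>vertices L. conv_poly L l l R [1\<^sub>m l, - A] z = 1\<^sub>m l))"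

section \<open>Rational discrete analytic functions\<close>

text \<open>\<open>f(z) = D + C (I - zA)\<^sup>-\<^sup>\<odot> \<odot> (zB)\<close>, where the polynomial \<open>zB\<close> has the coefficients \<open>0\<close> and \<open>B\<close>.\<close>

definition is_realization ::
  "complex set set \<Rightarrow> nat \<Rightarrow> nat \<Rightarrow> nat \<Rightarrow> complex mat \<Rightarrow> complex mat \<Rightarrow> complex mat \<Rightarrow> complex mat \<Rightarrow>
   (complex \<Rightarrow> complex mat) \<Rightarrow> bool" where
  "is_realization L m n l A B C D f \<longleftrightarrow>
     A \<in> carrier_mat l l \<and> B \<in> carrier_mat l n \<and> C \<in> carrier_mat m l \<and> D \<in> carrier_mat m n \<and>
     S_set L \<inter> spectrum A = {} \<and>
     f \<in> DA_mat L m n \<and>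
     (\<forall>z\<in>vertices L. f z = D + C * conv_poly L l n (resolvent L A) [0\<^sub>m l n, B] z)"

definition rational_DA :: "complex set set \<Rightarrow> nat \<Rightarrow> nat \<Rightarrow> (complex \<Rightarrow> complex mat) \<Rightarrow> bool" where
  "rational_DA L m n f \<longleftrightarrow> (\<exists>l A B C D. is_realization L m n l A B C D f)"

text \<open>\<open>\<tau> f\<close>, the matrix of power series \<open>\<Sum>k. (Z\<^sub>-\<^sup>k f)(0) t\<^sup>k\<close>. A rational function of \<open>t\<close> without pole at
  \<open>0\<close> is identified with its Taylor series at \<open>0\<close>; products of rational matrix functions are then
  matrix products over the ring of formal power series.\<close>

definition tau :: "complex set set \<Rightarrow> (complex \<Rightarrow> complex mat) \<Rightarrow> complex fps mat" where
  "tau L f = Matrix.mat (dim_row (f 0)) (dim_col (f 0))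
     (\<lambda>(i, j). Abs_fps (\<lambda>k. (Zminus L ^^ k) (\<lambda>z. f z $$ (i, j)) 0))"

definition rational_conv ::
  "complex set set \<Rightarrow> (complex \<Rightarrow> complex mat) \<Rightarrow> (complex \<Rightarrow> complex mat) \<Rightarrow> complex \<Rightarrow> complex mat" where
  "rational_conv L f g = (THE h. rational_DA L (dim_row (f 0)) (dim_col (g 0)) h \<and>
     tau L h = tau L f * tau L g)"

definition append_cols :: "'a :: zero mat \<Rightarrow> 'a mat \<Rightarrow> 'a mat" (infixr \<open>@\<^sub>c\<close> 65) where
  "X @\<^sub>c Y = four_block_mat X Y (0\<^sub>m 0 (dim_col X)) (0\<^sub>m 0 (dim_col Y))"

end

theory Submission imports Defs begin

text \<open>Write \<open>R\<close> for the resolvent \<open>(I - zA)\<^sup>-\<^sup>\<odot>\<close>. It satisfies \<open>R = I + (Z\<^sub>+ R) A\<close>, so applying \<open>Z\<^sub>-\<close> to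
\<open>f = D + C (Z\<^sub>+ R) B\<close> gives \<open>C R B\<close>, then \<open>C R A B\<close>, and so on. Hence the Taylor coefficients of \<open>\<tau> f\<close> are
the Markov parameters \<open>D, C B, C A B, C A\<^sup>2 B, \<dots>\<close> (\<open>tau_realization\<close>). The Markov parameters of the
block realization are the Cauchy products of those of the two factors (\<open>markov_product\<close>), and its
state matrix is block triangular, so it has no eigenvalue in \<open>S(\<Lambda>)\<close> (\<open>eigenvalue_block\<close>). The function
that it realizes therefore has \<open>\<tau>\<close> equal to \<open>\<tau> f\<^sub>1 \<cdot> \<tau> f\<^sub>2\<close>, and it remains to see that \<open>\<tau>\<close> is injective on
rational functions (\<open>realization_markov_unique\<close>).

Along an edge from \<open>a\<close> to \<open>b\<close>, with \<open>u = b - a\<close>, the resolvent obeys the recursion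
\<open>(2 I + (1 - u) A) R(b) = (2 I + (1 + u) A) R(a)\<close>, whose coefficients are invertible because no
eigenvalue of \<open>A\<close> lies in \<open>S(\<Lambda>)\<close>. This gives uniqueness of \<open>R\<close>. It also gives injectivity of \<open>\<tau>\<close>: if two
realizations have the same Markov parameters and the sequences \<open>C A\<^sup>k R B\<close> agree at \<open>a\<close>, then the
difference of the sequences at \<open>b\<close> is zero for \<open>u = 1\<close> and otherwise geometric with ratio
\<open>- 2 / (1 - u)\<close> in \<open>S(\<Lambda>)\<close>; by
Cayley-Hamilton it is annihilated by the product of the two characteristic polynomials, which does
not vanish at that ratio, so the difference is zero (\<open>geometric_annihilated\<close>).

Existence of \<open>R\<close> requires that the recursion be consistent around closed paths. Its steps commute and
the step along \<open>- u\<close> inverts the step along \<open>u\<close>, so it suffices that every closed path contains each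
direction \<open>u\<close> as often as \<open>- u\<close> (\<open>closed_path_balanced\<close>, \<open>fold_balanced\<close>). This is where the topology of the
plane enters. For an odd function \<open>n\<close>, each tile carries the linear function that has the value \<open>n(u)\<close>
at each of its edge vectors \<open>u\<close>; the increments of these functions agree on common edges. Over a
sufficiently small box they glue to one function, and two adjacent boxes can always be merged, since
their intersection is convex; so they glue over every box (\<open>matchable_cbox\<close>). The resulting function
is a potential for \<open>n\<close> along edges.

Instead of \<open>R\<close> itself, the recursion is solved for the function \<open>Y = Z\<^sub>+ Z\<^sub>+ R\<close>
(\<open>step_recursion_solution\<close>). Then \<open>X = z I + A Y\<close> is \<open>Z\<^sub>+ R\<close>, and \<open>R = I + A X\<close>. Primitives of \<open>X\<close> and \<open>R\<close>
along edges are \<open>Y + X / 2\<close> and \<open>X + R / 2\<close>, so both functions are discrete analytic, also when \<open>A\<close> is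
singular (\<open>is_resolvent_exists\<close>).\<close>

section \<open>Functions with prescribed increments on a locally finite convex cover\<close>

text \<open>A cover of a Euclidean space by convex sets, such that each point has a ball that meets only those
sets that contain the point.\<close>

locale tile_cover =
  fixes L :: "'a::euclidean_space set set"
  assumes convex_tile: "T \<in> L \<Longrightarrow> convex T"
    and covered: "\<exists>T\<in>L. p \<in> T"
    and locally_around: "\<exists>r>0. \<forall>q\<in>ball p r. \<forall>T\<in>L. q \<in> T \<longrightarrow> p \<in> T"
begin

text \<open>A function that is constant on each tile within a connected set is constant there, because it is
locally constant.\<close>

lemma constant_on_connected:
  assumes "connected K"
    and "\<And>T x y. T \<in> L \<Longrightarrow> x \<in> T \<inter> K \<Longrightarrow> y \<in> T \<inter> K \<Longrightarrow> f x = f y"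
  shows "f constant_on K"
proof (rule locally_constant_imp_constant[OF \<open>connected K\<close>])
  fix p assume "p \<in> K"
  obtain r where r: "r > 0" "\<forall>q\<in>ball p r. \<forall>T\<in>L. q \<in> T \<longrightarrow> p \<in> T"
    using locally_around by blast
  have "f q = f p" if "q \<in> K \<inter> ball p r" for q
  proof -
    obtain T where "T \<in> L" "q \<in> T" using covered by blast
    with r that \<open>p \<in> K\<close> show ?thesis by (intro assms(2)[of T]) auto
  qed
  moreover have "openin (top_of_set K) (K \<inter> ball p r)" by (simp add: openin_open_Int)
  moreover have "p \<in> K \<inter> ball p r" using \<open>p \<in> K\<close> r(1) by simp
  ultimately show "\<exists>U. openin (top_of_set K) U \<and> p \<in> U \<and> (\<forall>x\<in>U. f x = f p)" by blast
qed

text \<open>Each tile \<open>T\<close> carries a function \<open>g T\<close>. A function \<open>F\<close> matches \<open>g\<close> on \<open>Q\<close> if within each tile it has the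
same increments as \<open>g T\<close>.\<close>

definition matches :: "('a set \<Rightarrow> 'a \<Rightarrow> real) \<Rightarrow> 'a set \<Rightarrow> ('a \<Rightarrow> real) \<Rightarrow> bool" where
  "matches g Q F \<longleftrightarrow> (\<forall>T\<in>L. \<forall>x\<in>T \<inter> Q. \<forall>y\<in>T \<inter> Q. F y - F x = g T y - g T x)"

lemma matches_mono: "matches g Q F \<Longrightarrow> Q' \<subseteq> Q \<Longrightarrow> matches g Q' F"
  unfolding matches_def by blast

definition matchable :: "('a set \<Rightarrow> 'a \<Rightarrow> real) \<Rightarrow> 'a set \<Rightarrow> bool" where
  "matchable g Q \<longleftrightarrow> (\<exists>F. matches g Q F)"

lemma matchableI: "matches g Q F \<Longrightarrow> matchable g Q"
  unfolding matchable_def by (rule exI[of _ F])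

lemma matchableE:
  assumes "matchable g Q"
  obtains F where "matches g Q F"
  using assms unfolding matchable_def by (elim exE)

lemma matchable_mono: "matchable g Q \<Longrightarrow> Q' \<subseteq> Q \<Longrightarrow> matchable g Q'"
  by (elim matchableE) (rule matchableI, rule matches_mono)

text \<open>Two parts of a convex set on either side of a hyperplane are glued. The two given functions have
the same increments on the slice in between, which is convex, so they differ by a constant there.\<close>

lemma matchable_glue:
  assumes Q: "convex Q" and k: "k \<in> Basis"
    and le: "matchable g (Q \<inter> {x. inner x k \<le> c})"
    and ge: "matchable g (Q \<inter> {x. inner x k \<ge> c})"
  shows "matchable g Q"
proof -
  obtain F1 where 1: "matches g (Q \<inter> {x. inner x k \<le> c}) F1" using le by (rule matchableE)
  obtain F2 where 2: "matches g (Q \<inter> {x. inner x k \<ge> c}) F2" using ge by (rule matchableE)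
  let ?K = "Q \<inter> {x. inner x k = c}"
  have "convex ?K" using Q convex_hyperplane[of k c] by (simp add: convex_Int inner_commute)
  have "(\<lambda>x. F1 x - F2 x) constant_on ?K"
  proof (rule constant_on_connected)
    show "connected ?K" using \<open>convex ?K\<close> by (rule convex_connected)
    fix T x y assume "T \<in> L" "x \<in> T \<inter> ?K" "y \<in> T \<inter> ?K"
    then have "F1 y - F1 x = g T y - g T x" "F2 y - F2 x = g T y - g T x"
      using 1 2 unfolding matches_def by auto
    then show "F1 x - F2 x = F1 y - F2 y" by linarith
  qed
  then obtain d where d: "F1 x - F2 x = d" if "x \<in> ?K" for x
    unfolding constant_on_def by blast
  define F where "F x = (if inner x k \<le> c then F1 x else F2 x + d)" for x
  have F2: "F x = F2 x + d" if "x \<in> Q" "inner x k \<ge> c" for x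
    using d[of x] that unfolding F_def by (auto simp: algebra_simps)
  \<comment> \<open>A segment of a tile that crosses the hyperplane does so inside the tile.\<close>
  have cross: "F y - F x = g T y - g T x"
    if T: "T \<in> L" and x: "x \<in> T \<inter> Q" "inner x k \<le> c" and y: "y \<in> T \<inter> Q" "inner y k \<ge> c" for T x y
  proof -
    have "\<exists>z\<in>closed_segment x y. inner z k = c"
    proof -
      have "connected ((\<lambda>z. inner z k) ` closed_segment x y)"
        by (intro connected_continuous_image continuous_intros convex_connected) auto
      then have "c \<in> (\<lambda>z. inner z k) ` closed_segment x y"
        by (rule connectedD_interval[of _ "inner x k" "inner y k"]) (use x y in auto)
      then show ?thesis by auto
    qed
    then obtain z where z: "z \<in> closed_segment x y" "inner z k = c" by blast
    have "closed_segment x y \<subseteq> T \<inter> Q"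
      using convex_tile[OF T] Q x y by (intro closed_segment_subset convex_Int) auto
    with z have z': "z \<in> T \<inter> Q" by blast
    have "F1 z - F1 x = g T z - g T x" using 1 T x z' z unfolding matches_def by auto
    moreover have "F2 y - F2 z = g T y - g T z" using 2 T y z' z unfolding matches_def by auto
    moreover have "F x = F1 x" "F z = F1 z" using x z unfolding F_def by auto
    moreover have "F z = F2 z + d" "F y = F2 y + d" using F2 y z z' by auto
    ultimately have "F y = F z + (g T y - g T z)" "F z = F x + (g T z - g T x)"
      by (simp_all add: algebra_simps)
    then show ?thesis by (simp add: algebra_simps)
  qed
  have "F y - F x = g T y - g T x" if T: "T \<in> L" "x \<in> T \<inter> Q" "y \<in> T \<inter> Q" for T x y
  proof -
    consider "inner x k \<le> c" "inner y k \<ge> c" | "inner x k \<ge> c" "inner y k \<le> c"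
      | "inner x k \<le> c" "inner y k \<le> c" | "inner x k \<ge> c" "inner y k \<ge> c" by linarith
    then show ?thesis
    proof cases
      case 1 with T show ?thesis by (intro cross) auto
    next
      case 2
      with T have "F x - F y = g T x - g T y" by (intro cross) auto
      then show ?thesis by linarith
    next
      case 3
      with T \<open>matches g (Q \<inter> {x. inner x k \<le> c}) F1\<close> show ?thesis unfolding F_def matches_def by auto
    next
      case 4
      have "F2 y - F2 x = g T y - g T x"
        using 4 T \<open>matches g (Q \<inter> {x. inner x k \<ge> c}) F2\<close> unfolding matches_def by auto
      with 4 T show ?thesis by (simp add: F2)
    qed
  qed
  then have "matches g Q F" unfolding matches_def by blast
  then show ?thesis by (rule matchableI)
qed

text \<open>The increments of the functions carried by two tiles agree on the intersection of the tiles.\<close>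

definition compatible :: "('a set \<Rightarrow> 'a \<Rightarrow> real) \<Rightarrow> bool" where
  "compatible g \<longleftrightarrow> (\<forall>S\<in>L. \<forall>T\<in>L. \<forall>x\<in>S \<inter> T. \<forall>y\<in>S \<inter> T. g S y - g S x = g T y - g T x)"

lemma matchable_local:
  assumes compat: "compatible g"
  shows "\<exists>r>0. matchable g (ball p r)"
proof -
  obtain r where r: "r > 0" "\<forall>q\<in>ball p r. \<forall>T\<in>L. q \<in> T \<longrightarrow> p \<in> T"
    using locally_around by blast
  obtain t where t: "t x \<in> L" "x \<in> t x" for x using covered by metis
  have *: "g (t x) x - g (t x) p = g T x - g T p" if "T \<in> L" "x \<in> T" "x \<in> ball p r" for T x
  proof -
    have "x \<in> t x \<inter> T" "p \<in> t x \<inter> T" using that t[of x] r(2) by simp_all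
    with compat t(1) that(1) show ?thesis unfolding compatible_def by blast
  qed
  define F where "F x = g (t x) x - g (t x) p" for x
  have "matches g (ball p r) F"
    unfolding F_def matches_def
  proof (intro ballI)
    fix T x y assume T: "T \<in> L" "x \<in> T \<inter> ball p r" "y \<in> T \<inter> ball p r"
    show "(g (t y) y - g (t y) p) - (g (t x) x - g (t x) p) = g T y - g T x"
      using *[of T x] *[of T y] T by simp
  qed
  with r(1) show ?thesis by (blast intro: matchableI)
qed

text \<open>A box has a tagged division into boxes so small that \<open>matchable_local\<close> applies to them. The nonempty
interior of the box lets degenerate boxes be disregarded in the division.\<close>

lemma matchable_cbox:
  assumes compat: "compatible g"
    and ne: "box a b \<noteq> {}"
  shows "matchable g (cbox a b)"
proof -
  have "\<forall>p. \<exists>r>0. matchable g (ball p r)"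
    using matchable_local[OF compat] by blast
  then obtain r where r: "r p > 0" "matchable g (ball p (r p))" for p by metis
  have "gauge (\<lambda>p. ball p (r p))" using r by (simp add: gauge_ball_dependent)
  then obtain p where p: "p tagged_division_of cbox a b" "(\<lambda>p. ball p (r p)) fine p"
    by (rule fine_division_exists)
  \<comment> \<open>Boxes without interior are exempted, as they count for nothing in a division.\<close>
  define P where "P K \<longleftrightarrow> interior K = {} \<or> matchable g K" for K
  have P_mono: "P K'" if "P K" "K' \<subseteq> K" for K K'
    using that interior_mono[of K' K] matchable_mono[of g K K'] unfolding P_def by blast
  interpret operative conj True P
  proof
    show "P (cbox a b) = True" if "box a b = {}" for a b
      using that by (simp add: P_def interior_cbox)
    fix a b k :: 'a and c :: real assume k: "k \<in> Basis"
    let ?l = "cbox a b \<inter> {x. inner x k \<le> c}" and ?r = "cbox a b \<inter> {x. c \<le> inner x k}"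
    have "P (cbox a b)" if "P ?l" "P ?r"
    proof (cases "box a b = {} \<or> c \<le> inner a k \<or> inner b k \<le> c")
      case True
      then consider "box a b = {}" | "c \<le> inner a k" | "inner b k \<le> c" by blast
      then show ?thesis
      proof cases
        case 1 then show ?thesis by (simp add: P_def interior_cbox)
      next
        case 2
        then have "?r = cbox a b" using k by (fastforce simp: mem_box)
        with that show ?thesis by simp
      next
        case 3
        then have "?l = cbox a b" using k by (fastforce simp: mem_box)
        with that show ?thesis by simp
      qed
    next
      case False
      have "box a b \<inter> {x. inner x k < c} \<subseteq> interior ?l" "box a b \<inter> {x. inner x k > c} \<subseteq> interior ?r"
        using box_subset_cbox[of a b]
        by (intro interior_maximal; force intro!: open_Int open_halfspace_component_lt open_halfspace_component_gt)+
      moreover have "box a b \<inter> {x. inner x k < c} \<noteq> {}" "box a b \<inter> {x. inner x k > c} \<noteq> {}"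
      proof -
        have lt: "inner a i < inner b i" if "i \<in> Basis" for i using False that by (auto simp: box_eq_empty not_le)
        define h where "h s = (\<Sum>i\<in>Basis. (if i = k then s else (inner a i + inner b i) / 2) *\<^sub>R i)" for s
        have h: "inner (h s) i = (if i = k then s else (inner a i + inner b i) / 2)" if "i \<in> Basis" for s i
          unfolding h_def using that by simp
        have "h ((inner a k + c) / 2) \<in> box a b \<inter> {x. inner x k < c}" "h ((c + inner b k) / 2) \<in> box a b \<inter> {x. inner x k > c}"
          using False k lt by (auto simp: mem_box h field_simps)
        then show "box a b \<inter> {x. inner x k < c} \<noteq> {}" "box a b \<inter> {x. inner x k > c} \<noteq> {}" by blast+
      qed
      ultimately have "interior ?l \<noteq> {}" "interior ?r \<noteq> {}" by blast+
      with that have "matchable g ?l" "matchable g ?r" unfolding P_def by blast+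
      then show ?thesis using matchable_glue[OF convex_box(1) k] unfolding P_def by blast
    qed
    moreover have "P ?l" "P ?r" if "P (cbox a b)" using that by (auto intro: P_mono)
    ultimately show "P (cbox a b) = (P ?l \<and> P ?r)" by blast
  qed
  have "P K" if "K \<in> snd ` p" for K
  proof -
    from that obtain x where "(x, K) \<in> p" by auto
    then have "K \<subseteq> ball x (r x)" using p(2) by (auto simp: fine_def)
    with r[of x] show ?thesis using matchable_mono unfolding P_def by blast
  qed
  then have "P (cbox a b)"
    using division[OF division_of_tagged_division[OF p(1)]] by (auto simp: comm_monoid_set_F_and)
  then show ?thesis unfolding P_def using ne by (simp add: interior_cbox)
qed

end

section \<open>The geometry of a unit rhombus\<close>

text \<open>The signed area of the parallelogram spanned by two complex numbers.\<close>

definition cross_prod :: "complex \<Rightarrow> complex \<Rightarrow> real" where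
  "cross_prod u v = Re u * Im v - Im u * Re v"

text \<open>The unit rhombus \<open>T\<close> has the corner \<open>a\<close>, with edge vectors \<open>u\<close> and \<open>v\<close> issuing from it. The lemmas
\<open>rhombus_swap\<close> and \<open>rhombus_flip\<close> generate all descriptions of the same rhombus.\<close>

definition rhombus_at :: "complex set \<Rightarrow> complex \<Rightarrow> complex \<Rightarrow> complex \<Rightarrow> bool" where
  "rhombus_at T a u v \<longleftrightarrow> norm u = 1 \<and> norm v = 1 \<and> u \<noteq> v \<and> u \<noteq> - v \<and>
     T = convex hull {a, a + u, a + u + v, a + v}"

lemma unit_rhombus_iff: "unit_rhombus T \<longleftrightarrow> (\<exists>a u v. rhombus_at T a u v)"
  unfolding unit_rhombus_def rhombus_at_def by blast

lemma rhombus_swap: "rhombus_at T a u v \<Longrightarrow> rhombus_at T a v u"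
  unfolding rhombus_at_def by (auto simp: insert_commute add.commute add.left_commute)

lemma rhombus_flip: "rhombus_at T a u v \<Longrightarrow> rhombus_at T (a + u) (- u) v"
  unfolding rhombus_at_def
  by (auto simp: insert_commute add.commute add.left_commute minus_equation_iff[of u])

lemma cross_prod_ne0:
  assumes "norm u = 1" "norm v = 1" "u \<noteq> v" "u \<noteq> - v"
  shows "cross_prod u v \<noteq> 0"
proof
  assume 0: "cross_prod u v = 0"
  have u: "Re u * Re u + Im u * Im u = 1" and v: "Re v * Re v + Im v * Im v = 1"
    using assms(1,2) by (simp_all add: cmod_def power2_eq_square)
  let ?c = "Re u * Re v + Im u * Im v"
  have "?c * ?c + cross_prod u v * cross_prod u v = (Re u * Re u + Im u * Im u) * (Re v * Re v + Im v * Im v)"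
    unfolding cross_prod_def by (simp add: algebra_simps)
  then have "?c * ?c = 1" using 0 u v by simp
  then have c: "?c = 1 \<or> ?c = -1" using square_eq_1_iff by blast
  have "?c * Re u + cross_prod u v * (- Im u) = Re v * (Re u * Re u + Im u * Im u)"
    "?c * Im u + cross_prod u v * Re u = Im v * (Re u * Re u + Im u * Im u)"
    unfolding cross_prod_def by (simp_all add: algebra_simps)
  then have "?c * Re u = Re v" "?c * Im u = Im v" using 0 u by simp_all
  then show False using c assms(3,4) by (auto simp: complex_eq_iff)
qed

text \<open>The coefficient of \<open>u\<close> when a complex number is written in the real basis \<open>u\<close>, \<open>v\<close> (Cramer's rule).\<close>

definition coord :: "complex \<Rightarrow> complex \<Rightarrow> complex \<Rightarrow> real" where
  "coord u v x = cross_prod x v / cross_prod u v"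

lemma coord_add [simp]: "coord u v (x + y) = coord u v x + coord u v y"
  and coord_diff [simp]: "coord u v (x - y) = coord u v x - coord u v y"
  and coord_scaleR [simp]: "coord u v (r *\<^sub>R x) = r * coord u v x"
  by (simp_all add: coord_def cross_prod_def field_simps add_divide_distrib diff_divide_distrib)

lemma cross_prod_swap: "cross_prod u v = - cross_prod v u"
  by (simp add: cross_prod_def)

lemma rhombus_cross: "rhombus_at T a u v \<Longrightarrow> cross_prod u v \<noteq> 0 \<and> cross_prod v u \<noteq> 0"
  using cross_prod_ne0[of u v] cross_prod_swap[of u v] unfolding rhombus_at_def by auto

lemma coord_self:
  assumes "cross_prod u v \<noteq> 0"
  shows "coord u v u = 1" "coord u v v = 0"
  using assms by (simp_all add: coord_def) (simp add: cross_prod_def)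

lemma coord_decomp:
  assumes "cross_prod u v \<noteq> 0"
  shows "x = coord u v x *\<^sub>R u + coord v u x *\<^sub>R v"
proof -
  have "coord v u x = - cross_prod x u / cross_prod u v"
    by (simp add: coord_def cross_prod_swap[of v u])
  then show ?thesis using assms
    by (simp add: complex_eq_iff coord_def divide_simps) (simp add: cross_prod_def algebra_simps)
qed

lemma coord_decomp_at:
  assumes "cross_prod u v \<noteq> 0"
  shows "a + coord u v (x - a) *\<^sub>R u + coord v u (x - a) *\<^sub>R v = x"
  by (simp only: add.assoc coord_decomp[OF assms, of "x - a", symmetric]) simp

lemma rhombus_eq:
  assumes "rhombus_at T a u v"
  shows "T = {x. 0 \<le> coord u v (x - a) \<and> coord u v (x - a) \<le> 1 \<and> 0 \<le> coord v u (x - a) \<and> coord v u (x - a) \<le> 1}"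
    (is "_ = ?P")
proof -
  note c = rhombus_cross[OF assms]
  note cs = coord_self[OF conjunct1[OF c]] coord_self[OF conjunct2[OF c]]
  have hull: "T = convex hull {a, a + u, a + u + v, a + v}" using assms unfolding rhombus_at_def by blast
  have "convex ?P"
  proof (rule convexI)
    fix x y s t :: "_" assume xy: "x \<in> ?P" "y \<in> ?P" and st: "0 \<le> s" "0 \<le> t" "s + t = (1::real)"
    have *: "0 \<le> k (s *\<^sub>R x + t *\<^sub>R y - a) \<and> k (s *\<^sub>R x + t *\<^sub>R y - a) \<le> 1"
      if k: "k = coord u v \<or> k = coord v u" for k
    proof -
      have "s *\<^sub>R x + t *\<^sub>R y - a = s *\<^sub>R (x - a) + t *\<^sub>R (y - a)"
        using st by (simp add: algebra_simps) (metis scaleR_add_left scaleR_one add.commute)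
      then have "k (s *\<^sub>R x + t *\<^sub>R y - a) = s * k (x - a) + t * k (y - a)"
        using k by auto
      moreover have "0 \<le> k (x - a)" "k (x - a) \<le> 1" "0 \<le> k (y - a)" "k (y - a) \<le> 1" using xy k by auto
      ultimately show ?thesis using st convex_bound_le[of "k (x - a)" 1 "k (y - a)" s t] by simp
    qed
    show "s *\<^sub>R x + t *\<^sub>R y \<in> ?P" using *[of "coord u v"] *[of "coord v u"] by simp
  qed
  moreover have "{a, a + u, a + u + v, a + v} \<subseteq> ?P" using cs by (simp add: coord_def[of _ _ 0] cross_prod_def[of 0])
  ultimately have "T \<subseteq> ?P" unfolding hull by (intro hull_minimal) auto
  moreover have "x \<in> T" if "x \<in> ?P" for x
  proof -
    define s t where "s = coord u v (x - a)" and "t = coord v u (x - a)"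
    have st: "0 \<le> s" "s \<le> 1" "0 \<le> t" "t \<le> 1" using that by (auto simp: s_def t_def)
    have x: "x = a + s *\<^sub>R u + t *\<^sub>R v"
      unfolding s_def t_def by (rule coord_decomp_at[OF conjunct1[OF c], symmetric])
    have T: "convex T" "a \<in> T" "a + u \<in> T" "a + u + v \<in> T" "a + v \<in> T"
      unfolding hull by (simp_all add: hull_inc)
    have p: "(1 - s) *\<^sub>R a + s *\<^sub>R (a + u) \<in> T" "(1 - s) *\<^sub>R (a + v) + s *\<^sub>R (a + u + v) \<in> T"
      using T st by (simp_all add: convexD)
    have "(1 - t) *\<^sub>R ((1 - s) *\<^sub>R a + s *\<^sub>R (a + u)) + t *\<^sub>R ((1 - s) *\<^sub>R (a + v) + s *\<^sub>R (a + u + v)) \<in> T"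
      using convexD[OF T(1) p, of "1 - t" t] st by simp
    also have "(1 - t) *\<^sub>R ((1 - s) *\<^sub>R a + s *\<^sub>R (a + u)) + t *\<^sub>R ((1 - s) *\<^sub>R (a + v) + s *\<^sub>R (a + u + v)) = x"
      unfolding x by (simp add: algebra_simps)
    finally show ?thesis .
  qed
  ultimately show ?thesis by blast
qed

lemma rhombus_corners:
  assumes "rhombus_at T a u v"
  shows "a \<in> T" "a + u \<in> T" "a + v \<in> T" "a + u + v \<in> T"
  using assms unfolding rhombus_at_def by (auto intro: hull_inc)

lemma rhombus_convex: "rhombus_at T a u v \<Longrightarrow> convex T"
  unfolding rhombus_at_def by auto

lemma rhombus_compact: "rhombus_at T a u v \<Longrightarrow> compact T"
  unfolding rhombus_at_def by (auto intro!: finite_imp_compact_convex_hull)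

lemma continuous_coord: "continuous_on A (\<lambda>x. coord u v (x - a))"
  unfolding coord_def cross_prod_def divide_inverse by (intro continuous_intros)

lemma rhombus_center_interior:
  assumes "rhombus_at T a u v"
  shows "a + (1/2) *\<^sub>R (u + v) \<in> interior T"
proof -
  note c = rhombus_cross[OF assms]
  note cs = coord_self[OF conjunct1[OF c]] coord_self[OF conjunct2[OF c]]
  let ?O = "{x. 0 < coord u v (x - a)} \<inter> {x. coord u v (x - a) < 1} \<inter>
    ({x. 0 < coord v u (x - a)} \<inter> {x. coord v u (x - a) < 1})"
  have "open ?O"
    by (intro open_Int open_Collect_less continuous_coord continuous_on_const)
  moreover have "?O \<subseteq> T" using rhombus_eq[OF assms] by auto
  moreover have "a + (1/2) *\<^sub>R (u + v) \<in> ?O" by (simp add: cs)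
  ultimately show ?thesis using interiorI by blast
qed

lemma rhombus_dist:
  assumes "rhombus_at T a u v" "x \<in> T" "y \<in> T"
  shows "dist x y \<le> 4"
proof -
  have *: "dist x a \<le> 2" if "x \<in> T" for x
  proof -
    define s t where "s = coord u v (x - a)" and "t = coord v u (x - a)"
    have st: "0 \<le> s" "s \<le> 1" "0 \<le> t" "t \<le> 1"
      using that rhombus_eq[OF assms(1)] by (auto simp: s_def t_def)
    have x: "x - a = s *\<^sub>R u + t *\<^sub>R v"
      unfolding s_def t_def by (rule coord_decomp[OF conjunct1[OF rhombus_cross[OF assms(1)]]])
    have "norm (x - a) \<le> s * norm u + t * norm v"
      unfolding x using st norm_triangle_ineq[of "s *\<^sub>R u" "t *\<^sub>R v"] by simp
    then show ?thesis using assms(1) st unfolding rhombus_at_def dist_norm by simp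
  qed
  from *[OF assms(2)] *[OF assms(3)] show ?thesis
    using dist_triangle2[of x y a] by simp
qed

lemma rhombus_side_face:
  assumes "rhombus_at T a u v"
  shows "closed_segment a (a + u) face_of T"
proof -
  note c = rhombus_cross[OF assms]
  note cs = coord_self[OF conjunct1[OF c]] coord_self[OF conjunct2[OF c]]
  \<comment> \<open>The vector \<open>w\<close> represents the coordinate along \<open>v\<close>, which is smallest on the side.\<close>
  define w where "w = (1 / cross_prod v u) *\<^sub>R Complex (Im u) (- Re u)"
  have w: "inner w x = coord v u x" for x
    unfolding w_def coord_def cross_prod_def inner_complex_def by (simp add: field_simps diff_divide_distrib)
  have "(T \<inter> {x. inner w x = inner w a}) face_of T"
  proof (rule face_of_Int_supporting_hyperplane_ge[OF rhombus_convex[OF assms]])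
    fix x assume "x \<in> T"
    then have "0 \<le> coord v u (x - a)" using rhombus_eq[OF assms] by auto
    then show "inner w x \<ge> inner w a" by (simp add: w)
  qed
  also have "T \<inter> {x. inner w x = inner w a} = closed_segment a (a + u)"
  proof (intro equalityI subsetI)
    fix x assume "x \<in> T \<inter> {x. inner w x = inner w a}"
    then have "0 \<le> coord u v (x - a)" "coord u v (x - a) \<le> 1" "coord v u (x - a) = 0"
      using rhombus_eq[OF assms] by (auto simp: w)
    moreover have "x = a + coord u v (x - a) *\<^sub>R u + coord v u (x - a) *\<^sub>R v"
      by (rule coord_decomp_at[OF conjunct1[OF c], symmetric])
    ultimately have "x = (1 - coord u v (x - a)) *\<^sub>R a + coord u v (x - a) *\<^sub>R (a + u)"
      by (simp del: coord_diff add: scaleR_diff_left scaleR_add_right)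
    with \<open>0 \<le> coord u v (x - a)\<close> \<open>coord u v (x - a) \<le> 1\<close> show "x \<in> closed_segment a (a + u)"
      unfolding closed_segment_def by blast
  next
    fix x assume "x \<in> closed_segment a (a + u)"
    then obtain r where r: "0 \<le> r" "r \<le> 1" "x = (1 - r) *\<^sub>R a + r *\<^sub>R (a + u)"
      unfolding closed_segment_def by blast
    then have "x = a + r *\<^sub>R u" by (simp add: algebra_simps)
    then show "x \<in> T \<inter> {x. inner w x = inner w a}"
      using rhombus_eq[OF assms] r(1,2) by (simp add: w cs)
  qed
  finally show ?thesis .
qed

lemma rhombus_ne0: "rhombus_at T a u v \<Longrightarrow> u \<noteq> 0 \<and> v \<noteq> 0"
  unfolding rhombus_at_def by auto

lemma rhombus_side_edge:
  assumes "rhombus_at T a u v"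
  shows "closed_segment a (a + u) edge_of T"
  using rhombus_side_face[OF assms] rhombus_ne0[OF assms]
  by (simp add: edge_of_def segment_convex_hull aff_dim_convex_hull)

lemma rhombus_corner_extreme:
  assumes "rhombus_at T a u v"
  shows "a extreme_point_of T"
  using extreme_point_of_face[OF rhombus_side_face[OF assms], of a] extreme_point_of_segment[of a a "a + u"]
  by simp

lemma extreme_point_rhombus:
  assumes "rhombus_at T a u v" "z extreme_point_of T"
  shows "z \<in> {a, a + u, a + u + v, a + v}"
  using assms extreme_point_of_convex_hull unfolding rhombus_at_def by blast

text \<open>The real-linear function with values \<open>n u\<close> at \<open>u\<close> and \<open>n v\<close> at \<open>v\<close>. For odd \<open>n\<close> it is the same for all
descriptions of a rhombus.\<close>

definition lin_ext :: "(complex \<Rightarrow> real) \<Rightarrow> complex \<Rightarrow> complex \<Rightarrow> complex \<Rightarrow> real" where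
  "lin_ext n u v x = coord u v x * n u + coord v u x * n v"

lemma lin_ext_diff: "lin_ext n u v (x - y) = lin_ext n u v x - lin_ext n u v y"
  and lin_ext_scale: "lin_ext n u v (r *\<^sub>R x) = r * lin_ext n u v x"
  by (simp_all add: lin_ext_def algebra_simps)

lemma lin_ext_swap: "lin_ext n v u = lin_ext n u v"
  by (simp add: lin_ext_def fun_eq_iff)

definition odd_fun :: "(complex \<Rightarrow> real) \<Rightarrow> bool" where
  "odd_fun n \<longleftrightarrow> (\<forall>u. n (- u) = - n u)"

lemma lin_ext_flip:
  assumes "odd_fun n"
  shows "lin_ext n (- u) v = lin_ext n u v"
proof -
  have c: "cross_prod (- u) v = - cross_prod u v" "cross_prod v (- u) = - cross_prod v u" for u v
    by (simp_all add: cross_prod_def)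
  have "coord (- u) v x = - coord u v x" "coord v (- u) x = coord v u x" for x
    by (simp_all add: coord_def c)
  then show ?thesis using assms by (simp add: lin_ext_def fun_eq_iff odd_fun_def)
qed

lemma lin_ext_self:
  "rhombus_at T a u v \<Longrightarrow> lin_ext n u v u = n u"
  using coord_self rhombus_cross by (simp add: lin_ext_def)

text \<open>A proper nonempty face is the hull of some corners. Two opposite corners cannot both belong to it,
since their midpoint is an interior point. So it is a corner or a side, and the rhombus can be
described such that it is the first corner or the first side.\<close>

lemma rhombus_proper_face:
  assumes T: "rhombus_at T a u v" and K: "K face_of T" "K \<noteq> T" "K \<noteq> {}"
    and odd: "odd_fun n"
  shows "\<exists>a' u' v'. rhombus_at T a' u' v' \<and> lin_ext n u' v' = lin_ext n u v \<and>
    (K = {a'} \<or> K = closed_segment a' (a' + u'))"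
proof -
  have hull: "T = convex hull {a, a + u, a + u + v, a + v}" using T unfolding rhombus_at_def by blast
  obtain C where C: "C \<subseteq> {a, a + u, a + u + v, a + v}" "K = convex hull C"
    using face_of_convex_hull_subset[of "{a, a + u, a + u + v, a + v}" K] K(1) unfolding hull
    by (metis finite.emptyI finite_imp_compact finite_insert)
  have KC: "C \<subseteq> K" "convex K" unfolding C(2) by (auto simp: hull_subset)
  have "a + (1/2) *\<^sub>R (u + v) \<notin> K"
    using face_of_disjoint_interior[OF K(1,2)] rhombus_center_interior[OF T] by blast
  moreover have "midpoint x y \<in> K" if "x \<in> C" "y \<in> C" for x y
  proof -
    have "midpoint x y \<in> closed_segment x y" by simp
    then show ?thesis using KC closed_segment_subset that by blast
  qed
  moreover have "midpoint a (a + u + v) = a + (1/2) *\<^sub>R (u + v)" "midpoint (a + u) (a + v) = a + (1/2) *\<^sub>R (u + v)"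
    by (simp_all add: midpoint_def complex_eq_iff field_simps)
  ultimately have not_opp: "\<not> (a \<in> C \<and> a + u + v \<in> C)" "\<not> (a + u \<in> C \<and> a + v \<in> C)" by metis+
  have "C \<noteq> {}" using C K(3) by auto
  define R where "R = (\<lambda>a' u' v'. rhombus_at T a' u' v' \<and> lin_ext n u' v' = lin_ext n u v)"
  have R_sym: "R a' v' u'" "R (a' + u') (- u') v'" if "R a' u' v'" for a' u' v'
    using that rhombus_swap rhombus_flip lin_ext_swap lin_ext_flip[OF odd] unfolding R_def by metis+
  have R0: "R a u v" using T by (simp add: R_def)
  have R1: "R a v u" "R (a + u) v (- u)" "R (a + v) u (- v)"
    using R0 R_sym by blast+
  have side: "\<exists>a' u' v'. R a' u' v' \<and> (K = {a'} \<or> K = closed_segment a' (a' + u'))"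
    if "R p w z" "C \<subseteq> {p, p + w}" for p w z
  proof -
    have "C = {p} \<or> C = {p + w} \<or> C = {p, p + w}" using that(2) \<open>C \<noteq> {}\<close> by blast
    then show ?thesis
    proof (elim disjE)
      assume "C = {p + w}"
      then have "K = {p + w}" using C(2) by simp
      then show ?thesis using R_sym(2)[OF that(1)] by blast
    qed (use that(1) C(2) in \<open>auto simp: segment_convex_hull\<close>)
  qed
  have "a + v + u = a + u + v" by simp
  have "C \<subseteq> {a, a + u} \<or> C \<subseteq> {a, a + v} \<or> C \<subseteq> {a + u, a + u + v} \<or> C \<subseteq> {a + v, a + v + u}"
  proof (cases "a \<in> C"; cases "a + u \<in> C")
    assume "a \<in> C" "a + u \<in> C"
    with not_opp have "C \<subseteq> {a, a + u}" using C(1) by fast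
    then show ?thesis by simp
  next
    assume "a \<in> C" "a + u \<notin> C"
    with not_opp have "C \<subseteq> {a, a + v}" using C(1) by fast
    then show ?thesis by simp
  next
    assume "a \<notin> C" "a + u \<in> C"
    with not_opp have "C \<subseteq> {a + u, a + u + v}" using C(1) by fast
    then show ?thesis by simp
  next
    assume "a \<notin> C" "a + u \<notin> C"
    then have "C \<subseteq> {a + v, a + v + u}" unfolding \<open>a + v + u = a + u + v\<close> using C(1) by fast
    then show ?thesis by simp
  qed
  then have "\<exists>a' u' v'. R a' u' v' \<and> (K = {a'} \<or> K = closed_segment a' (a' + u'))"
    by (elim disjE) (rule side[OF R0], assumption, rule side[OF R1(1)], assumption,
      rule side[OF R1(2)], assumption, rule side[OF R1(3)], assumption)
  then show ?thesis unfolding R_def by blast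
qed

section \<open>Tiles and edges of a rhombic lattice\<close>

lemma rhombic_latticeD:
  assumes "rhombic_lattice L"
  shows "T \<in> L \<Longrightarrow> unit_rhombus T"
    and "S \<in> L \<Longrightarrow> T \<in> L \<Longrightarrow> congruent_sets S T"
    and "\<exists>T\<in>L. p \<in> T"
    and "S \<in> L \<Longrightarrow> T \<in> L \<Longrightarrow> S \<noteq> T \<Longrightarrow> interior S \<inter> interior T = {}"
    and "S \<in> L \<Longrightarrow> T \<in> L \<Longrightarrow> S \<inter> T face_of S"
proof -
  note L = assms[unfolded rhombic_lattice_def]
  show "T \<in> L \<Longrightarrow> unit_rhombus T" using L by simp
  show "S \<in> L \<Longrightarrow> T \<in> L \<Longrightarrow> congruent_sets S T" using L by simp
  have "p \<in> \<Union>L" using L by simp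
  then show "\<exists>T\<in>L. p \<in> T" by simp
  show "S \<in> L \<Longrightarrow> T \<in> L \<Longrightarrow> S \<noteq> T \<Longrightarrow> interior S \<inter> interior T = {}" using L by simp
  show "S \<in> L \<Longrightarrow> T \<in> L \<Longrightarrow> S \<inter> T face_of S" using L by simp
qed

lemma lattice_rhombus:
  assumes "rhombic_lattice L" "T \<in> L"
  obtains a u v where "rhombus_at T a u v"
proof -
  have "unit_rhombus T" using assms by (rule rhombic_latticeD(1))
  then show ?thesis using that by (auto simp: unit_rhombus_iff)
qed

text \<open>The tiles contain discs of a common radius: a disc in one tile is carried to the others by the
isometries, which are surjective.\<close>

lemma lattice_inradius:
  assumes L: "rhombic_lattice L"
  shows "\<exists>\<rho>>0. \<forall>T\<in>L. \<exists>c. ball c \<rho> \<subseteq> T"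
proof -
  obtain S where S: "S \<in> L" using rhombic_latticeD(3)[OF L] by blast
  obtain a u v where "rhombus_at S a u v" using lattice_rhombus[OF L S] .
  from rhombus_center_interior[OF this] obtain c \<rho> where \<rho>: "\<rho> > 0" "ball c \<rho> \<subseteq> S"
    unfolding mem_interior by blast
  have "\<exists>c. ball c \<rho> \<subseteq> T" if "T \<in> L" for T
  proof -
    have "congruent_sets S T" using L S that by (rule rhombic_latticeD(2))
    then obtain g where g: "\<And>x y. dist (g x) (g y) = dist x y" "g ` S = T"
      unfolding congruent_sets_def by blast
    have "orthogonal_transformation (\<lambda>x. g x - g 0)"
      unfolding orthogonal_transformation_isometry using g(1) by (simp add: dist_norm)
    then have "surj (\<lambda>x. g x - g 0)" by (rule orthogonal_transformation_surj)
    have "ball (g c) \<rho> \<subseteq> T"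
    proof
      fix y assume y: "y \<in> ball (g c) \<rho>"
      obtain x where "y - g 0 = g x - g 0" using \<open>surj (\<lambda>x. g x - g 0)\<close> by (rule surjE)
      then have "y = g x" by simp
      with y g(1)[of c x] have "x \<in> ball c \<rho>" by simp
      with \<rho>(2) g(2) \<open>y = g x\<close> show "y \<in> T" by blast
    qed
    then show ?thesis by blast
  qed
  with \<rho>(1) show ?thesis by blast
qed

text \<open>The centres of the discs are separated because the tiles have disjoint interiors, and those of the
tiles near \<open>p\<close> lie in a bounded region.\<close>

lemma lattice_locally_finite:
  assumes L: "rhombic_lattice L"
  shows "finite {T \<in> L. T \<inter> ball p 1 \<noteq> {}}" (is "finite ?F")
proof -
  from lattice_inradius[OF L] obtain \<rho> where \<rho>: "\<rho> > 0" "\<forall>T\<in>L. \<exists>c. ball c \<rho> \<subseteq> T" by blast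
  then obtain c where c: "ball (c T) \<rho> \<subseteq> T" if "T \<in> L" for T by metis
  have sep: "S = T" if "S \<in> L" "T \<in> L" "dist (c S) (c T) < \<rho>" for S T
  proof (rule ccontr)
    assume "S \<noteq> T"
    with L that(1,2) have "interior S \<inter> interior T = {}" by (rule rhombic_latticeD(4))
    moreover have "ball (c S) \<rho> \<subseteq> interior S" "ball (c T) \<rho> \<subseteq> interior T"
      using c that by (simp_all add: interior_maximal)
    moreover have "c T \<in> ball (c S) \<rho>" "c T \<in> ball (c T) \<rho>" using that \<rho> by simp_all
    ultimately show False by blast
  qed
  have "uniform_discrete (c ` ?F)"
    unfolding uniform_discrete_def
  proof (intro exI[of _ \<rho>] conjI ballI impI)
    fix x y assume "x \<in> c ` ?F" "y \<in> c ` ?F" "dist x y < \<rho>"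
    then show "x = y" using sep by blast
  qed (fact \<rho>(1))
  moreover have "c ` ?F \<subseteq> cball p 5"
  proof
    fix x assume "x \<in> c ` ?F"
    then obtain T where T': "T \<in> L" "x = c T" "T \<inter> ball p 1 \<noteq> {}" by blast
    from T'(3) obtain q where "q \<in> T \<inter> ball p 1" by blast
    with T' have T: "T \<in> L" "x = c T" "q \<in> T" "dist p q < 1" by simp_all
    obtain a u v where "rhombus_at T a u v" using lattice_rhombus[OF L T(1)] .
    moreover have "c T \<in> T" using c[OF T(1)] \<rho>(1) by auto
    ultimately have "dist q (c T) \<le> 4" using T(3) by (intro rhombus_dist)
    with T show "x \<in> cball p 5" using dist_triangle[of p "c T" q] by simp
  qed
  then have "bounded (c ` ?F)" by (rule bounded_subset[OF bounded_cball])
  ultimately have "finite (c ` ?F)" using uniform_discrete_finite_iff by blast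
  moreover have "inj_on c ?F" using sep \<rho>(1) by (intro inj_onI) simp
  ultimately show ?thesis by (rule finite_imageD)
qed

lemma lattice_tile_cover:
  assumes L: "rhombic_lattice L"
  shows "tile_cover L"
proof
  show "convex T" if T: "T \<in> L" for T
  proof -
    obtain a u v where "rhombus_at T a u v" using lattice_rhombus[OF L T] .
    then show ?thesis by (rule rhombus_convex)
  qed
  show "\<exists>T\<in>L. p \<in> T" for p by (rule rhombic_latticeD(3)[OF L])
  show "\<exists>r>0. \<forall>q\<in>ball p r. \<forall>T\<in>L. q \<in> T \<longrightarrow> p \<in> T" for p
  proof -
    let ?U = "\<Union>{T \<in> L. T \<inter> ball p 1 \<noteq> {} \<and> p \<notin> T}"
    have "closed T" if T: "T \<in> L" for T
    proof -
      obtain a u v where "rhombus_at T a u v" using lattice_rhombus[OF L T] .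
      from rhombus_compact[OF this] show ?thesis by (rule compact_imp_closed)
    qed
    moreover have "finite {T \<in> L. T \<inter> ball p 1 \<noteq> {} \<and> p \<notin> T}"
      by (rule finite_subset[OF _ lattice_locally_finite[OF L, of p]]) blast
    ultimately have "closed ?U" by (intro closed_Union) auto
    then have "open (ball p 1 - ?U)" by (intro open_Diff open_ball)
    moreover have "p \<in> ball p 1 - ?U" by simp
    ultimately obtain r where r: "r > 0" "ball p r \<subseteq> ball p 1 - ?U"
      unfolding open_contains_ball by blast
    then have "\<forall>q\<in>ball p r. \<forall>T\<in>L. q \<in> T \<longrightarrow> p \<in> T" by blast
    with r(1) show ?thesis by blast
  qed
qed

lemma lattice_Int_face:
  assumes "rhombic_lattice L" "S \<in> L" "T \<in> L" "S \<noteq> T"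
  shows "S \<inter> T face_of S" "S \<inter> T \<noteq> S"
proof -
  show "S \<inter> T face_of S" using assms(1-3) by (rule rhombic_latticeD(5))
  obtain a u v where "rhombus_at S a u v" using lattice_rhombus[OF assms(1,2)] .
  from rhombus_center_interior[OF this] have "interior S \<noteq> {}" by blast
  moreover have "interior S \<inter> interior T = {}"
    using assms by (rule rhombic_latticeD(4))
  ultimately show "S \<inter> T \<noteq> S" using interior_mono[of S T] by blast
qed

text \<open>An edge is the first side of some description of a tile. The description is related to a chosen one,
\<open>a T\<close>, \<open>u T\<close>, \<open>v T\<close>, by having the same linear function.\<close>

lemma edge_rhombus:
  assumes L: "rhombic_lattice L" and "(c, d) \<in> edges L"
    and n: "odd_fun n" and rep: "\<forall>T\<in>L. rhombus_at T (a T) (u T) (v T)"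
  shows "\<exists>T w z. T \<in> L \<and> rhombus_at T c w z \<and> d = c + w \<and> lin_ext n w z = lin_ext n (u T) (v T)"
proof -
  obtain T where T: "T \<in> L" "closed_segment c d edge_of T"
    using assms(2) unfolding edges_def by blast
  let ?K = "closed_segment c d"
  note rT = bspec[OF rep T(1)]
  have K: "?K face_of T" "aff_dim ?K = 1" using T(2) unfolding edge_of_def by blast+
  have "aff_dim T = 2"
    using aff_dim_nonempty_interior[of T] rhombus_center_interior[OF rT] by auto
  with K(2) have "?K \<noteq> T" by auto
  then obtain p w z where p: "rhombus_at T p w z" "lin_ext n w z = lin_ext n (u T) (v T)"
      "?K = {p} \<or> ?K = closed_segment p (p + w)"
    using rhombus_proper_face[OF rT K(1) _ _ n] by auto
  from p(3) show ?thesis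
  proof
    assume "?K = {p}"
    then show ?thesis using K(2) by simp
  next
    assume "?K = closed_segment p (p + w)"
    then have "{c, d} = {p, p + w}" by simp
    then consider "c = p" "d = p + w" | "c = p + w" "d = p" by (auto simp: doubleton_eq_iff)
    then show ?thesis
    proof cases
      case 1
      with p T(1) show ?thesis by blast
    next
      case 2
      have "rhombus_at T c (- w) z" "lin_ext n (- w) z = lin_ext n (u T) (v T)"
        using rhombus_flip[OF p(1)] lin_ext_flip[OF n] p(2) 2 by simp_all
      moreover have "d = c + - w" using 2 by simp
      ultimately show ?thesis using T(1) by blast
    qed
  qed
qed

lemma lattice_rep:
  assumes "rhombic_lattice L"
  obtains a u v where "\<forall>T\<in>L. rhombus_at T (a T) (u T) (v T)"
proof -
  have "\<forall>T\<in>L. \<exists>p. rhombus_at T (fst p) (fst (snd p)) (snd (snd p))"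
  proof
    fix T assume "T \<in> L"
    then obtain a u v where "rhombus_at T a u v" by (rule lattice_rhombus[OF assms])
    then show "\<exists>p. rhombus_at T (fst p) (fst (snd p)) (snd (snd p))" by (intro exI[of _ "(a, u, v)"]) simp
  qed
  then obtain f where "\<forall>T\<in>L. rhombus_at T (fst (f T)) (fst (snd (f T))) (snd (snd (f T)))"
    using bchoice by meson
  then show ?thesis
    by (intro that[of "\<lambda>T. fst (f T)" "\<lambda>T. fst (snd (f T))" "\<lambda>T. snd (snd (f T))"]) blast
qed

lemma odd_fun_zero: "odd_fun (\<lambda>_. 0)"
  by (simp add: odd_fun_def)

lemma edges_iff:
  assumes L: "rhombic_lattice L"
  shows "(c, d) \<in> edges L \<longleftrightarrow> (\<exists>T\<in>L. \<exists>z. rhombus_at T c (d - c) z)"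
proof
  assume cd: "(c, d) \<in> edges L"
  obtain a u v where "\<forall>T\<in>L. rhombus_at T (a T) (u T) (v T)" using lattice_rep[OF L] .
  from edge_rhombus[OF L cd odd_fun_zero this] obtain T w z
    where "T \<in> L" "rhombus_at T c w z" "d = c + w" by (elim exE conjE)
  then have "rhombus_at T c (d - c) z" by simp
  with \<open>T \<in> L\<close> show "\<exists>T\<in>L. \<exists>z. rhombus_at T c (d - c) z" by (intro bexI exI)
next
  assume "\<exists>T\<in>L. \<exists>z. rhombus_at T c (d - c) z"
  then obtain T z where "T \<in> L" "rhombus_at T c (d - c) z" by blast
  with rhombus_side_edge[OF this(2)] show "(c, d) \<in> edges L" unfolding edges_def by auto
qed

lemma edges_sym:
  assumes "rhombic_lattice L" "(c, d) \<in> edges L"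
  shows "(d, c) \<in> edges L"
  using assms rhombus_flip[of _ c "d - c"] by (auto simp: edges_iff)

lemma edges_vertices:
  assumes "rhombic_lattice L" "(c, d) \<in> edges L"
  shows "c \<in> vertices L" "d \<in> vertices L"
proof -
  have *: "c \<in> vertices L" if "(c, d) \<in> edges L" for c d
    using that assms(1) rhombus_corner_extreme unfolding edges_iff[OF assms(1)] vertices_def by blast
  show "c \<in> vertices L" "d \<in> vertices L" using * assms edges_sym by blast+
qed

lemma lin_ext_compatible:
  assumes L: "rhombic_lattice L" and n: "odd_fun n"
    and rep: "\<forall>T\<in>L. rhombus_at T (a T) (u T) (v T)"
  shows "tile_cover.compatible L (\<lambda>T. lin_ext n (u T) (v T))"
proof -
  interpret tile_cover L using lattice_tile_cover[OF L] .
  have *: "lin_ext n (u S) (v S) (y - x) = lin_ext n (u T) (v T) (y - x)"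
    if ST: "S \<in> L" "T \<in> L" "x \<in> S \<inter> T" "y \<in> S \<inter> T" "S \<noteq> T" "x \<noteq> y" for S T x y
  proof -
    let ?K = "S \<inter> T"
    have seg: "\<exists>p w. S \<inter> T = closed_segment p (p + w) \<and> lin_ext n (u S) (v S) w = n w \<and> w \<noteq> 0"
      if K: "S \<inter> T face_of S" "S \<inter> T \<noteq> S" and S: "S \<in> L" and "x \<in> S \<inter> T" "y \<in> S \<inter> T" for S T
    proof -
      have "S \<inter> T \<noteq> {}" using that(4) by auto
      then obtain p w z where p: "rhombus_at S p w z" "lin_ext n w z = lin_ext n (u S) (v S)"
          "S \<inter> T = {p} \<or> S \<inter> T = closed_segment p (p + w)"
        using rhombus_proper_face[OF bspec[OF rep S] K _ n] by blast
      have "S \<inter> T \<noteq> {p}" using that(4,5) \<open>x \<noteq> y\<close> by (metis singletonD)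
      moreover have "lin_ext n (u S) (v S) w = n w" using lin_ext_self[OF p(1)] p(2) by metis
      moreover have "w \<noteq> 0" using rhombus_ne0[OF p(1)] by simp
      ultimately show ?thesis using p(3) by (intro exI[of _ p] exI[of _ w]) simp
    qed
    obtain p w where p: "?K = closed_segment p (p + w)" "lin_ext n (u S) (v S) w = n w" "w \<noteq> 0"
      using seg[of S T] lattice_Int_face[OF L, of S T] ST by blast
    obtain q t where q: "?K = closed_segment q (q + t)" "lin_ext n (u T) (v T) t = n t" "t \<noteq> 0"
      using seg[of T S] lattice_Int_face[OF L, of T S] ST unfolding Int_commute[of T S] by blast
    have "{p, p + w} = {q, q + t}" using p(1) q(1) closed_segment_eq by metis
    then have "t = w \<or> t = - w" by (auto simp: doubleton_eq_iff eq_neg_iff_add_eq_0)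
    then have tw: "lin_ext n (u T) (v T) w = n w"
    proof
      assume "t = - w"
      then have "lin_ext n (u T) (v T) ((- 1) *\<^sub>R w) = n (- w)" using q(2) by simp
      then show ?thesis using n unfolding lin_ext_scale by (simp add: odd_fun_def)
    qed (use q in simp)
    obtain r s where rs: "x = (1 - r) *\<^sub>R p + r *\<^sub>R (p + w)" "y = (1 - s) *\<^sub>R p + s *\<^sub>R (p + w)"
      using ST(3,4) p(1) unfolding closed_segment_def by blast
    have "y - x = (s - r) *\<^sub>R w" unfolding rs by (simp add: algebra_simps)
    then show ?thesis using tw p(2) by (simp add: lin_ext_scale)
  qed
  show ?thesis unfolding compatible_def
  proof (intro ballI)
    fix S T x y assume ST: "S \<in> L" "T \<in> L" "x \<in> S \<inter> T" "y \<in> S \<inter> T"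
    show "lin_ext n (u S) (v S) y - lin_ext n (u S) (v S) x = lin_ext n (u T) (v T) y - lin_ext n (u T) (v T) x"
    proof (cases "S = T \<or> x = y")
      case True
      then show ?thesis by (elim disjE) simp_all
    next
      case False
      then have "S \<noteq> T" "x \<noteq> y" by simp_all
      from *[OF ST this] show ?thesis unfolding lin_ext_diff .
    qed
  qed
qed

text \<open>The difference vectors of consecutive points of a path.\<close>

fun steps :: "complex list \<Rightarrow> complex list" where
  "steps (a # b # zs) = (b - a) # steps (b # zs)"
| "steps _ = []"

lemma is_path_Cons:
  "is_path L (a # b # zs) \<longleftrightarrow> a \<in> vertices L \<and> (a, b) \<in> edges L \<and> is_path L (b # zs)"
  by (auto simp: is_path_def)

lemma is_path_single: "is_path L [a] \<longleftrightarrow> a \<in> vertices L"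
  by (simp add: is_path_def)

lemma path_telescope:
  fixes F :: "complex \<Rightarrow> real"
  assumes "is_path L zs"
    and "\<And>c d. (c, d) \<in> edges L \<Longrightarrow> c \<in> set zs \<Longrightarrow> d \<in> set zs \<Longrightarrow> F d - F c = n (d - c)"
  shows "sum_list (map n (steps zs)) = F (last zs) - F (hd zs)"
  using assms
proof (induction zs rule: steps.induct)
  case (1 a b zs)
  have "sum_list (map n (steps (b # zs))) = F (last (b # zs)) - F (hd (b # zs))"
    using 1 by (simp add: is_path_Cons)
  moreover have "F b - F a = n (b - a)" using 1 by (simp add: is_path_Cons)
  ultimately show ?case by simp
qed (simp_all add: is_path_def)

text \<open>An odd function of the edge vectors has a potential on every box, so it sums to zero around each
closed path.\<close>

lemma closed_path_sum:
  assumes L: "rhombic_lattice L" and n: "odd_fun n" and zs: "is_path_between L a a zs"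
  shows "sum_list (map n (steps zs)) = 0"
proof -
  interpret tile_cover L using lattice_tile_cover[OF L] .
  obtain p u v where rep: "\<forall>T\<in>L. rhombus_at T (p T) (u T) (v T)" using lattice_rep[OF L] .
  let ?g = "\<lambda>T. lin_ext n (u T) (v T)"
  \<comment> \<open>The point 1 only serves to make the set, and hence the box, nonempty.\<close>
  have "bounded (insert 1 (set zs))" by (simp add: finite_imp_bounded)
  then obtain q where q: "insert 1 (set zs) \<subseteq> box (- q) q"
    using bounded_subset_box_symmetric by metis
  then have "matchable ?g (cbox (- q) q)"
    by (intro matchable_cbox lin_ext_compatible[OF L n rep]) auto
  then obtain F where F: "matches ?g (cbox (- q) q) F" by (rule matchableE)
  have zsq: "set zs \<subseteq> cbox (- q) q" using q box_subset_cbox by blast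
  have "F d - F c = n (d - c)" if cd: "(c, d) \<in> edges L" "c \<in> set zs" "d \<in> set zs" for c d
  proof -
    obtain T w z where T: "T \<in> L" "rhombus_at T c w z" "d = c + w" "lin_ext n w z = ?g T"
      using edge_rhombus[OF L cd(1) n rep] by (elim exE conjE)
    have "c \<in> T \<inter> cbox (- q) q" "d \<in> T \<inter> cbox (- q) q"
      using rhombus_corners[OF T(2)] T(3) cd zsq by auto
    then have "F d - F c = ?g T d - ?g T c" using F T(1) unfolding matches_def by blast
    also have "\<dots> = lin_ext n w z w" using T(3,4) lin_ext_diff[of n w z d c] by simp
    also have "\<dots> = n (d - c)" using lin_ext_self[OF T(2)] T(3) by simp
    finally show ?thesis .
  qed
  then have "sum_list (map n (steps zs)) = F (last zs) - F (hd zs)"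
    using zs unfolding is_path_between_def by (intro path_telescope[of L]) simp_all
  then show ?thesis using zs unfolding is_path_between_def by simp
qed

lemma corners_connected:
  assumes "rhombic_lattice L" "T \<in> L" "z extreme_point_of T" "z' extreme_point_of T"
  shows "(z, z') \<in> (edges L)\<^sup>*"
proof -
  obtain a u v where R: "rhombus_at T a u v" using lattice_rhombus[OF assms(1,2)] .
  have sym: "sym ((edges L)\<^sup>*)" using edges_sym[OF assms(1)] by (intro sym_rtrancl symI)
  have e: "(p, p + w) \<in> edges L" if "rhombus_at T p w t" for p w t
    using that assms(1,2) by (auto simp: edges_iff)
  have "(a, a + u) \<in> edges L" "(a, a + v) \<in> edges L" "(a + u, a + u + v) \<in> edges L"
    using e[OF R] e[OF rhombus_swap[OF R]] e[OF rhombus_swap[OF rhombus_flip[OF R]]] by simp_all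
  then have a: "(a, z) \<in> (edges L)\<^sup>*" if "z \<in> {a, a + u, a + u + v, a + v}" for z
    using that by (auto intro: rtrancl_trans)
  show ?thesis
    using a[OF extreme_point_rhombus[OF R assms(3)]] a[OF extreme_point_rhombus[OF R assms(4)]] sym
    by (meson rtrancl_trans symD)
qed

text \<open>Two tiles that meet have a corner in common, because they meet in a face.\<close>

lemma common_corner:
  assumes L: "rhombic_lattice L" and ST: "S \<in> L" "T \<in> L" "S \<inter> T \<noteq> {}"
  shows "\<exists>z. z extreme_point_of S \<and> z extreme_point_of T"
proof (cases "S = T")
  case True
  obtain a u v where "rhombus_at T a u v" using lattice_rhombus[OF L ST(2)] .
  from rhombus_corner_extreme[OF this] True show ?thesis by blast
next
  case False
  obtain a u v where R: "rhombus_at S a u v" using lattice_rhombus[OF L ST(1)] .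
  obtain p w t where p: "rhombus_at S p w t" "S \<inter> T = {p} \<or> S \<inter> T = closed_segment p (p + w)"
    using rhombus_proper_face[OF R lattice_Int_face[OF L ST(1,2) False] ST(3) odd_fun_zero]
    by (elim exE conjE)
  have "p extreme_point_of (S \<inter> T)"
    using p(2) by (elim disjE) (simp_all add: extreme_point_of_singleton extreme_point_of_segment)
  moreover have "S \<inter> T face_of T"
    using lattice_Int_face(1)[OF L ST(2,1)] False by (simp add: Int_commute)
  ultimately have "p extreme_point_of T" using extreme_point_of_face by metis
  with rhombus_corner_extreme[OF p(1)] show ?thesis by blast
qed

lemma tiles_connected:
  assumes L: "rhombic_lattice L" and ST: "S \<in> L" "T \<in> L" "S \<inter> T \<noteq> {}"
    and z: "z extreme_point_of S" "z' extreme_point_of T"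
  shows "(z, z') \<in> (edges L)\<^sup>*"
proof -
  obtain y where y: "y extreme_point_of S" "y extreme_point_of T"
    using common_corner[OF L ST] by (elim exE conjE)
  show ?thesis
    using corners_connected[OF L ST(1) z(1) y(1)] corners_connected[OF L ST(2) y(2) z(2)]
    by (rule rtrancl_trans)
qed

text \<open>The set of vertices that can be reached from the corners of the tiles at a point \<open>p\<close> does not change
when \<open>p\<close> moves within a tile, so it does not depend on \<open>p\<close>.\<close>

lemma vertices_connected:
  assumes L: "rhombic_lattice L" and "z \<in> vertices L" "w \<in> vertices L"
  shows "(z, w) \<in> (edges L)\<^sup>*"
proof -
  interpret tile_cover L using lattice_tile_cover[OF L] .
  define f where "f p = {y. \<exists>T\<in>L. \<exists>x. p \<in> T \<and> x extreme_point_of T \<and> (x, y) \<in> (edges L)\<^sup>*}" for p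
  have sub: "f p \<subseteq> f q" if T: "T \<in> L" "p \<in> T" "q \<in> T" for T p q
  proof
    fix y assume "y \<in> f p"
    then obtain S x where S: "S \<in> L" "p \<in> S" "x extreme_point_of S" "(x, y) \<in> (edges L)\<^sup>*"
      unfolding f_def by blast
    obtain a u v where R: "rhombus_at T a u v" using lattice_rhombus[OF L T(1)] .
    have "(a, x) \<in> (edges L)\<^sup>*"
      using tiles_connected[OF L T(1) S(1) _ rhombus_corner_extreme[OF R] S(3)] S T by blast
    then have "(a, y) \<in> (edges L)\<^sup>*" using S(4) by (rule rtrancl_trans)
    with T R show "y \<in> f q" unfolding f_def using rhombus_corner_extreme by blast
  qed
  have "f constant_on UNIV"
  proof (rule constant_on_connected)
    fix T p q assume "T \<in> L" "p \<in> T \<inter> UNIV" "q \<in> T \<inter> UNIV"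
    then show "f p = f q" using sub[of T p q] sub[of T q p] by simp
  qed (rule convex_connected[OF convex_UNIV])
  then have "f z = f w" unfolding constant_on_def by auto
  obtain S T where S: "S \<in> L" "z extreme_point_of S" and T: "T \<in> L" "w extreme_point_of T"
    using assms(2,3) unfolding vertices_def by blast
  have "w \<in> f w" unfolding f_def using T by (auto simp: extreme_point_of_def)
  then have "w \<in> f z" using \<open>f z = f w\<close> by simp
  then obtain T' x where T': "T' \<in> L" "z \<in> T'" "x extreme_point_of T'" "(x, w) \<in> (edges L)\<^sup>*"
    unfolding f_def by blast
  have "(z, x) \<in> (edges L)\<^sup>*"
    using S T' by (intro tiles_connected[OF L S(1) T'(1)]) (auto simp: extreme_point_of_def)
  then show ?thesis using T'(4) by (rule rtrancl_trans)
qed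

lemma path_exists:
  assumes L: "rhombic_lattice L" and "z \<in> vertices L" "w \<in> vertices L"
  shows "\<exists>zs. is_path_between L z w zs"
  using vertices_connected[OF assms]
proof (induction rule: converse_rtrancl_induct)
  case base
  then show ?case using assms(3) by (auto simp: is_path_between_def is_path_single intro!: exI[of _ "[w]"])
next
  case (step y z)
  then obtain zs where zs: "is_path_between L z w zs" by blast
  then obtain zs' where "zs = z # zs'" unfolding is_path_between_def is_path_def by (cases zs) auto
  with zs step(1) edges_vertices[OF L step(1)] have "is_path_between L y w (y # zs)"
    by (auto simp: is_path_between_def is_path_Cons)
  then show ?case by blast
qed

lemma path_append:
  assumes "is_path_between L a b xs" "is_path_between L b c ys"
  shows "is_path_between L a c (xs @ tl ys)" "steps (xs @ tl ys) = steps xs @ steps ys"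
proof -
  have "is_path_between L a c (xs @ tl ys) \<and> steps (xs @ tl ys) = steps xs @ steps ys"
    using assms(1)
  proof (induction xs arbitrary: a rule: steps.induct)
    case (1 x y xs)
    then have "is_path_between L y b (y # xs)" by (auto simp: is_path_between_def is_path_Cons)
    with 1 show ?case by (auto simp: is_path_between_def is_path_Cons)
  next
    case ("2_2" x)
    then have "x = b" "a = b" by (auto simp: is_path_between_def)
    moreover have "b # tl ys = ys"
      using assms(2) by (cases ys) (auto simp: is_path_between_def is_path_def)
    ultimately show ?case using assms(2) by simp
  qed (simp add: is_path_between_def is_path_def)
  then show "is_path_between L a c (xs @ tl ys)" "steps (xs @ tl ys) = steps xs @ steps ys" by simp_all
qed

lemma edge_path:
  assumes L: "rhombic_lattice L" and ab: "(a, b) \<in> edges L"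
  shows "is_path_between L a b [a, b]"
  using edges_vertices[OF L ab] ab by (simp add: is_path_between_def is_path_Cons is_path_single)

text \<open>The vectors of the oriented edges.\<close>

definition directions :: "complex set set \<Rightarrow> complex set" where
  "directions L = {b - a |a b. (a, b) \<in> edges L}"

lemma directions_uminus: "rhombic_lattice L \<Longrightarrow> u \<in> directions L \<Longrightarrow> - u \<in> directions L"
  unfolding directions_def by (force dest: edges_sym)

lemma directions_norm: "rhombic_lattice L \<Longrightarrow> u \<in> directions L \<Longrightarrow> norm u = 1"
  unfolding directions_def by (auto simp: edges_iff rhombus_at_def)

lemma steps_directions: "is_path L zs \<Longrightarrow> set (steps zs) \<subseteq> directions L"
  by (induction zs rule: steps.induct) (auto simp: is_path_Cons directions_def)

text \<open>Use \<open>closed_path_sum\<close> for the odd function that is 1 at \<open>w\<close>, -1 at \<open>- w\<close> and 0 elsewhere.\<close>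

lemma closed_path_balanced:
  assumes "rhombic_lattice L" "is_path_between L a a zs"
  shows "count_list (steps zs) w = count_list (steps zs) (- w)"
proof -
  let ?n = "\<lambda>z. (if z = w then 1 else 0) - (if z = - w then 1 else 0) :: real"
  have "odd_fun ?n" unfolding odd_fun_def by (auto simp: minus_equation_iff[of _ w])
  then have "sum_list (map ?n (steps zs)) = 0" by (rule closed_path_sum[OF assms(1) _ assms(2)])
  moreover have "sum_list (map ?n us) = real (count_list us w) - real (count_list us (- w))" for us
    by (induction us) auto
  ultimately show ?thesis by simp
qed

text \<open>Commuting moves in which each \<open>u\<close> can be cancelled against a \<open>- u\<close> return to the starting state.\<close>

lemma fold_balanced:
  fixes us :: "complex list"
  assumes neg: "\<And>u. u \<in> U \<Longrightarrow> - u \<in> U" "\<And>u. u \<in> U \<Longrightarrow> u \<noteq> 0"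
    and maps: "\<And>u x. u \<in> U \<Longrightarrow> x \<in> X \<Longrightarrow> T u x \<in> X"
    and comm: "\<And>u v x. u \<in> U \<Longrightarrow> v \<in> U \<Longrightarrow> x \<in> X \<Longrightarrow> T u (T v x) = T v (T u x)"
    and inv: "\<And>u x. u \<in> U \<Longrightarrow> x \<in> X \<Longrightarrow> T (- u) (T u x) = x"
    and us: "set us \<subseteq> U" "\<And>w. count_list us w = count_list us (- w)" and x: "x \<in> X"
  shows "fold T us x = x"
  using us x
proof (induction "length us" arbitrary: us rule: less_induct)
  case less
  have fold_comm: "T w (fold T ys y) = fold T ys (T w y)"
    if "w \<in> U" "set ys \<subseteq> U" "y \<in> X" for w ys y
    using that
  proof (induction ys arbitrary: y)
    case (Cons v ys)
    then have "T w (fold T ys (T v y)) = fold T ys (T w (T v y))" by (simp add: maps)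
    also have "T w (T v y) = T v (T w y)" using Cons by (simp add: comm)
    finally show ?case by simp
  qed simp
  show ?case
  proof (cases us)
    case (Cons u us')
    have u: "u \<in> U" "- u \<noteq> u" using less(2) neg(2)[of u] Cons by auto
    have "count_list us (- u) \<noteq> 0" using less(3)[of u] Cons by simp
    then have "- u \<in> set us'" using Cons u(2) count_notin[of "- u" us'] by fastforce
    then obtain ys zs where us': "us' = ys @ - u # zs" by (meson split_list)
    have sub: "set ys \<subseteq> U" "set zs \<subseteq> U" using less(2) Cons us' by auto
    have "fold T us x = fold T zs (T (- u) (fold T ys (T u x)))" by (simp add: Cons us')
    also have "T (- u) (fold T ys (T u x)) = fold T ys (T (- u) (T u x))"
      using u sub less(4) by (intro fold_comm maps neg)
    also have "T (- u) (T u x) = x" using u less(4) by (intro inv)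
    also have "fold T zs (fold T ys x) = fold T (ys @ zs) x" by simp
    also have "\<dots> = x"
    proof (rule less(1))
      have A: "count_list (ys @ zs) w + (if w = u then 1 else 0) + (if w = - u then 1 else 0) = count_list us w" for w
        using u(2) by (auto simp: Cons us')
      show "count_list (ys @ zs) w = count_list (ys @ zs) (- w)" for w
      proof -
        have "- w = u \<longleftrightarrow> w = - u" "- w = - u \<longleftrightarrow> w = u" by auto
        then show ?thesis using A[of w] A[of "- w"] less(3)[of w] by simp
      qed
    qed (use sub less(4) in \<open>auto simp: Cons us'\<close>)
    finally show ?thesis .
  qed simp
qed

text \<open>A state that is transported along edges by commuting maps, depending only on the edge vector and
inverse to each other for opposite vectors, is a function of the vertex alone.\<close>

lemma potential_exists:
  assumes L: "rhombic_lattice L" and p0: "p0 \<in> vertices L"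
    and maps: "\<And>u x. u \<in> directions L \<Longrightarrow> x \<in> X \<Longrightarrow> T u x \<in> X"
    and comm: "\<And>u v x. u \<in> directions L \<Longrightarrow> v \<in> directions L \<Longrightarrow> x \<in> X \<Longrightarrow> T u (T v x) = T v (T u x)"
    and inv: "\<And>u x. u \<in> directions L \<Longrightarrow> x \<in> X \<Longrightarrow> T (- u) (T u x) = x"
    and x0: "x0 \<in> X"
  obtains \<Phi> where "\<Phi> p0 = x0" "\<And>z. z \<in> vertices L \<Longrightarrow> \<Phi> z \<in> X"
    "\<And>a b. (a, b) \<in> edges L \<Longrightarrow> \<Phi> b = T (b - a) (\<Phi> a)"
proof -
  have loop: "fold T (steps zs) x = x" if zs: "is_path_between L a a zs" and "x \<in> X" for a zs x
  proof (rule fold_balanced[where U = "directions L" and X = X])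
    show "u \<noteq> 0" if "u \<in> directions L" for u using directions_norm[OF L that] by auto
    show "set (steps zs) \<subseteq> directions L" using zs by (intro steps_directions) (simp add: is_path_between_def)
  qed (use directions_uminus[OF L] maps comm inv closed_path_balanced[OF L zs] that in auto)
  have fold_X: "fold T us x \<in> X" if "set us \<subseteq> directions L" "x \<in> X" for us x
    using that by (induction us arbitrary: x) (auto intro: maps)
  obtain P where P: "is_path_between L p0 z (P z)" if "z \<in> vertices L" for z
    using path_exists[OF L p0] by metis
  define \<Phi> where "\<Phi> z = fold T (steps (P z)) x0" for z
  have \<Phi>_X: "\<Phi> z \<in> X" if "z \<in> vertices L" for z
    unfolding \<Phi>_def using P[OF that] x0
    by (intro fold_X steps_directions) (simp_all add: is_path_between_def)
  have "\<Phi> b = T (b - a) (\<Phi> a)" if ab: "(a, b) \<in> edges L" for a b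
  proof -
    note V = edges_vertices[OF L ab]
    obtain Q where Q: "is_path_between L b p0 Q" using path_exists[OF L V(2) p0] by blast
    note Pb = path_append[OF P[OF V(2)] Q]
    have "fold T (steps Q) (\<Phi> b) = x0"
      using loop[OF Pb(1) x0] unfolding Pb(2) \<Phi>_def by simp
    moreover note QP = path_append[OF Q P[OF V(1)]]
    note QPe = path_append[OF QP(1) edge_path[OF L ab]]
    have "fold T (steps Q @ steps (P a) @ [b - a]) (\<Phi> b) = \<Phi> b"
      using loop[OF QPe(1) \<Phi>_X[OF V(2)]] unfolding QPe(2) QP(2) by simp
    ultimately show ?thesis by (simp add: \<Phi>_def)
  qed
  moreover have "\<Phi> p0 = x0" unfolding \<Phi>_def by (rule loop[OF P[OF p0] x0])
  ultimately show ?thesis using \<Phi>_X that[of \<Phi>] by blast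
qed

section \<open>Discrete integration and injectivity of \<open>Z\<^sub>+\<close>\<close>

lemma path_sum_Cons:
  "path_sum f (a # b # zs) = (f a + f b) / 2 * (b - a) + path_sum f (b # zs)"
proof -
  have "path_sum f (a # b # zs) = (\<Sum>n = Suc 0..Suc (length zs).
     (f ((a # b # zs) ! (n - 1)) + f ((a # b # zs) ! n)) / 2 * ((a # b # zs) ! n - (a # b # zs) ! (n - 1)))"
    by (simp add: path_sum_def)
  also have "\<dots> = (f a + f b) / 2 * (b - a) + (\<Sum>n = Suc 1..Suc (length zs).
     (f ((a # b # zs) ! (n - 1)) + f ((a # b # zs) ! n)) / 2 * ((a # b # zs) ! n - (a # b # zs) ! (n - 1)))"
    by (subst sum.atLeast_Suc_atMost) simp_all
  also have "(\<Sum>n = Suc 1..Suc (length zs).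
     (f ((a # b # zs) ! (n - 1)) + f ((a # b # zs) ! n)) / 2 * ((a # b # zs) ! n - (a # b # zs) ! (n - 1)))
     = path_sum f (b # zs)"
    unfolding path_sum_def sum.shift_bounds_cl_Suc_ivl by (intro sum.cong) (auto simp: nth_Cons')
  finally show ?thesis .
qed

lemma path_sum_single: "path_sum f [a] = 0" "path_sum f [] = 0"
  by (simp_all add: path_sum_def)

lemma path_sum_append:
  assumes "is_path_between L a b xs" "is_path_between L b c ys"
  shows "path_sum f (xs @ tl ys) = path_sum f xs + path_sum f ys"
  using assms(1)
proof (induction xs arbitrary: a rule: steps.induct)
  case (1 x y xs)
  then have "is_path_between L y b (y # xs)" by (auto simp: is_path_between_def is_path_Cons)
  from 1(1)[OF this] show ?case by (simp add: path_sum_Cons)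
next
  case ("2_2" x)
  then have "x = b" by (auto simp: is_path_between_def)
  moreover have "b # tl ys = ys"
    using assms(2) by (cases ys) (auto simp: is_path_between_def is_path_def)
  ultimately show ?case by (simp add: path_sum_single)
qed (simp add: is_path_between_def is_path_def)

lemma path_sum_telescope:
  assumes "is_path L zs"
    and "\<And>a b. (a, b) \<in> edges L \<Longrightarrow> (f a + f b) / 2 * (b - a) = H b - H a"
  shows "path_sum f zs = H (last zs) - H (hd zs)"
  using assms(1)
proof (induction zs rule: steps.induct)
  case (1 a b zs)
  then have A: "path_sum f (b # zs) = H (last (b # zs)) - H b" by (simp add: is_path_Cons)
  have B: "(f a + f b) / 2 * (b - a) = H b - H a" using 1 by (intro assms(2)) (simp add: is_path_Cons)
  show ?case unfolding path_sum_Cons A B by simp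
qed (simp_all add: is_path_def path_sum_single)

lemma discrete_analytic_primitive:
  assumes "\<And>a b. (a, b) \<in> edges L \<Longrightarrow> (f a + f b) / 2 * (b - a) = H b - H a"
  shows "discrete_analytic L f"
  unfolding discrete_analytic_def is_path_between_def
proof (intro allI impI)
  fix a zs assume "is_path L zs \<and> hd zs = a \<and> last zs = a"
  then show "path_sum f zs = 0" using path_sum_telescope[of L zs f H] assms by simp
qed

text \<open>\<open>H\<close> is a primitive of \<open>f\<close> along edges.\<close>

definition primitive :: "complex set set \<Rightarrow> (complex \<Rightarrow> complex) \<Rightarrow> (complex \<Rightarrow> complex) \<Rightarrow> bool" where
  "primitive L f H \<longleftrightarrow> (\<forall>(a, b)\<in>edges L. (f a + f b) / 2 * (b - a) = H b - H a)"

lemma primitiveD: "primitive L f H \<Longrightarrow> (a, b) \<in> edges L \<Longrightarrow> (f a + f b) / 2 * (b - a) = H b - H a"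
  unfolding primitive_def by blast

lemma dint_path:
  assumes "rhombic_lattice L" "a \<in> vertices L" "b \<in> vertices L"
  shows "\<exists>zs. is_path_between L a b zs \<and> dint L a b f = path_sum f zs"
  unfolding dint_def using someI_ex[OF path_exists[OF assms]] by blast

lemma dint_primitive:
  assumes "rhombic_lattice L" "a \<in> vertices L" "b \<in> vertices L" and H: "primitive L f H"
  shows "dint L a b f = H b - H a"
proof -
  obtain zs where zs: "is_path_between L a b zs" "dint L a b f = path_sum f zs"
    using dint_path[OF assms(1-3)] by blast
  then show ?thesis
    using path_sum_telescope[of L zs f H, OF _ primitiveD[OF H]] by (simp add: is_path_between_def)
qed

lemma DA_primitive:
  assumes L: "rhombic_lattice L" and o: "p0 \<in> vertices L" and f: "discrete_analytic L f"
  shows "primitive L f (\<lambda>z. dint L p0 z f)"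
  unfolding primitive_def
proof (intro ballI, clarify)
  fix a b assume ab: "(a, b) \<in> edges L"
  note V = edges_vertices[OF L ab]
  obtain P P' where P: "is_path_between L p0 a P" "dint L p0 a f = path_sum f P"
    and P': "is_path_between L p0 b P'" "dint L p0 b f = path_sum f P'"
    using dint_path[OF L o] V by metis
  obtain Q where Q: "is_path_between L b p0 Q" using path_exists[OF L V(2) o] by blast
  note e = edge_path[OF L ab]
  have "path_sum f P' + path_sum f Q = 0"
    using f path_append(1)[OF P'(1) Q] path_sum_append[OF P'(1) Q, of f]
    unfolding discrete_analytic_def by metis
  moreover have "path_sum f P + path_sum f [a, b] + path_sum f Q = 0"
    using f path_append(1)[OF path_append(1)[OF P(1) e] Q]
      path_sum_append[OF path_append(1)[OF P(1) e] Q, of f] path_sum_append[OF P(1) e, of f]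
    unfolding discrete_analytic_def by metis
  moreover have "path_sum f [a, b] = (f a + f b) / 2 * (b - a)"
    by (simp add: path_sum_Cons path_sum_single)
  ultimately show "(f a + f b) / 2 * (b - a) = dint L p0 b f - dint L p0 a f"
    unfolding P(2) P'(2) by (simp add: algebra_simps add_eq_0_iff)
qed

lemma Zplus_primitive:
  assumes "rhombic_lattice L" "0 \<in> vertices L" "z \<in> vertices L" "primitive L f H"
  shows "Zplus L f z = (f 0 - f z) / 2 + H z - H 0"
  using dint_primitive[OF assms] assms(3) by (simp add: Zplus_def)

lemma Zplus_edge:
  assumes L: "rhombic_lattice L" "0 \<in> vertices L" and f: "f \<in> DA L" and ab: "(a, b) \<in> edges L"
  shows "Zplus L f b - Zplus L f a = (f a - f b) / 2 + (f a + f b) / 2 * (b - a)"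
proof -
  have "primitive L f (\<lambda>z. dint L 0 z f)" using f by (intro DA_primitive L) (simp add: DA_def)
  note Z = Zplus_primitive[OF L edges_vertices(1)[OF L(1) ab] this]
    Zplus_primitive[OF L edges_vertices(2)[OF L(1) ab] this]
  show ?thesis unfolding Z primitiveD[OF \<open>primitive L f (\<lambda>z. dint L 0 z f)\<close> ab] by (simp add: diff_divide_distrib)
qed

lemma Zplus_0:
  assumes "rhombic_lattice L" "0 \<in> vertices L" and "f \<in> DA L"
  shows "Zplus L f 0 = 0"
proof -
  have "primitive L f (\<lambda>z. dint L 0 z f)" using assms by (intro DA_primitive) (simp_all add: DA_def)
  from Zplus_primitive[OF assms(1,2,2) this] show ?thesis by simp
qed

lemma path_sum_lincomb: "path_sum (\<lambda>z. \<Sum>i\<in>I. c i * f i z) zs = (\<Sum>i\<in>I. c i * path_sum (f i) zs)"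
proof -
  have *: "((\<Sum>i\<in>I. c i * f i a) + (\<Sum>i\<in>I. c i * f i b)) / 2 * w = (\<Sum>i\<in>I. c i * ((f i a + f i b) / 2 * w))" for a b w
    unfolding sum.distrib[symmetric] sum_divide_distrib sum_distrib_right
    by (intro sum.cong refl) (simp add: distrib_left)
  show ?thesis unfolding path_sum_def * sum_distrib_left by (rule sum.swap)
qed

lemma DA_lincomb:
  assumes "\<And>i. i \<in> I \<Longrightarrow> f i \<in> DA L"
  shows "(\<lambda>z. \<Sum>i\<in>I. c i * f i z) \<in> DA L"
  using assms by (auto simp: DA_def discrete_analytic_def path_sum_lincomb)

lemma Zplus_lincomb: "Zplus L (\<lambda>z. \<Sum>i\<in>I. c i * f i z) z = (\<Sum>i\<in>I. c i * Zplus L (f i) z)"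
  unfolding Zplus_def dint_def path_sum_lincomb
  by (simp add: distrib_left right_diff_distrib sum.distrib sum_subtractf diff_divide_distrib sum_divide_distrib)

text \<open>From every vertex there is a path whose last step is 1 and whose other steps are neither 1 nor -1.\<close>

definition unit_step_reachable :: "complex set set \<Rightarrow> bool" where
  "unit_step_reachable L \<longleftrightarrow> (\<forall>z\<in>vertices L. \<exists>N zs. N \<ge> 1 \<and> length zs = N + 1 \<and> is_path L zs \<and> zs ! 0 = z \<and>
           (\<forall>i\<in>{1..N - 1}. zs ! i - zs ! (i - 1) \<noteq> 1 \<and> zs ! i - zs ! (i - 1) \<noteq> - 1) \<and>
           zs ! N - zs ! (N - 1) = 1)"

lemma path_edge:
  assumes "is_path L zs" "0 < i" "i < length zs"
  shows "(zs ! (i - 1), zs ! i) \<in> edges L"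
  using assms unfolding is_path_def successively_conv_nth by (auto elim!: allE[of _ "i - 1"])

text \<open>The difference \<open>d\<close> satisfies \<open>d(a) (1 + u) = d(b) (1 - u)\<close> along an edge with vector \<open>u\<close>. If \<open>u = 1\<close>, then
\<open>d(a) = 0\<close>; if \<open>u \<noteq> -1\<close>, then \<open>d(b) = 0\<close> implies \<open>d(a) = 0\<close>. So \<open>d\<close> vanishes backwards along the given paths.\<close>

lemma Zplus_inj:
  assumes L: "rhombic_lattice L" "0 \<in> vertices L" "unit_step_reachable L"
    and fg: "f \<in> DA L" "g \<in> DA L" "\<And>z. z \<in> vertices L \<Longrightarrow> Zplus L f z = Zplus L g z"
  shows "f = g"
proof
  define d where "d z = f z - g z" for z
  have edge: "d a * (1 + (b - a)) = d b * (1 - (b - a))" if "(a, b) \<in> edges L" for a b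
  proof -
    have "(f a - f b) / 2 + (f a + f b) / 2 * (b - a) = (g a - g b) / 2 + (g a + g b) / 2 * (b - a)"
      using Zplus_edge[OF L(1,2) fg(1) that] Zplus_edge[OF L(1,2) fg(2) that]
        fg(3)[OF edges_vertices(1)[OF L(1) that]] fg(3)[OF edges_vertices(2)[OF L(1) that]] by metis
    moreover have "d a * (1 + (b - a)) - d b * (1 - (b - a)) =
      2 * (((f a - f b) / 2 + (f a + f b) / 2 * (b - a)) - ((g a - g b) / 2 + (g a + g b) / 2 * (b - a)))"
      by (simp add: d_def field_simps)
    ultimately show ?thesis by simp
  qed
  fix z
  show "f z = g z"
  proof (cases "z \<in> vertices L")
    case False
    then show ?thesis using fg by (simp add: DA_def)
  next
    case True
    then obtain N zs where zs: "N \<ge> 1" "length zs = N + 1" "is_path L zs" "zs ! 0 = z"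
        "\<And>i. i \<in> {1..N - 1} \<Longrightarrow> zs ! i - zs ! (i - 1) \<noteq> - 1" "zs ! N - zs ! (N - 1) = 1"
      using L(3) unfolding unit_step_reachable_def by metis
    \<comment> \<open>Induction backwards from the start of the last step.\<close>
    have "d (zs ! (N - 1 - j)) = 0" if "j \<le> N - 1" for j
      using that
    proof (induction j)
      case 0
      have "(zs ! (N - 1), zs ! N) \<in> edges L" using zs by (intro path_edge) auto
      from edge[OF this] zs(6) show ?case by simp
    next
      case (Suc j)
      let ?i = "N - 1 - j"
      have i: "?i \<in> {1..N - 1}" "N - 1 - Suc j = ?i - 1" using Suc(2) by auto
      have "(zs ! (?i - 1), zs ! ?i) \<in> edges L" using zs i by (intro path_edge) auto
      from edge[OF this] Suc have "d (zs ! (?i - 1)) * (1 + (zs ! ?i - zs ! (?i - 1))) = 0" by simp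
      moreover have "1 + (zs ! ?i - zs ! (?i - 1)) \<noteq> 0"
        using zs(5)[OF i(1)] by (metis add.inverse_unique)
      ultimately show ?case using i(2) by simp
    qed
    from this[of "N - 1"] zs(4) show ?thesis by (simp add: d_def)
  qed
qed

lemma Zminus_eqI:
  assumes L: "rhombic_lattice L" "0 \<in> vertices L" "unit_step_reachable L"
    and h: "h \<in> DA L" "\<And>z. z \<in> vertices L \<Longrightarrow> Zplus L h z = f z - f 0"
  shows "Zminus L f = h"
  unfolding Zminus_def
proof (rule the_equality)
  show "h \<in> DA L \<and> (\<forall>z\<in>vertices L. Zplus L h z = f z - f 0)" using h by simp
next
  fix g assume "g \<in> DA L \<and> (\<forall>z\<in>vertices L. Zplus L g z = f z - f 0)"
  with h show "g = h" by (intro Zplus_inj[OF L]) simp_all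
qed

section \<open>The matrix recursion along edges\<close>

text \<open>The coefficient \<open>2 I + (1 - u) A\<close> of the recursion along an edge with vector \<open>u\<close>. The coefficient on the
other side is obtained with \<open>- u\<close>.\<close>

definition step_mat :: "complex mat \<Rightarrow> complex \<Rightarrow> complex mat" where
  "step_mat A u = 2 \<cdot>\<^sub>m 1\<^sub>m (dim_row A) + (1 - u) \<cdot>\<^sub>m A"

lemma step_mat_dim [simp]: "dim_row (step_mat A u) = dim_row A" "dim_col (step_mat A u) = dim_col A"
  by (simp_all add: step_mat_def)

lemma step_mat_carrier [simp]: "A \<in> carrier_mat l l \<Longrightarrow> step_mat A u \<in> carrier_mat l l"
  by (simp add: step_mat_def)

lemma step_mat_mult:
  assumes "A \<in> carrier_mat l l" "Y \<in> carrier_mat l n"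
  shows "step_mat A u * Y = 2 \<cdot>\<^sub>m Y + (1 - u) \<cdot>\<^sub>m (A * Y)"
proof -
  have "step_mat A u * Y = (2 \<cdot>\<^sub>m 1\<^sub>m l) * Y + ((1 - u) \<cdot>\<^sub>m A) * Y"
    unfolding step_mat_def using assms by (subst add_mult_distrib_mat[of _ l l _ _ n]) auto
  then show ?thesis using assms by (simp add: mult_smult_assoc_mat[of _ l l _ n])
qed

lemma mult_step_mat:
  assumes "A \<in> carrier_mat l l" "Y \<in> carrier_mat n l"
  shows "Y * step_mat A u = 2 \<cdot>\<^sub>m Y + (1 - u) \<cdot>\<^sub>m (Y * A)"
proof -
  have "Y * step_mat A u = Y * (2 \<cdot>\<^sub>m 1\<^sub>m l) + Y * ((1 - u) \<cdot>\<^sub>m A)"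
    unfolding step_mat_def using assms by (subst mult_add_distrib_mat[of _ n l _ l]) auto
  also have "Y * (2 \<cdot>\<^sub>m 1\<^sub>m l) = 2 \<cdot>\<^sub>m Y"
    using assms mult_smult_distrib[of Y n l "1\<^sub>m l" l 2] by simp
  also have "Y * ((1 - u) \<cdot>\<^sub>m A) = (1 - u) \<cdot>\<^sub>m (Y * A)"
    using assms by (intro mult_smult_distrib)
  finally show ?thesis .
qed

lemma step_mat_index:
  "A \<in> carrier_mat l l \<Longrightarrow> i < l \<Longrightarrow> j < l \<Longrightarrow>
    step_mat A u $$ (i, j) = 2 * (if i = j then 1 else 0) + (1 - u) * A $$ (i, j)"
  by (simp add: step_mat_def)

lemma step_mat_commute:
  assumes A: "A \<in> carrier_mat l l"
  shows "step_mat A u * step_mat A v = step_mat A v * step_mat A u"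
proof (rule eq_matI)
  fix i j assume "i < dim_row (step_mat A v * step_mat A u)" "j < dim_col (step_mat A v * step_mat A u)"
  then have ij: "i < l" "j < l" using A by (simp_all add: step_mat_def)
  have e: "(step_mat A u * step_mat A v) $$ (i, j) = 4 * (if i = j then 1 else 0) + 2 * (1 - v) * A $$ (i, j)
      + (1 - u) * (2 * A $$ (i, j) + (1 - v) * (A * A) $$ (i, j))" for u v
    using A ij by (simp add: step_mat_mult[OF A step_mat_carrier[OF A]] mult_step_mat[OF A A] step_mat_index[OF A]
      del: index_mult_mat(1))
  show "(step_mat A u * step_mat A v) $$ (i, j) = (step_mat A v * step_mat A u) $$ (i, j)"
    unfolding e[of u v] e[of v u] by (simp add: algebra_simps)
qed (use A in \<open>simp_all add: step_mat_def\<close>)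

lemma smult_mult_mat_vec:
  assumes "A \<in> carrier_mat m n" "x \<in> carrier_vec n"
  shows "(k \<cdot>\<^sub>m A) *\<^sub>v x = k \<cdot>\<^sub>v (A *\<^sub>v x)"
  using assms by (intro eq_vecI) (auto simp: scalar_prod_def sum_distrib_left mult.assoc)

lemma direction_S_set:
  assumes L: "rhombic_lattice L" and u: "u \<in> directions L" "u \<noteq> 1"
  shows "- 2 / (1 - u) \<in> S_set L"
proof -
  obtain a b where ab: "(a, b) \<in> edges L" "b - a = - u"
    using directions_uminus[OF L u(1)] unfolding directions_def by (auto simp: eq_commute)
  then have ba: "1 + b - a = 1 - u" by (simp add: algebra_simps)
  have "(- 2 / (1 - u)) * (1 + b - a) = - 2"
    unfolding ba using nonzero_eq_divide_eq[of "1 - u" "- 2 / (1 - u)" "- 2"] u(2) by simp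
  with ab(1) show ?thesis unfolding S_set_def by blast
qed

text \<open>If \<open>u = 1\<close>, the matrix is \<open>2 I\<close>. Otherwise a kernel vector is an eigenvector of \<open>A\<close> for \<open>- 2 / (1 - u)\<close>.\<close>

lemma step_mat_det:
  assumes L: "rhombic_lattice L" and A: "A \<in> carrier_mat l l" and sp: "S_set L \<inter> spectrum A = {}"
    and u: "u \<in> directions L"
  shows "det (step_mat A u) \<noteq> 0"
proof
  assume "det (step_mat A u) = 0"
  then obtain x where x: "x \<in> carrier_vec l" "x \<noteq> 0\<^sub>v l" "step_mat A u *\<^sub>v x = 0\<^sub>v l"
    using det_0_iff_vec_prod_zero[OF step_mat_carrier[OF A]] by blast
  have eq: "2 * x $ i + (1 - u) * (A *\<^sub>v x) $ i = 0" if i: "i < l" for i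
  proof -
    have "step_mat A u *\<^sub>v x = (2 \<cdot>\<^sub>m 1\<^sub>m l) *\<^sub>v x + ((1 - u) \<cdot>\<^sub>m A) *\<^sub>v x"
      unfolding step_mat_def using A x by (simp add: add_mult_distrib_mat_vec[of _ l l])
    also have "(2 \<cdot>\<^sub>m 1\<^sub>m l) *\<^sub>v x = 2 \<cdot>\<^sub>v x" using x(1) by (simp add: smult_mult_mat_vec[of _ l l])
    also have "((1 - u) \<cdot>\<^sub>m A) *\<^sub>v x = (1 - u) \<cdot>\<^sub>v (A *\<^sub>v x)" using x(1) A by (simp add: smult_mult_mat_vec)
    finally have "(2 \<cdot>\<^sub>v x + (1 - u) \<cdot>\<^sub>v (A *\<^sub>v x)) $ i = (0\<^sub>v l) $ i" using x(3) by simp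
    then show ?thesis using i x A by simp
  qed
  show False
  proof (cases "u = 1")
    case True
    then have "x = 0\<^sub>v l" using eq x(1) by (intro eq_vecI) auto
    with x(2) show False by simp
  next
    case False
    define c where "c = - 2 / (1 - u)"
    have "A *\<^sub>v x = c \<cdot>\<^sub>v x"
    proof (rule eq_vecI)
      fix i assume "i < dim_vec (c \<cdot>\<^sub>v x)"
      then show "(A *\<^sub>v x) $ i = (c \<cdot>\<^sub>v x) $ i"
        using eq[of i] x(1) False by (simp add: c_def field_simps)
    qed (use A x in simp)
    then have "c \<in> spectrum A"
      using A x unfolding spectrum_def eigenvalue_def eigenvector_def by auto
    moreover have "c \<in> S_set L" unfolding c_def by (rule direction_S_set[OF L u False])
    ultimately show False using sp by blast
  qed
qed

lemma step_mat_inverse: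
  assumes "rhombic_lattice L" and A: "A \<in> carrier_mat l l" and "S_set L \<inter> spectrum A = {}"
    and "u \<in> directions L"
  shows "\<exists>W. W \<in> carrier_mat l l \<and> W * step_mat A u = 1\<^sub>m l \<and> step_mat A u * W = 1\<^sub>m l"
proof -
  let ?M = "step_mat A u"
  note d = step_mat_det[OF assms]
  note adj = adj_mat[OF step_mat_carrier[OF A, of u]]
  have "(1 / det ?M) \<cdot>\<^sub>m adj_mat ?M * ?M = 1\<^sub>m l"
    using adj d A by (subst mult_smult_assoc_mat[of _ l l _ l]) (auto simp: step_mat_def)
  moreover have "?M * ((1 / det ?M) \<cdot>\<^sub>m adj_mat ?M) = 1\<^sub>m l"
    using adj d A by (subst mult_smult_distrib[of _ l l _ l]) (auto simp: step_mat_def)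
  ultimately show ?thesis using adj(1) by (intro exI[of _ "(1 / det ?M) \<cdot>\<^sub>m adj_mat ?M"]) simp
qed

lemma step_mat_cancel:
  assumes "rhombic_lattice L" and A: "A \<in> carrier_mat l l" and "S_set L \<inter> spectrum A = {}"
    and "u \<in> directions L" and F: "F \<in> carrier_mat l n" "G \<in> carrier_mat l n"
    and eq: "step_mat A u * F = step_mat A u * G"
  shows "F = G"
proof -
  obtain W where W: "W \<in> carrier_mat l l" "W * step_mat A u = 1\<^sub>m l"
    using step_mat_inverse[OF assms(1-4)] by blast
  have "W * (step_mat A u * F) = F" "W * (step_mat A u * G) = G"
    using W F A by (simp_all add: assoc_mult_mat[symmetric, of _ l l _ l _ n])
  with eq show ?thesis by metis
qed

text \<open>The hypothesis on edges holds if both functions satisfy the same recursion, in which the value at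
\<open>a\<close> determines the right-hand side.\<close>

lemma edge_recursion_unique:
  assumes L: "rhombic_lattice L" "0 \<in> vertices L" and A: "A \<in> carrier_mat l l" and sp: "S_set L \<inter> spectrum A = {}"
    and F: "\<And>z. z \<in> vertices L \<Longrightarrow> F z \<in> carrier_mat l n" "\<And>z. z \<in> vertices L \<Longrightarrow> G z \<in> carrier_mat l n"
    and e: "\<And>a b. (a, b) \<in> edges L \<Longrightarrow> F a = G a \<Longrightarrow> step_mat A (b - a) * F b = step_mat A (b - a) * G b"
    and 0: "F 0 = G 0" and z: "z \<in> vertices L"
  shows "F z = G z"
  using vertices_connected[OF L z]
proof (induction rule: rtrancl_induct)
  case (step a b)
  note V = edges_vertices[OF L(1) step(2)]
  have "b - a \<in> directions L" using step(2) unfolding directions_def by blast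
  moreover have "step_mat A (b - a) * F b = step_mat A (b - a) * G b"
    by (rule e[OF step(2,3)])
  ultimately show ?case using step_mat_cancel[OF L(1) A sp _ F(1)[OF V(2)] F(2)[OF V(2)]] by blast
qed (rule 0)

text \<open>The recursion for \<open>Y = Z\<^sub>+ Z\<^sub>+ (I - zA)\<^sup>-\<^sup>\<odot>\<close>. Its right-hand side depends on the endpoints of the edge and
not only on the edge vector, so the transported state is the pair of the vertex and the value there.\<close>

lemma step_recursion_solution:
  assumes L: "rhombic_lattice L" "0 \<in> vertices L" and A: "A \<in> carrier_mat l l" and sp: "S_set L \<inter> spectrum A = {}"
  obtains Y where "Y 0 = 0\<^sub>m l l" "\<And>z. z \<in> vertices L \<Longrightarrow> Y z \<in> carrier_mat l l"
    "\<And>a b. (a, b) \<in> edges L \<Longrightarrow>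
      step_mat A (b - a) * Y b = step_mat A (a - b) * Y a + ((b - a) * (a + b - 1)) \<cdot>\<^sub>m 1\<^sub>m l"
proof -
  let ?D = "directions L" and ?C = "carrier_mat l l :: complex mat set"
  let ?M = "step_mat A"
  have M: "?M u \<in> ?C" for u using A by simp
  note neg = directions_uminus[OF L(1)]
  have "\<forall>u\<in>?D. \<exists>W. W \<in> ?C \<and> W * ?M u = 1\<^sub>m l \<and> ?M u * W = 1\<^sub>m l"
    using step_mat_inverse[OF L(1) A sp] by simp
  then obtain W where W: "W u \<in> ?C" "W u * ?M u = 1\<^sub>m l" "?M u * W u = 1\<^sub>m l" if "u \<in> ?D" for u
    by metis
  have MW: "?M u * (W u * G) = G" if "u \<in> ?D" "G \<in> ?C" for u G
    using W[OF that(1)] M[of u] that(2) by (simp add: assoc_mult_mat[symmetric, of _ l l _ l _ l])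
  define c where "c a u = u * (2 * a + u - 1)" for a u :: complex
  define S where "S u a Y = W u * (?M (- u) * Y + c a u \<cdot>\<^sub>m 1\<^sub>m l)" for u a Y
  have S_carrier: "S u a Y \<in> ?C" if "u \<in> ?D" "Y \<in> ?C" for u a Y
    unfolding S_def using W[OF that(1)] M[of "- u"] that(2) by simp
  have S: "?M u * S u a Y = ?M (- u) * Y + c a u \<cdot>\<^sub>m 1\<^sub>m l" if "u \<in> ?D" "Y \<in> ?C" for u a Y
    unfolding S_def using M[of "- u"] that by (intro MW) simp_all
  have swap: "?M u * (?M v * Y) = ?M v * (?M u * Y)" if "Y \<in> ?C" for u v Y
    unfolding assoc_mult_mat[OF M M that, symmetric] step_mat_commute[OF A, of u v] ..
  have two: "?M v * (?M u * S u (a + v) (S v a Y)) =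
      ?M (- u) * (?M (- v) * Y) + (c a v \<cdot>\<^sub>m ?M (- u) + c (a + v) u \<cdot>\<^sub>m ?M v)"
    if "u \<in> ?D" "v \<in> ?D" "Y \<in> ?C" for u v a Y
  proof -
    have 1: "S v a Y \<in> ?C" using S_carrier that by simp
    have "?M v * (?M u * S u (a + v) (S v a Y)) = ?M v * (?M (- u) * S v a Y + c (a + v) u \<cdot>\<^sub>m 1\<^sub>m l)"
      using S[OF that(1) 1] by simp
    also have "\<dots> = ?M v * (?M (- u) * S v a Y) + ?M v * (c (a + v) u \<cdot>\<^sub>m 1\<^sub>m l)"
      using M[of v] M[of "- u"] 1 by (intro mult_add_distrib_mat[of _ l l _ l]) simp_all
    also have "?M v * (c (a + v) u \<cdot>\<^sub>m 1\<^sub>m l) = c (a + v) u \<cdot>\<^sub>m ?M v"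
      unfolding mult_smult_distrib[OF M one_carrier_mat] right_mult_one_mat[OF M] ..
    also have "?M v * (?M (- u) * S v a Y) = ?M (- u) * (?M (- v) * Y + c a v \<cdot>\<^sub>m 1\<^sub>m l)"
      unfolding swap[OF 1, of v "- u"] S[OF that(2,3)] ..
    also have "\<dots> = ?M (- u) * (?M (- v) * Y) + ?M (- u) * (c a v \<cdot>\<^sub>m 1\<^sub>m l)"
      using M[of "- v"] M[of "- u"] that by (intro mult_add_distrib_mat[of _ l l _ l]) simp_all
    also have "?M (- u) * (c a v \<cdot>\<^sub>m 1\<^sub>m l) = c a v \<cdot>\<^sub>m ?M (- u)"
      unfolding mult_smult_distrib[OF M one_carrier_mat] right_mult_one_mat[OF M] ..
    also have "?M (- u) * (?M (- v) * Y) + c a v \<cdot>\<^sub>m ?M (- u) + c (a + v) u \<cdot>\<^sub>m ?M v =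
      ?M (- u) * (?M (- v) * Y) + (c a v \<cdot>\<^sub>m ?M (- u) + c (a + v) u \<cdot>\<^sub>m ?M v)"
      using M[of v] M[of "- u"] M[of "- v"] that by (intro assoc_add_mat[of _ l l]) simp_all
    finally show ?thesis .
  qed
  \<comment> \<open>The inhomogeneous part of two consecutive steps does not depend on their order.\<close>
  have inhom: "c a v \<cdot>\<^sub>m ?M (- u) + c (a + v) u \<cdot>\<^sub>m ?M v = c a u \<cdot>\<^sub>m ?M (- v) + c (a + u) v \<cdot>\<^sub>m ?M u" for a u v
    using A by (intro eq_matI) (auto simp: step_mat_index[OF A] c_def algebra_simps)
  have comm: "S u (a + v) (S v a Y) = S v (a + u) (S u a Y)"
    if uv: "u \<in> ?D" "v \<in> ?D" and Y: "Y \<in> ?C" for u v a Y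
  proof -
    let ?P = "S u (a + v) (S v a Y)" and ?Q = "S v (a + u) (S u a Y)"
    have PQ: "?P \<in> ?C" "?Q \<in> ?C" using S_carrier uv Y by simp_all
    have "?M v * (?M u * ?P) = ?M u * (?M v * ?Q)"
      unfolding two[OF uv Y] two[OF uv(2,1) Y] inhom[of a v u] swap[OF Y, of "- u" "- v"] ..
    also have "\<dots> = ?M v * (?M u * ?Q)" using swap[OF PQ(2)] .
    finally have "?M u * ?P = ?M u * ?Q"
      by (rule step_mat_cancel[OF L(1) A sp uv(2) mult_carrier_mat[OF M PQ(1)] mult_carrier_mat[OF M PQ(2)]])
    then show ?thesis using step_mat_cancel[OF L(1) A sp uv(1) PQ] by blast
  qed
  have inv: "S (- u) (a + u) (S u a Y) = Y" if u: "u \<in> ?D" and Y: "Y \<in> ?C" for u a Y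
  proof -
    have 1: "S u a Y \<in> ?C" using S_carrier u Y by simp
    have "?M (- u) * S (- u) (a + u) (S u a Y) = ?M u * S u a Y + c (a + u) (- u) \<cdot>\<^sub>m 1\<^sub>m l"
      using S[OF neg[OF u] 1] by simp
    also have "\<dots> = ?M (- u) * Y + c a u \<cdot>\<^sub>m 1\<^sub>m l + c (a + u) (- u) \<cdot>\<^sub>m 1\<^sub>m l"
      using S[OF u Y] by simp
    also have "\<dots> = ?M (- u) * Y"
      using A Y by (intro eq_matI) (auto simp: c_def algebra_simps)
    finally show ?thesis
      by (rule step_mat_cancel[OF L(1) A sp neg[OF u] S_carrier[OF neg[OF u] 1] Y])
  qed
  define T where "T u = (\<lambda>(a, Y). (a + u, S u a Y))" for u
  obtain \<Phi> where \<Phi>: "\<Phi> 0 = (0, 0\<^sub>m l l)" "\<And>z. z \<in> vertices L \<Longrightarrow> \<Phi> z \<in> UNIV \<times> ?C"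
    "\<And>a b. (a, b) \<in> edges L \<Longrightarrow> \<Phi> b = T (b - a) (\<Phi> a)"
  proof (rule potential_exists[of L 0 "UNIV \<times> ?C" T "(0, 0\<^sub>m l l)"])
    show "T u x \<in> UNIV \<times> ?C" if "u \<in> ?D" "x \<in> UNIV \<times> ?C" for u x
      using that S_carrier by (auto simp: T_def)
    show "T u (T v x) = T v (T u x)" if "u \<in> ?D" "v \<in> ?D" "x \<in> UNIV \<times> ?C" for u v x
      using that comm by (auto simp: T_def)
    show "T (- u) (T u x) = x" if "u \<in> ?D" "x \<in> UNIV \<times> ?C" for u x
      using that inv by (auto simp: T_def)
  qed (use L in simp_all)
  have fst: "fst (\<Phi> z) = z" if "z \<in> vertices L" for z
    using vertices_connected[OF L that]
  proof (induction rule: rtrancl_induct)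
    case (step a b)
    then show ?case using \<Phi>(3)[OF step(2)] by (simp add: T_def case_prod_beta)
  qed (simp add: \<Phi>(1))
  show thesis
  proof (rule that[of "\<lambda>z. snd (\<Phi> z)"])
    show "snd (\<Phi> z) \<in> ?C" if "z \<in> vertices L" for z using \<Phi>(2)[OF that] by auto
    fix a b assume ab: "(a, b) \<in> edges L"
    have a: "a \<in> vertices L" by (rule edges_vertices(1)[OF L(1) ab])
    have "\<Phi> a \<in> UNIV \<times> ?C" using \<Phi>(2)[OF a] .
    moreover have "b - a \<in> ?D" using ab unfolding directions_def by blast
    moreover have "snd (\<Phi> b) = S (b - a) a (snd (\<Phi> a))"
      using \<Phi>(3)[OF ab] fst[OF a] by (simp add: T_def case_prod_beta)
    ultimately have "?M (b - a) * snd (\<Phi> b) = ?M (- (b - a)) * snd (\<Phi> a) + c a (b - a) \<cdot>\<^sub>m 1\<^sub>m l"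
      using S by auto
    moreover have "c a (b - a) = (b - a) * (a + b - 1)" by (simp add: c_def)
    ultimately show "?M (b - a) * snd (\<Phi> b) = ?M (a - b) * snd (\<Phi> a) + ((b - a) * (a + b - 1)) \<cdot>\<^sub>m 1\<^sub>m l"
      by simp
  qed (simp add: \<Phi>(1))
qed

section \<open>The resolvent\<close>

lemma DA_matD:
  assumes "F \<in> DA_mat L m n"
  shows "F z \<in> carrier_mat m n" "i < m \<Longrightarrow> j < n \<Longrightarrow> (\<lambda>z. F z $$ (i, j)) \<in> DA L"
  using assms by (auto simp: DA_mat_def)

lemma DA_mat_outside:
  assumes "F \<in> DA_mat L m n" "z \<notin> vertices L"
  shows "F z = 0\<^sub>m m n"
proof (rule eq_matI)
  fix i j assume "i < dim_row (0\<^sub>m m n :: complex mat)" "j < dim_col (0\<^sub>m m n :: complex mat)"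
  then show "F z $$ (i, j) = 0\<^sub>m m n $$ (i, j)"
    using DA_matD(2)[OF assms(1), of i j] assms(2) by (simp add: DA_def)
qed (use DA_matD(1)[OF assms(1)] in auto)

lemma DA_mat_eqI:
  assumes "F \<in> DA_mat L m n" "G \<in> DA_mat L m n" "\<And>z. z \<in> vertices L \<Longrightarrow> F z = G z"
  shows "F = G"
proof
  fix z show "F z = G z"
    using assms DA_mat_outside[OF assms(1)] DA_mat_outside[OF assms(2)] by (cases "z \<in> vertices L") simp_all
qed

lemma Zplus_mat_index:
  assumes "F z \<in> carrier_mat m n" "i < m" "j < n"
  shows "Zplus_mat L F z $$ (i, j) = Zplus L (\<lambda>w. F w $$ (i, j)) z"
  using assms by (simp add: Zplus_mat_def)

lemma Zplus_mat_dim [simp]: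
  "dim_row (Zplus_mat L F z) = dim_row (F z)" "dim_col (Zplus_mat L F z) = dim_col (F z)"
  by (simp_all add: Zplus_mat_def)

lemma Zplus_mat_carrier [simp]: "F z \<in> carrier_mat m n \<Longrightarrow> Zplus_mat L F z \<in> carrier_mat m n"
  by (simp add: Zplus_mat_def)

lemma poly_conv_linear:
  assumes A: "A \<in> carrier_mat l l" and R: "R z \<in> carrier_mat l l"
  shows "poly_conv L l l [1\<^sub>m l, - A] R z = R z - A * Zplus_mat L R z"
  using A R Zplus_mat_carrier[of R z l l L] by (intro eq_matI) (simp_all add: poly_conv_def numeral_2_eq_2 lessThan_Suc uminus_mult_left_mat)

lemma conv_poly_linear:
  assumes A: "A \<in> carrier_mat l l" and R: "R z \<in> carrier_mat l l"
  shows "conv_poly L l l R [1\<^sub>m l, - A] z = R z - Zplus_mat L R z * A"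
  using A R Zplus_mat_carrier[of R z l l L] by (intro eq_matI) (simp_all add: conv_poly_def numeral_2_eq_2 lessThan_Suc uminus_mult_right_mat)

lemma conv_poly_monomial:
  assumes B: "B \<in> carrier_mat l n" and R: "R z \<in> carrier_mat l l"
  shows "conv_poly L l n R [0\<^sub>m l n, B] z = Zplus_mat L R z * B"
  using B R Zplus_mat_carrier[of R z l l L] by (intro eq_matI) (simp_all add: conv_poly_def numeral_2_eq_2 lessThan_Suc uminus_mult_right_mat)

lemma mat_diff_eq_iff:
  fixes X Y Z :: "complex mat"
  assumes "X \<in> carrier_mat m n" "Y \<in> carrier_mat m n" "Z \<in> carrier_mat m n"
  shows "X - Y = Z \<longleftrightarrow> X = Z + Y"
  using assms by (auto simp: mat_eq_iff algebra_simps)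

text \<open>The two equations of the \<open>\<odot>\<close>-inverse of \<open>I - zA\<close>, solved for the resolvent.\<close>

definition is_resolvent :: "complex set set \<Rightarrow> complex mat \<Rightarrow> nat \<Rightarrow> (complex \<Rightarrow> complex mat) \<Rightarrow> bool" where
  "is_resolvent L A l R \<longleftrightarrow> R \<in> DA_mat L l l \<and>
     (\<forall>z\<in>vertices L. R z = 1\<^sub>m l + A * Zplus_mat L R z \<and> R z = 1\<^sub>m l + Zplus_mat L R z * A)"

lemma resolvent_eq_THE:
  assumes A: "A \<in> carrier_mat l l"
  shows "resolvent L A = (THE R. is_resolvent L A l R)"
proof -
  have "R \<in> DA_mat L l l \<and> (\<forall>z\<in>vertices L. poly_conv L l l [1\<^sub>m l, - A] R z = 1\<^sub>m l) \<and>
      (\<forall>z\<in>vertices L. conv_poly L l l R [1\<^sub>m l, - A] z = 1\<^sub>m l) \<longleftrightarrow> is_resolvent L A l R" for R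
  proof (cases "R \<in> DA_mat L l l")
    case True
    have R: "R z \<in> carrier_mat l l" for z using DA_matD(1)[OF True] .
    have Z: "Zplus_mat L R z \<in> carrier_mat l l" for z using R by simp
    show ?thesis
      unfolding is_resolvent_def poly_conv_linear[OF A R] conv_poly_linear[OF A R]
        mat_diff_eq_iff[OF R mult_carrier_mat[OF A Z] one_carrier_mat]
        mat_diff_eq_iff[OF R mult_carrier_mat[OF Z A] one_carrier_mat] by blast
  qed (simp add: is_resolvent_def)
  moreover have "dim_row A = l" using A by simp
  ultimately show ?thesis unfolding resolvent_def Let_def by simp
qed

text \<open>Multiplying by \<open>A\<close> the increment of \<open>Z = Z\<^sub>+ R\<close> along an edge with vector \<open>u\<close> and eliminating \<open>Z\<close> by means
of \<open>R = I + A Z\<close>. Here \<open>I\<close> may be any constant matrix.\<close>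

lemma mult_step_recursion:
  assumes A: "A \<in> carrier_mat l l" and R: "Ra \<in> carrier_mat l n" "Rb \<in> carrier_mat l n"
    and Z: "Za \<in> carrier_mat l n" "Zb \<in> carrier_mat l n" and I: "I \<in> carrier_mat l n"
    and Ra: "Ra = I + A * Za" and Rb: "Rb = I + A * Zb"
    and e: "Zb = Za + ((1 + u) / 2) \<cdot>\<^sub>m Ra + ((u - 1) / 2) \<cdot>\<^sub>m Rb"
  shows "step_mat A u * Rb = step_mat A (- u) * Ra"
proof -
  have "A * Zb = A * Za + ((1 + u) / 2) \<cdot>\<^sub>m (A * Ra) + ((u - 1) / 2) \<cdot>\<^sub>m (A * Rb)"
  proof -
    have "A * Zb = A * (Za + ((1 + u) / 2) \<cdot>\<^sub>m Ra) + A * (((u - 1) / 2) \<cdot>\<^sub>m Rb)"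
      using e A R Z by (metis add_carrier_mat mult_add_distrib_mat smult_carrier_mat)
    also have "A * (Za + ((1 + u) / 2) \<cdot>\<^sub>m Ra) = A * Za + A * (((1 + u) / 2) \<cdot>\<^sub>m Ra)"
      using A R Z by (intro mult_add_distrib_mat) auto
    finally show ?thesis using mult_smult_distrib[OF A R(1)] mult_smult_distrib[OF A R(2)] by simp
  qed
  then have *: "(A * Zb) $$ (i, j) = (A * Za) $$ (i, j) + (1 + u) / 2 * (A * Ra) $$ (i, j) + (u - 1) / 2 * (A * Rb) $$ (i, j)"
    if "i < l" "j < n" for i j
    using that A R Z by (simp del: index_mult_mat(1))
  have r: "Ra $$ (i, j) = I $$ (i, j) + (A * Za) $$ (i, j)" "Rb $$ (i, j) = I $$ (i, j) + (A * Zb) $$ (i, j)"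
    if "i < l" "j < n" for i j
    using arg_cong[OF Ra, of "\<lambda>M. M $$ (i, j)"] arg_cong[OF Rb, of "\<lambda>M. M $$ (i, j)"] that A Z I
    by (simp_all del: index_mult_mat(1))
  show ?thesis unfolding step_mat_mult[OF A R(1)] step_mat_mult[OF A R(2)]
  proof (rule eq_matI)
    fix i j assume "i < dim_row (2 \<cdot>\<^sub>m Ra + (1 - - u) \<cdot>\<^sub>m (A * Ra))" "j < dim_col (2 \<cdot>\<^sub>m Ra + (1 - - u) \<cdot>\<^sub>m (A * Ra))"
    then have ij: "i < l" "j < n" using A R by simp_all
    have "2 * Rb $$ (i, j) + (1 - u) * (A * Rb) $$ (i, j) = 2 * Ra $$ (i, j) + (1 + u) * (A * Ra) $$ (i, j)"
      unfolding r[OF ij] *[OF ij] by (simp add: field_simps)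
    then show "(2 \<cdot>\<^sub>m Rb + (1 - u) \<cdot>\<^sub>m (A * Rb)) $$ (i, j) = (2 \<cdot>\<^sub>m Ra + (1 - - u) \<cdot>\<^sub>m (A * Ra)) $$ (i, j)"
      using ij A R by (simp del: index_mult_mat(1))
  qed (use A R in simp_all)
qed

lemma Zplus_mat_edge:
  assumes L: "rhombic_lattice L" "0 \<in> vertices L" and R: "R \<in> DA_mat L m n" and ab: "(a, b) \<in> edges L"
  shows "Zplus_mat L R b = Zplus_mat L R a + ((1 + (b - a)) / 2) \<cdot>\<^sub>m R a + (((b - a) - 1) / 2) \<cdot>\<^sub>m R b"
proof (rule eq_matI)
  note c = DA_matD(1)[OF R]
  let ?P = "Zplus_mat L R a + ((1 + (b - a)) / 2) \<cdot>\<^sub>m R a + (((b - a) - 1) / 2) \<cdot>\<^sub>m R b"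
  fix i j assume "i < dim_row ?P" "j < dim_col ?P"
  then have ij: "i < m" "j < n" using carrier_matD[OF c[of b]] by simp_all
  have e: "Zplus L (\<lambda>w. R w $$ (i, j)) b = Zplus L (\<lambda>w. R w $$ (i, j)) a +
     ((R a $$ (i, j) - R b $$ (i, j)) / 2 + (R a $$ (i, j) + R b $$ (i, j)) / 2 * (b - a))"
    using Zplus_edge[OF L DA_matD(2)[OF R ij] ab] by (simp only: diff_eq_eq add.commute)
  have "Zplus_mat L R b $$ (i, j) = Zplus_mat L R a $$ (i, j) + (1 + (b - a)) / 2 * R a $$ (i, j)
      + ((b - a) - 1) / 2 * R b $$ (i, j)"
    unfolding Zplus_mat_index[OF c ij] e by (simp add: field_simps)
  then show "Zplus_mat L R b $$ (i, j) = ?P $$ (i, j)" using ij c[of a] c[of b] by simp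
qed (use DA_matD(1)[OF R] Zplus_mat_carrier[OF DA_matD(1)[OF R]] in auto)

lemma Zplus_mat_0:
  assumes "rhombic_lattice L" "0 \<in> vertices L" "R \<in> DA_mat L m n"
  shows "Zplus_mat L R 0 = 0\<^sub>m m n"
  using Zplus_0[OF assms(1,2) DA_matD(2)[OF assms(3)]] DA_matD(1)[OF assms(3), of 0]
  by (intro eq_matI) (simp_all add: Zplus_mat_def)

lemma resolvent_edge:
  assumes L: "rhombic_lattice L" "0 \<in> vertices L" and A: "A \<in> carrier_mat l l"
    and R: "R \<in> DA_mat L l l" "\<And>z. z \<in> vertices L \<Longrightarrow> R z = 1\<^sub>m l + A * Zplus_mat L R z"
    and ab: "(a, b) \<in> edges L"
  shows "step_mat A (b - a) * R b = step_mat A (- (b - a)) * R a"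
proof -
  note c = DA_matD(1)[OF R(1)]
  show ?thesis
    by (rule mult_step_recursion[OF A c c Zplus_mat_carrier[OF c] Zplus_mat_carrier[OF c] one_carrier_mat
        R(2) R(2) Zplus_mat_edge[OF L R(1) ab]]) (rule edges_vertices[OF L(1) ab])+
qed

lemma resolvent_at_0:
  assumes L: "rhombic_lattice L" "0 \<in> vertices L" and A: "A \<in> carrier_mat l l"
    and R: "R \<in> DA_mat L l l" "\<And>z. z \<in> vertices L \<Longrightarrow> R z = 1\<^sub>m l + A * Zplus_mat L R z"
  shows "R 0 = 1\<^sub>m l"
  using R(2)[OF L(2)] Zplus_mat_0[OF L R(1)] A by simp

lemma is_resolvent_unique:
  assumes L: "rhombic_lattice L" "0 \<in> vertices L" and A: "A \<in> carrier_mat l l" "S_set L \<inter> spectrum A = {}"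
    and R: "is_resolvent L A l R" and R': "is_resolvent L A l R'"
  shows "R = R'"
proof -
  have D: "R \<in> DA_mat L l l" "R' \<in> DA_mat L l l" using R R' by (simp_all add: is_resolvent_def)
  have e: "R z = 1\<^sub>m l + A * Zplus_mat L R z" "R' z = 1\<^sub>m l + A * Zplus_mat L R' z" if "z \<in> vertices L" for z
    using R R' that unfolding is_resolvent_def by blast+
  show ?thesis
  proof (rule DA_mat_eqI[OF D], rule edge_recursion_unique[OF L A])
    show "R z \<in> carrier_mat l l" "R' z \<in> carrier_mat l l" for z using DA_matD(1) D by auto
    show "R 0 = R' 0" using resolvent_at_0[OF L A(1) D(1) e(1)] resolvent_at_0[OF L A(1) D(2) e(2)] by simp
    show "step_mat A (b - a) * R b = step_mat A (b - a) * R' b" if "(a, b) \<in> edges L" "R a = R' a" for a b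
      using resolvent_edge[OF L A(1) D(1) e(1) that(1)] resolvent_edge[OF L A(1) D(2) e(2) that(1)] that(2) by simp
  qed
qed

lemma DA_matI_primitive:
  assumes c: "\<And>z. F z \<in> carrier_mat m n" and out: "\<And>z. z \<notin> vertices L \<Longrightarrow> F z = 0\<^sub>m m n"
    and H: "\<And>i j. i < m \<Longrightarrow> j < n \<Longrightarrow> primitive L (\<lambda>z. F z $$ (i, j)) (H i j)"
  shows "F \<in> DA_mat L m n"
  unfolding DA_mat_def DA_def
proof (intro CollectI conjI allI impI)
  fix i j assume "i < m" "j < n"
  from discrete_analytic_primitive[of L, OF primitiveD[OF H[OF this]]]
  show "discrete_analytic L (\<lambda>z. F z $$ (i, j))" .
next
  fix i j z assume "i < m" "j < n" "z \<notin> vertices L"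
  then show "F z $$ (i, j) = 0" by (simp add: out)
qed (rule c)

text \<open>The next three identities show that \<open>Y + X / 2\<close> and \<open>X + R / 2\<close> are primitives of \<open>X = z I + A Y\<close> and
\<open>R = I + A X\<close>. The letters \<open>s\<close>, \<open>t\<close>, \<open>c\<close>, \<open>d\<close> stand for entries of \<open>A Y\<close>, \<open>A\<^sup>2 Y\<close>, \<open>A\<close> and \<open>I\<close>, and primed
letters for values at \<open>b\<close>.\<close>

lemma half_telescope:
  fixes x y x' y' h :: complex
  assumes "(x + x') * h = 2 * y' + x' - (2 * y + x)"
  shows "(x + x') / 2 * h = y' + x' / 2 - (y + x / 2)"
proof -
  have "(x + x') / 2 * h = ((x + x') * h) / 2" by simp
  also have "\<dots> = y' + x' / 2 - (y + x / 2)" unfolding assms by (simp add: field_simps)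
  finally show ?thesis .
qed

lemma telescope_first:
  fixes a b d s s' y y' :: complex
  assumes "2 * y' + (1 - (b - a)) * s' = 2 * y + (1 - (a - b)) * s + (b - a) * (a + b - 1) * d"
  shows "((a * d + s) + (b * d + s')) * (b - a) = 2 * y' + (b * d + s') - (2 * y + (a * d + s))"
proof -
  have "2 * y' = 2 * y + (1 - (a - b)) * s + (b - a) * (a + b - 1) * d - (1 - (b - a)) * s'"
    using assms by (simp add: eq_diff_eq)
  then show ?thesis by (simp add: algebra_simps)
qed

lemma telescope_second:
  fixes a b c d s s' t t' :: complex
  assumes "2 * s' + (1 - (b - a)) * t' = 2 * s + (1 - (a - b)) * t + (b - a) * (a + b - 1) * c"
  shows "((d + a * c + t) + (d + b * c + t')) * (b - a) =
    2 * (b * d + s') + (d + b * c + t') - (2 * (a * d + s) + (d + a * c + t))"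
proof -
  have "2 * s' = 2 * s + (1 - (a - b)) * t + (b - a) * (a + b - 1) * c - (1 - (b - a)) * t'"
    using assms by (simp add: eq_diff_eq)
  then show ?thesis by (simp add: algebra_simps)
qed

text \<open>The solution of the recursion commutes with \<open>A\<close> because \<open>A Y\<close> and \<open>Y A\<close> satisfy the same recursion, which
yields the second equation of the resolvent.\<close>

lemma is_resolvent_exists:
  assumes L: "rhombic_lattice L" "0 \<in> vertices L" and A: "A \<in> carrier_mat l l" and sp: "S_set L \<inter> spectrum A = {}"
  shows "\<exists>R. is_resolvent L A l R \<and> Zplus_mat L R \<in> DA_mat L l l"
proof -
  let ?V = "vertices L"
  obtain Y where Y0: "Y 0 = 0\<^sub>m l l" and Y: "\<And>z. z \<in> ?V \<Longrightarrow> Y z \<in> carrier_mat l l"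
    and Ye: "\<And>a b. (a, b) \<in> edges L \<Longrightarrow>
      step_mat A (b - a) * Y b = step_mat A (a - b) * Y a + ((b - a) * (a + b - 1)) \<cdot>\<^sub>m 1\<^sub>m l"
    using step_recursion_solution[OF L A sp] by metis
  have M: "step_mat A u \<in> carrier_mat l l" for u using A by simp
  have YA: "A * Y z \<in> carrier_mat l l" "Y z * A \<in> carrier_mat l l" if "z \<in> ?V" for z
    using A Y[OF that] by simp_all
  have MA: "step_mat A u * A = A * step_mat A u" for u
    using A by (simp add: step_mat_mult mult_step_mat)
  have left: "step_mat A (b - a) * (A * Y b) = step_mat A (a - b) * (A * Y a) + ((b - a) * (a + b - 1)) \<cdot>\<^sub>m A"
    if ab: "(a, b) \<in> edges L" for a b
  proof -
    note V = edges_vertices[OF L(1) ab]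
    have "step_mat A (b - a) * (A * Y b) = A * (step_mat A (b - a) * Y b)"
      unfolding assoc_mult_mat[OF M A Y[OF V(2)], symmetric] assoc_mult_mat[OF A M Y[OF V(2)], symmetric] MA ..
    also have "\<dots> = A * (step_mat A (a - b) * Y a) + A * (((b - a) * (a + b - 1)) \<cdot>\<^sub>m 1\<^sub>m l)"
      unfolding Ye[OF ab] by (rule mult_add_distrib_mat[OF A mult_carrier_mat[OF M Y[OF V(1)]]]) simp
    also have "A * (step_mat A (a - b) * Y a) = step_mat A (a - b) * (A * Y a)"
      unfolding assoc_mult_mat[OF M A Y[OF V(1)], symmetric] assoc_mult_mat[OF A M Y[OF V(1)], symmetric] MA ..
    also have "A * (((b - a) * (a + b - 1)) \<cdot>\<^sub>m 1\<^sub>m l) = ((b - a) * (a + b - 1)) \<cdot>\<^sub>m A"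
      unfolding mult_smult_distrib[OF A one_carrier_mat] right_mult_one_mat[OF A] ..
    finally show ?thesis .
  qed
  have right: "step_mat A (b - a) * (Y b * A) = step_mat A (a - b) * (Y a * A) + ((b - a) * (a + b - 1)) \<cdot>\<^sub>m A"
    if ab: "(a, b) \<in> edges L" for a b
  proof -
    note V = edges_vertices[OF L(1) ab]
    have "step_mat A (b - a) * (Y b * A) = (step_mat A (b - a) * Y b) * A"
      by (rule assoc_mult_mat[OF M Y[OF V(2)] A, symmetric])
    also have "\<dots> = step_mat A (a - b) * Y a * A + (((b - a) * (a + b - 1)) \<cdot>\<^sub>m 1\<^sub>m l) * A"
      unfolding Ye[OF ab] by (rule add_mult_distrib_mat[OF mult_carrier_mat[OF M Y[OF V(1)]] _ A]) simp
    also have "step_mat A (a - b) * Y a * A = step_mat A (a - b) * (Y a * A)"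
      by (rule assoc_mult_mat[OF M Y[OF V(1)] A])
    also have "(((b - a) * (a + b - 1)) \<cdot>\<^sub>m 1\<^sub>m l) * A = ((b - a) * (a + b - 1)) \<cdot>\<^sub>m A"
      unfolding mult_smult_assoc_mat[OF one_carrier_mat A] left_mult_one_mat[OF A] ..
    finally show ?thesis .
  qed
  have commute: "A * Y z = Y z * A" if "z \<in> ?V" for z
  proof (rule edge_recursion_unique[OF L A sp _ _ _ _ that, of "\<lambda>z. A * Y z" _ "\<lambda>z. Y z * A"])
    show "A * Y z \<in> carrier_mat l l" "Y z * A \<in> carrier_mat l l" if "z \<in> ?V" for z using YA[OF that] .
    show "A * Y 0 = Y 0 * A" using A by (simp add: Y0)
    show "step_mat A (b - a) * (A * Y b) = step_mat A (b - a) * (Y b * A)"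
      if "(a, b) \<in> edges L" "A * Y a = Y a * A" for a b
      unfolding left[OF that(1)] right[OF that(1)] that(2) ..
  qed
  define X where "X z = (if z \<in> ?V then z \<cdot>\<^sub>m 1\<^sub>m l + A * Y z else 0\<^sub>m l l)" for z
  define R where "R z = (if z \<in> ?V then 1\<^sub>m l + A * X z else 0\<^sub>m l l)" for z
  have X: "X z \<in> carrier_mat l l" for z using YA by (simp add: X_def)
  have R: "R z \<in> carrier_mat l l" for z using X A by (simp add: R_def)
  have AX: "A * X z = z \<cdot>\<^sub>m A + A * (A * Y z)" if "z \<in> ?V" for z
  proof -
    have "A * X z = A * (z \<cdot>\<^sub>m 1\<^sub>m l) + A * (A * Y z)"
      unfolding X_def using that YA[OF that] A by (simp add: mult_add_distrib_mat[of _ l l _ l])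
    then show ?thesis unfolding mult_smult_distrib[OF A one_carrier_mat] right_mult_one_mat[OF A] .
  qed
  have XA: "X z * A = A * X z" if "z \<in> ?V" for z
  proof -
    have "X z * A = (z \<cdot>\<^sub>m 1\<^sub>m l) * A + A * Y z * A"
      unfolding X_def using that YA[OF that] A by (simp add: add_mult_distrib_mat[of _ l l _ _ l])
    also have "(z \<cdot>\<^sub>m 1\<^sub>m l) * A = z \<cdot>\<^sub>m A"
      unfolding mult_smult_assoc_mat[OF one_carrier_mat A] left_mult_one_mat[OF A] ..
    also have "A * Y z * A = A * (A * Y z)"
      unfolding assoc_mult_mat[OF A Y[OF that] A] commute[OF that, symmetric] ..
    finally show ?thesis unfolding AX[OF that] .
  qed
  have X_ij: "X z $$ (i, j) = z * 1\<^sub>m l $$ (i, j) + (A * Y z) $$ (i, j)" if "z \<in> ?V" "i < l" "j < l" for z i j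
    using that carrier_matD[OF A] carrier_matD[OF Y[OF that(1)]] by (simp add: X_def del: index_mult_mat(1))
  have R_ij: "R z $$ (i, j) = 1\<^sub>m l $$ (i, j) + z * A $$ (i, j) + (A * (A * Y z)) $$ (i, j)"
    if "z \<in> ?V" "i < l" "j < l" for z i j
    using that carrier_matD[OF A] carrier_matD[OF Y[OF that(1)]]
    by (simp add: R_def AX del: index_mult_mat(1) index_one_mat(1))
  have primX: "primitive L (\<lambda>z. X z $$ (i, j)) (\<lambda>z. Y z $$ (i, j) + X z $$ (i, j) / 2)"
    if ij: "i < l" "j < l" for i j
    unfolding primitive_def
  proof (intro ballI, clarify)
    fix a b assume ab: "(a, b) \<in> edges L"
    note V = edges_vertices[OF L(1) ab]
    have "(2 \<cdot>\<^sub>m Y b + (1 - (b - a)) \<cdot>\<^sub>m (A * Y b)) $$ (i, j) =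
        (2 \<cdot>\<^sub>m Y a + (1 - (a - b)) \<cdot>\<^sub>m (A * Y a) + ((b - a) * (a + b - 1)) \<cdot>\<^sub>m 1\<^sub>m l) $$ (i, j)"
      using Ye[OF ab] unfolding step_mat_mult[OF A Y[OF V(1)]] step_mat_mult[OF A Y[OF V(2)]] by simp
    then have "2 * Y b $$ (i, j) + (1 - (b - a)) * (A * Y b) $$ (i, j) =
        2 * Y a $$ (i, j) + (1 - (a - b)) * (A * Y a) $$ (i, j) + (b - a) * (a + b - 1) * 1\<^sub>m l $$ (i, j)"
      using ij carrier_matD[OF A] carrier_matD[OF Y[OF V(1)]] carrier_matD[OF Y[OF V(2)]] by (simp del: index_mult_mat(1) index_one_mat(1))
    then show "(X a $$ (i, j) + X b $$ (i, j)) / 2 * (b - a) =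
        Y b $$ (i, j) + X b $$ (i, j) / 2 - (Y a $$ (i, j) + X a $$ (i, j) / 2)"
      unfolding X_ij[OF V(1) ij] X_ij[OF V(2) ij] by (rule half_telescope[OF telescope_first])
  qed
  have primR: "primitive L (\<lambda>z. R z $$ (i, j)) (\<lambda>z. X z $$ (i, j) + R z $$ (i, j) / 2)"
    if ij: "i < l" "j < l" for i j
    unfolding primitive_def
  proof (intro ballI, clarify)
    fix a b assume ab: "(a, b) \<in> edges L"
    note V = edges_vertices[OF L(1) ab]
    have "(2 \<cdot>\<^sub>m (A * Y b) + (1 - (b - a)) \<cdot>\<^sub>m (A * (A * Y b))) $$ (i, j) =
        (2 \<cdot>\<^sub>m (A * Y a) + (1 - (a - b)) \<cdot>\<^sub>m (A * (A * Y a)) + ((b - a) * (a + b - 1)) \<cdot>\<^sub>m A) $$ (i, j)"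
      using left[OF ab] unfolding step_mat_mult[OF A YA(1)[OF V(1)]] step_mat_mult[OF A YA(1)[OF V(2)]] by simp
    then have "2 * (A * Y b) $$ (i, j) + (1 - (b - a)) * (A * (A * Y b)) $$ (i, j) =
        2 * (A * Y a) $$ (i, j) + (1 - (a - b)) * (A * (A * Y a)) $$ (i, j) + (b - a) * (a + b - 1) * A $$ (i, j)"
      using ij carrier_matD[OF A] carrier_matD[OF Y[OF V(1)]] carrier_matD[OF Y[OF V(2)]] by (simp del: index_mult_mat(1) index_one_mat(1))
    then show "(R a $$ (i, j) + R b $$ (i, j)) / 2 * (b - a) =
        X b $$ (i, j) + R b $$ (i, j) / 2 - (X a $$ (i, j) + R a $$ (i, j) / 2)"
      unfolding X_ij[OF V(1) ij] X_ij[OF V(2) ij] R_ij[OF V(1) ij] R_ij[OF V(2) ij]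
      by (rule half_telescope[OF telescope_second])
  qed
  have DX: "X \<in> DA_mat L l l" by (rule DA_matI_primitive[OF X _ primX]) (simp_all add: X_def)
  have DR: "R \<in> DA_mat L l l" by (rule DA_matI_primitive[OF R _ primR]) (simp_all add: R_def)
  have X0: "X 0 = 0\<^sub>m l l" using A L(2) by (intro eq_matI) (auto simp: X_def Y0)
  have ZR: "Zplus_mat L R z = X z" for z
  proof (cases "z \<in> ?V")
    case True
    show ?thesis
    proof (rule eq_matI)
      fix i j assume "i < dim_row (X z)" "j < dim_col (X z)"
      then have ij: "i < l" "j < l" using carrier_matD[OF X[of z]] by simp_all
      show "Zplus_mat L R z $$ (i, j) = X z $$ (i, j)"
        unfolding Zplus_mat_index[OF R ij] Zplus_primitive[OF L True primR[OF ij]] using ij X0 by (simp add: diff_divide_distrib)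
    qed (use R[of z] X[of z] in simp_all)
  next
    case False
    then have "X z = 0\<^sub>m l l" by (simp add: X_def)
    with False show ?thesis using R[of z] by (intro eq_matI) (simp_all add: Zplus_mat_def Zplus_def)
  qed
  then have "Zplus_mat L R = X" by (rule ext)
  moreover have "is_resolvent L A l R"
    unfolding is_resolvent_def ZR using DR XA by (simp add: R_def)
  ultimately show ?thesis using DX by metis
qed

lemma resolvent:
  assumes "rhombic_lattice L" "0 \<in> vertices L" "A \<in> carrier_mat l l" "S_set L \<inter> spectrum A = {}"
  shows "is_resolvent L A l (resolvent L A)" "Zplus_mat L (resolvent L A) \<in> DA_mat L l l"
proof -
  obtain R where R: "is_resolvent L A l R" "Zplus_mat L R \<in> DA_mat L l l"
    using is_resolvent_exists[OF assms] by metis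
  have "resolvent L A = R"
    unfolding resolvent_eq_THE[OF assms(3)]
    using R(1) is_resolvent_unique[OF assms] by (intro the_equality)
  with R show "is_resolvent L A l (resolvent L A)" "Zplus_mat L (resolvent L A) \<in> DA_mat L l l" by simp_all
qed

section \<open>Cayley-Hamilton for sequences of Markov parameters\<close>

text \<open>The product \<open>A\<^sup>k W\<close>, formed by \<open>k\<close> multiplications from the left.\<close>

definition mat_iter :: "complex mat \<Rightarrow> nat \<Rightarrow> complex mat \<Rightarrow> complex mat" where
  "mat_iter A k W = ((*) A ^^ k) W"

lemma mat_iter_0 [simp]: "mat_iter A 0 W = W"
  and mat_iter_Suc: "mat_iter A (Suc k) W = A * mat_iter A k W"
  and mat_iter_Suc': "mat_iter A (Suc k) W = mat_iter A k (A * W)"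
  by (simp_all add: mat_iter_def funpow_swap1)

lemma mat_iter_carrier [simp]:
  "A \<in> carrier_mat l l \<Longrightarrow> W \<in> carrier_mat l n \<Longrightarrow> mat_iter A k W \<in> carrier_mat l n"
  by (induction k) (simp_all add: mat_iter_Suc)

lemma mat_iter_diff:
  assumes "A \<in> carrier_mat l l" "X \<in> carrier_mat l n" "Y \<in> carrier_mat l n"
  shows "mat_iter A k (X - Y) = mat_iter A k X - mat_iter A k Y"
  using assms by (induction k) (simp_all add: mat_iter_Suc mult_minus_distrib_mat[of _ l l _ n])

lemma mat_iter_smult:
  assumes "A \<in> carrier_mat l l" "X \<in> carrier_mat l n"
  shows "mat_iter A k (c \<cdot>\<^sub>m X) = c \<cdot>\<^sub>m mat_iter A k X"
  using assms by (induction k) (simp_all add: mat_iter_Suc mult_smult_distrib[of _ l l _ n])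

lemma mat_iter_add:
  assumes "A \<in> carrier_mat l l" "X \<in> carrier_mat l n" "Y \<in> carrier_mat l n"
  shows "mat_iter A k (X + Y) = mat_iter A k X + mat_iter A k Y"
  using assms by (induction k) (simp_all add: mat_iter_Suc mult_add_distrib_mat[of _ l l _ n])

text \<open>The matrices \<open>B (Suc k)\<close> are the coefficients of the adjugate of \<open>x I - A\<close>. The equation compares the
coefficients of \<open>x\<^sup>k\<close> in \<open>(x I - A) adj (x I - A) = \<chi>(x) I\<close>.\<close>

lemma char_poly_coeff_decomp:
  assumes A: "(A :: complex mat) \<in> carrier_mat l l"
  obtains B N where "\<And>k. B k \<in> carrier_mat l l" "B 0 = 0\<^sub>m l l" "\<And>k. k \<ge> N \<Longrightarrow> B k = 0\<^sub>m l l"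
    "\<And>k. coeff (char_poly A) k \<cdot>\<^sub>m 1\<^sub>m l = B k - A * B (Suc k)"
proof -
  let ?C = "char_poly_matrix A"
  have C: "?C \<in> carrier_mat l l" using A by simp
  define P where "P = adj_mat ?C"
  have P: "P \<in> carrier_mat l l" "?C * P = char_poly A \<cdot>\<^sub>m 1\<^sub>m l"
    using adj_mat[OF C] unfolding P_def char_poly_def by simp_all
  define B where "B k = (if k = 0 then 0\<^sub>m l l else Matrix.mat l l (\<lambda>(i, j). coeff (P $$ (i, j)) (k - 1)))" for k
  define N where "N = Suc (Suc (\<Sum>i<l. \<Sum>j<l. degree (P $$ (i, j))))"
  show thesis
  proof (rule that[of B N])
    show "B k \<in> carrier_mat l l" for k by (simp add: B_def)
    show "B 0 = 0\<^sub>m l l" by (simp add: B_def)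
    show "B k = 0\<^sub>m l l" if "k \<ge> N" for k
    proof (rule eq_matI)
      fix i j assume "i < dim_row (0\<^sub>m l l :: complex mat)" "j < dim_col (0\<^sub>m l l :: complex mat)"
      then have ij: "i < l" "j < l" by simp_all
      have "degree (P $$ (i, j)) \<le> (\<Sum>j<l. degree (P $$ (i, j)))"
        using ij by (intro member_le_sum) auto
      also have "\<dots> \<le> (\<Sum>i<l. \<Sum>j<l. degree (P $$ (i, j)))"
        using ij by (intro member_le_sum[of i "{..<l}" "\<lambda>i. \<Sum>j<l. degree (P $$ (i, j))"]) auto
      finally have "degree (P $$ (i, j)) < k - 1" using that by (simp add: N_def)
      then show "B k $$ (i, j) = 0\<^sub>m l l $$ (i, j)" using ij by (simp add: B_def coeff_eq_0)
    qed (simp_all add: B_def)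
    fix k
    show "coeff (char_poly A) k \<cdot>\<^sub>m 1\<^sub>m l = B k - A * B (Suc k)"
    proof (rule eq_matI)
      fix i j assume "i < dim_row (B k - A * B (Suc k))" "j < dim_col (B k - A * B (Suc k))"
      then have ij: "i < l" "j < l" using A by (simp_all add: B_def)
      have entry: "?C $$ (i, q) = [:- (A $$ (i, q)), if i = q then 1 else 0:]" if "q < l" for q
        using A ij that by (simp add: char_poly_matrix_def)
      have c: "coeff (?C $$ (i, q) * P $$ (q, j)) k = (if i = q then B k $$ (q, j) else 0) - A $$ (i, q) * B (Suc k) $$ (q, j)"
        if "q < l" for q
        unfolding entry[OF that] using that ij by (cases k) (auto simp: B_def)
      have "(coeff (char_poly A) k \<cdot>\<^sub>m 1\<^sub>m l) $$ (i, j) = coeff ((?C * P) $$ (i, j)) k"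
        unfolding P(2) using ij by simp
      also have "(?C * P) $$ (i, j) = (\<Sum>q = 0..<l. ?C $$ (i, q) * P $$ (q, j))"
        using ij C P(1) by (simp add: scalar_prod_def)
      also have "coeff \<dots> k = (\<Sum>q = 0..<l. (if i = q then B k $$ (q, j) else 0) - A $$ (i, q) * B (Suc k) $$ (q, j))"
        unfolding coeff_sum by (intro sum.cong refl c) simp
      also have "\<dots> = B k $$ (i, j) - (\<Sum>q = 0..<l. A $$ (i, q) * B (Suc k) $$ (q, j))"
        using ij by (simp add: sum_subtractf)
      also have "\<dots> = (B k - A * B (Suc k)) $$ (i, j)"
        using ij A by (simp add: B_def scalar_prod_def)
      finally show "(coeff (char_poly A) k \<cdot>\<^sub>m 1\<^sub>m l) $$ (i, j) = (B k - A * B (Suc k)) $$ (i, j)" .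
    qed (use A in \<open>simp_all add: B_def\<close>)
  qed
qed

text \<open>By \<open>char_poly_coeff_decomp\<close>, the sum of the matrices \<open>\<chi>\<^sub>k A\<^sup>k W\<close> telescopes.\<close>

lemma cayley_hamilton_entry:
  assumes A: "A \<in> carrier_mat l l" and W: "W \<in> carrier_mat l n" and ij: "i < l" "j < n"
  shows "(\<Sum>k\<le>degree (char_poly A). coeff (char_poly A) k * mat_iter A k W $$ (i, j)) = 0"
proof -
  obtain B N where B: "\<And>k. B k \<in> carrier_mat l l" "B 0 = 0\<^sub>m l l" "\<And>k. k \<ge> N \<Longrightarrow> B k = 0\<^sub>m l l"
    "\<And>k. coeff (char_poly A) k \<cdot>\<^sub>m 1\<^sub>m l = B k - A * B (Suc k)"
    using char_poly_coeff_decomp[OF A] by metis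
  let ?c = "coeff (char_poly A)"
  define t where "t k = mat_iter A k (B k * W) $$ (i, j)" for k
  have tele: "?c k * mat_iter A k W $$ (i, j) = t k - t (Suc k)" for k
  proof -
    have BW: "B k * W \<in> carrier_mat l n" "A * (B (Suc k) * W) \<in> carrier_mat l n" for k
      using A B(1) W by (meson mult_carrier_mat)+
    have "?c k \<cdot>\<^sub>m W = (?c k \<cdot>\<^sub>m 1\<^sub>m l) * W"
      using W by (simp add: mult_smult_assoc_mat[of _ l l _ n])
    also have "\<dots> = B k * W - A * B (Suc k) * W"
      unfolding B(4) by (rule minus_mult_distrib_mat[OF B(1) mult_carrier_mat[OF A B(1)] W])
    also have "A * B (Suc k) * W = A * (B (Suc k) * W)"
      by (rule assoc_mult_mat[OF A B(1) W])
    finally have "mat_iter A k (?c k \<cdot>\<^sub>m W) = mat_iter A k (B k * W) - mat_iter A (Suc k) (B (Suc k) * W)"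
      by (simp add: mat_iter_diff[OF A BW] mat_iter_Suc')
    then have e: "?c k \<cdot>\<^sub>m mat_iter A k W = mat_iter A k (B k * W) - mat_iter A (Suc k) (B (Suc k) * W)"
      by (simp add: mat_iter_smult[OF A W])
    note d = carrier_matD[OF mat_iter_carrier[OF A W]] carrier_matD[OF mat_iter_carrier[OF A BW(1)]]
    show ?thesis unfolding t_def using arg_cong[OF e, of "\<lambda>M. M $$ (i, j)"] ij by (simp add: d)
  qed
  \<comment> \<open>An upper limit beyond which both the coefficients and the matrices \<open>B k\<close> vanish.\<close>
  let ?M = "Suc (max N (degree (char_poly A)))"
  have "(\<Sum>k\<le>degree (char_poly A). ?c k * mat_iter A k W $$ (i, j)) = (\<Sum>k<?M. ?c k * mat_iter A k W $$ (i, j))"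
    by (rule sum.mono_neutral_left) (auto simp: coeff_eq_0)
  also have "\<dots> = t 0 - t ?M"
    unfolding tele by (simp add: sum_lessThan_telescope' del: sum.lessThan_Suc)
  also have "t ?M = 0"
  proof -
    have "B ?M * W = 0 \<cdot>\<^sub>m W" using W B(3)[of ?M] by (intro eq_matI) auto
    then show ?thesis unfolding t_def using mat_iter_smult[OF A W] carrier_matD[OF mat_iter_carrier[OF A W]] ij by simp
  qed
  also have "t 0 = 0" using W ij by (simp add: t_def B(2))
  finally show ?thesis by simp
qed

lemma cayley_hamilton_markov:
  assumes A: "A \<in> carrier_mat l l" and W: "W \<in> carrier_mat l n" and C: "C \<in> carrier_mat m l" and ij: "i < m" "j < n"
  shows "(\<Sum>k\<le>degree (char_poly A). coeff (char_poly A) k * (C * mat_iter A (k + s) W) $$ (i, j)) = 0"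
proof -
  have it: "mat_iter A (k + s) W = mat_iter A k (mat_iter A s W)" for k
    by (simp add: mat_iter_def funpow_add)
  have W': "mat_iter A s W \<in> carrier_mat l n" using A W by simp
  have "(C * mat_iter A (k + s) W) $$ (i, j) = (\<Sum>q = 0..<l. C $$ (i, q) * mat_iter A k (mat_iter A s W) $$ (q, j))" for k
    unfolding it using ij C carrier_matD[OF mat_iter_carrier[OF A W']] by (simp add: scalar_prod_def)
  then have "(\<Sum>k\<le>degree (char_poly A). coeff (char_poly A) k * (C * mat_iter A (k + s) W) $$ (i, j)) =
    (\<Sum>q = 0..<l. C $$ (i, q) * (\<Sum>k\<le>degree (char_poly A). coeff (char_poly A) k * mat_iter A k (mat_iter A s W) $$ (q, j)))"
    by (simp add: sum_distrib_left sum.swap[of _ "{..degree (char_poly A)}"] algebra_simps)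
  also have "\<dots> = 0" by (simp add: cayley_hamilton_entry[OF A W' _ ij(2)])
  finally show ?thesis .
qed

text \<open>A geometric sequence that is the difference of a sequence annihilated by \<open>p\<close> and one annihilated by
\<open>q\<close>, both polynomials acting through the shift, is annihilated by the product of \<open>p\<close> and \<open>q\<close>. On the
geometric sequence this product acts as multiplication by \<open>p(c) q(c)\<close>.\<close>

lemma geometric_annihilated:
  fixes w x y :: "nat \<Rightarrow> complex" and p q :: "complex poly"
  assumes p: "\<And>s. (\<Sum>k\<le>degree p. coeff p k * x (k + s)) = 0"
    and q: "\<And>s. (\<Sum>k\<le>degree q. coeff q k * y (k + s)) = 0"
    and w: "\<And>k. x k - y k = c ^ k * w0" and "poly p c \<noteq> 0" "poly q c \<noteq> 0"
  shows "w0 = 0"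
proof -
  have "(\<Sum>k\<le>degree p. coeff p k * (x (k + s) - y (k + s))) = - (\<Sum>k\<le>degree p. coeff p k * y (k + s))" for s
    using p[of s] by (simp add: right_diff_distrib sum_subtractf)
  moreover have "(\<Sum>k\<le>degree p. coeff p k * (x (k + s) - y (k + s))) = poly p c * c ^ s * w0" for s
    unfolding w poly_altdef sum_distrib_right by (simp add: power_add mult_ac)
  ultimately have *: "poly p c * c ^ s * w0 = - (\<Sum>k\<le>degree p. coeff p k * y (k + s))" for s by metis
  have "poly q c * poly p c * w0 = (\<Sum>s\<le>degree q. coeff q s * (poly p c * c ^ s * w0))"
    unfolding poly_altdef[of q] sum_distrib_right by (simp add: mult_ac)
  also have "\<dots> = - (\<Sum>s\<le>degree q. \<Sum>k\<le>degree p. coeff q s * (coeff p k * y (k + s)))"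
    unfolding * by (simp add: sum_negf sum_distrib_left)
  also have "(\<Sum>s\<le>degree q. \<Sum>k\<le>degree p. coeff q s * (coeff p k * y (k + s))) =
      (\<Sum>k\<le>degree p. coeff p k * (\<Sum>s\<le>degree q. coeff q s * y (s + k)))"
    by (subst sum.swap) (simp add: sum_distrib_left mult_ac add.commute)
  also have "\<dots> = 0" by (simp add: q)
  finally show ?thesis using assms(4,5) by simp
qed

section \<open>Realizations and their Markov parameters\<close>

lemma mult_entry:
  assumes "X \<in> carrier_mat m l" "Y \<in> carrier_mat l n" "i < m" "j < n"
  shows "(X * Y) $$ (i, j) = (\<Sum>q = 0..<l. X $$ (i, q) * Y $$ (q, j))"
  using assms by (simp add: scalar_prod_def)

lemma Zplus_mat_mult_left:
  assumes F: "\<And>w. F w \<in> carrier_mat l n" and C: "C \<in> carrier_mat m l"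
  shows "Zplus_mat L (\<lambda>w. C * F w) z = C * Zplus_mat L F z"
proof (rule eq_matI)
  have CF: "C * F w \<in> carrier_mat m n" for w using C F[of w] by simp
  fix i j assume "i < dim_row (C * Zplus_mat L F z)" "j < dim_col (C * Zplus_mat L F z)"
  then have ij: "i < m" "j < n" using C carrier_matD[OF F[of z]] by simp_all
  show "Zplus_mat L (\<lambda>w. C * F w) z $$ (i, j) = (C * Zplus_mat L F z) $$ (i, j)"
    unfolding Zplus_mat_index[OF CF ij] mult_entry[OF C F ij] Zplus_lincomb
      mult_entry[OF C Zplus_mat_carrier[OF F] ij]
    by (intro sum.cong refl) (simp add: Zplus_mat_index[OF F _ ij(2)])
qed (use C F[of z] in simp_all)

lemma Zplus_mat_mult_right:
  assumes F: "\<And>w. F w \<in> carrier_mat m l" and E: "E \<in> carrier_mat l n"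
  shows "Zplus_mat L (\<lambda>w. F w * E) z = Zplus_mat L F z * E"
proof (rule eq_matI)
  have FE: "F w * E \<in> carrier_mat m n" for w using E F[of w] by simp
  fix i j assume "i < dim_row (Zplus_mat L F z * E)" "j < dim_col (Zplus_mat L F z * E)"
  then have ij: "i < m" "j < n" using E carrier_matD[OF F[of z]] by simp_all
  show "Zplus_mat L (\<lambda>w. F w * E) z $$ (i, j) = (Zplus_mat L F z * E) $$ (i, j)"
    unfolding Zplus_mat_index[OF FE ij] mult_entry[OF F E ij] mult.commute[of _ "E $$ (_, j)"] Zplus_lincomb
      mult_entry[OF Zplus_mat_carrier[OF F] E ij]
    by (intro sum.cong refl) (simp add: Zplus_mat_index[OF F ij(1)])
qed (use E F[of z] in simp_all)

lemma DA_mat_mult_left: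
  assumes F: "F \<in> DA_mat L l n" and C: "C \<in> carrier_mat m l"
  shows "(\<lambda>z. C * F z) \<in> DA_mat L m n"
  unfolding DA_mat_def
proof (intro CollectI conjI allI impI)
  note c = DA_matD(1)[OF F]
  show "C * F z \<in> carrier_mat m n" for z using C c by (rule mult_carrier_mat)
  fix i j assume ij: "i < m" "j < n"
  show "(\<lambda>z. (C * F z) $$ (i, j)) \<in> DA L"
    unfolding mult_entry[OF C c ij] by (intro DA_lincomb DA_matD(2)[OF F _ ij(2)]) simp
qed

lemma DA_mat_mult_right:
  assumes F: "F \<in> DA_mat L m l" and E: "E \<in> carrier_mat l n"
  shows "(\<lambda>z. F z * E) \<in> DA_mat L m n"
  unfolding DA_mat_def
proof (intro CollectI conjI allI impI)
  note c = DA_matD(1)[OF F]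
  show "F z * E \<in> carrier_mat m n" for z using c E by (rule mult_carrier_mat)
  fix i j assume ij: "i < m" "j < n"
  show "(\<lambda>z. (F z * E) $$ (i, j)) \<in> DA L"
    unfolding mult_entry[OF c E ij] mult.commute[of _ "E $$ (_, j)"]
    by (intro DA_lincomb DA_matD(2)[OF F ij(1)]) simp
qed

text \<open>The function \<open>D + C (I - zA)\<^sup>-\<^sup>\<odot> \<odot> (zB)\<close>, extended by zero outside of the vertex set.\<close>

definition realization_fun ::
  "complex set set \<Rightarrow> nat \<Rightarrow> nat \<Rightarrow> complex mat \<Rightarrow> complex mat \<Rightarrow> complex mat \<Rightarrow> complex mat \<Rightarrow> complex \<Rightarrow> complex mat" where
  "realization_fun L m n A B C D z =
    (if z \<in> vertices L then D + C * (Zplus_mat L (resolvent L A) z * B) else 0\<^sub>m m n)"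

text \<open>Discrete analyticity of the realized function is automatic, as \<open>Z\<^sub>+\<close> of the resolvent is discrete
analytic.\<close>

lemma is_realization_iff:
  assumes L: "rhombic_lattice L" "0 \<in> vertices L"
  shows "is_realization L m n l A B C D f \<longleftrightarrow>
     A \<in> carrier_mat l l \<and> B \<in> carrier_mat l n \<and> C \<in> carrier_mat m l \<and> D \<in> carrier_mat m n \<and>
     S_set L \<inter> spectrum A = {} \<and> f = realization_fun L m n A B C D" (is "_ \<longleftrightarrow> ?R")
proof
  assume r: "is_realization L m n l A B C D f"
  then have c: "A \<in> carrier_mat l l" "B \<in> carrier_mat l n" "C \<in> carrier_mat m l" "D \<in> carrier_mat m n"
    "S_set L \<inter> spectrum A = {}" and f: "f \<in> DA_mat L m n"
    "\<And>z. z \<in> vertices L \<Longrightarrow> f z = D + C * conv_poly L l n (resolvent L A) [0\<^sub>m l n, B] z"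
    unfolding is_realization_def by simp_all
  have R: "resolvent L A z \<in> carrier_mat l l" for z
    using resolvent(1)[OF L c(1,5)] DA_matD(1) unfolding is_resolvent_def by blast
  have "f z = realization_fun L m n A B C D z" for z
    unfolding realization_fun_def
    using f(2) DA_mat_outside[OF f(1)] by (simp add: conv_poly_monomial[OF c(2) R])
  with c show ?R by auto
next
  assume ?R
  then have c: "A \<in> carrier_mat l l" "B \<in> carrier_mat l n" "C \<in> carrier_mat m l" "D \<in> carrier_mat m n"
    "S_set L \<inter> spectrum A = {}" and f: "f = realization_fun L m n A B C D" by simp_all
  note res = resolvent[OF L c(1,5)]
  have R: "resolvent L A z \<in> carrier_mat l l" for z
    using res(1) DA_matD(1) unfolding is_resolvent_def by blast
  define g where "g z = C * (Zplus_mat L (resolvent L A) z * B)" for z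
  have g: "g \<in> DA_mat L m n"
    unfolding g_def by (rule DA_mat_mult_left[OF DA_mat_mult_right[OF res(2) c(2)] c(3)])
  have fz: "f z = D + g z" if "z \<in> vertices L" for z
    using that by (simp add: f g_def realization_fun_def)
  have "f \<in> DA_mat L m n"
  proof (rule DA_matI_primitive)
    show "f z \<in> carrier_mat m n" for z
      using fz[of z] c(4) DA_matD(1)[OF g] by (cases "z \<in> vertices L") (simp_all add: f realization_fun_def)
    show "f z = 0\<^sub>m m n" if "z \<notin> vertices L" for z using that by (simp add: f realization_fun_def)
    fix i j assume ij: "i < m" "j < n"
    let ?g = "\<lambda>z. g z $$ (i, j)"
    have prim: "primitive L ?g (\<lambda>z. dint L 0 z ?g)"
      using DA_matD(2)[OF g ij] by (intro DA_primitive L) (simp add: DA_def)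
    show "primitive L (\<lambda>z. f z $$ (i, j)) (\<lambda>z. D $$ (i, j) * z + dint L 0 z ?g)"
      unfolding primitive_def
    proof (intro ballI, clarify)
      fix a b assume ab: "(a, b) \<in> edges L"
      have "f z $$ (i, j) = D $$ (i, j) + g z $$ (i, j)" if "z \<in> vertices L" for z
        using fz[OF that] carrier_matD[OF DA_matD(1)[OF g]] ij by simp
      then have e: "f a $$ (i, j) = D $$ (i, j) + g a $$ (i, j)" "f b $$ (i, j) = D $$ (i, j) + g b $$ (i, j)"
        using edges_vertices[OF L(1) ab] by simp_all
      have "(f a $$ (i, j) + f b $$ (i, j)) / 2 * (b - a) =
          D $$ (i, j) * (b - a) + (g a $$ (i, j) + g b $$ (i, j)) / 2 * (b - a)"
        unfolding e by (simp add: field_simps)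
      then show "(f a $$ (i, j) + f b $$ (i, j)) / 2 * (b - a) =
          D $$ (i, j) * b + dint L 0 b ?g - (D $$ (i, j) * a + dint L 0 a ?g)"
        unfolding primitiveD[OF prim ab] by (simp add: algebra_simps)
    qed
  qed
  moreover have "f z = D + C * conv_poly L l n (resolvent L A) [0\<^sub>m l n, B] z" if "z \<in> vertices L" for z
    using fz[OF that] by (simp add: g_def conv_poly_monomial[OF c(2) R])
  ultimately show "is_realization L m n l A B C D f" unfolding is_realization_def using c by simp
qed

text \<open>The Markov parameters: \<open>D\<close> at index 0 and \<open>C A\<^sup>k B\<close> at index \<open>k + 1\<close>.\<close>

definition markov :: "complex mat \<Rightarrow> complex mat \<Rightarrow> complex mat \<Rightarrow> complex mat \<Rightarrow> nat \<Rightarrow> complex mat" where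
  "markov A B C D k = (case k of 0 \<Rightarrow> D | Suc k \<Rightarrow> C * mat_iter A k B)"

lemma markov_carrier:
  assumes "A \<in> carrier_mat l l" "B \<in> carrier_mat l n" "C \<in> carrier_mat m l" "D \<in> carrier_mat m n"
  shows "markov A B C D k \<in> carrier_mat m n"
  using assms mat_iter_carrier[OF assms(1,2)] by (cases k) (simp_all add: markov_def)

text \<open>With \<open>g E = C R E\<close> for the resolvent \<open>R\<close>, \<open>Z\<^sub>-\<close> maps the given function to \<open>g B\<close> and \<open>g E\<close> to \<open>g (A E)\<close>.\<close>

lemma Zminus_funpow_realization:
  assumes L: "rhombic_lattice L" "0 \<in> vertices L" "unit_step_reachable L"
    and f: "is_realization L m n l A B C D f" and ij: "i < m" "j < n"
  shows "(Zminus L ^^ k) (\<lambda>z. f z $$ (i, j)) 0 = markov A B C D k $$ (i, j)"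
proof -
  have c: "A \<in> carrier_mat l l" "B \<in> carrier_mat l n" "C \<in> carrier_mat m l" "D \<in> carrier_mat m n"
    "S_set L \<inter> spectrum A = {}" and f: "f = realization_fun L m n A B C D"
    using f unfolding is_realization_iff[OF L(1,2)] by simp_all
  define R where "R = resolvent L A"
  have "is_resolvent L A l R" unfolding R_def by (rule resolvent[OF L(1,2) c(1,5)])
  then have DR: "R \<in> DA_mat L l l" and R1: "\<And>z. z \<in> vertices L \<Longrightarrow> R z = 1\<^sub>m l + A * Zplus_mat L R z"
    and R2: "\<And>z. z \<in> vertices L \<Longrightarrow> R z = 1\<^sub>m l + Zplus_mat L R z * A"
    unfolding is_resolvent_def by blast+
  note cR = DA_matD(1)[OF DR] and cZ = Zplus_mat_carrier[OF DA_matD(1)[OF DR]]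
  note R0 = resolvent_at_0[OF L(1,2) c(1) DR R1] and Z0 = Zplus_mat_0[OF L(1,2) DR]
  define g where "g E z = (C * (R z * E)) $$ (i, j)" for E z
  have gDA: "g E \<in> DA L" if "E \<in> carrier_mat l n" for E
    unfolding g_def by (rule DA_matD(2)[OF DA_mat_mult_left[OF DA_mat_mult_right[OF DR that] c(3)] ij])
  have Zg: "Zplus L (g E) z = (C * (Zplus_mat L R z * E)) $$ (i, j)" if E: "E \<in> carrier_mat l n" for E z
  proof -
    have RE: "R w * E \<in> carrier_mat l n" for w using cR E by (rule mult_carrier_mat)
    have "Zplus L (g E) z = Zplus_mat L (\<lambda>w. C * (R w * E)) z $$ (i, j)"
      unfolding g_def Zplus_mat_index[of "\<lambda>w. C * (R w * E)", OF mult_carrier_mat[OF c(3) RE] ij] ..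
    then show ?thesis unfolding Zplus_mat_mult_left[OF RE c(3)] Zplus_mat_mult_right[OF cR E] .
  qed
  have CZ: "C * (Zplus_mat L R z * E) \<in> carrier_mat m n" if "E \<in> carrier_mat l n" for E z
    using c(3) cZ that by (meson mult_carrier_mat)
  have CZ0: "C * (Zplus_mat L R 0 * E) = 0\<^sub>m m n" if "E \<in> carrier_mat l n" for E
    unfolding Z0 using that c(3) by simp
  have first: "Zminus L (\<lambda>z. f z $$ (i, j)) = g B"
  proof (rule Zminus_eqI[OF L gDA[OF c(2)]])
    fix z assume z: "z \<in> vertices L"
    show "Zplus L (g B) z = f z $$ (i, j) - f 0 $$ (i, j)"
      unfolding Zg[OF c(2)] using z L(2) c(4) ij CZ0[OF c(2)] carrier_matD[OF CZ[OF c(2)]]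
      by (simp add: f realization_fun_def R_def[symmetric] del: index_mult_mat(1))
  qed
  have step: "Zminus L (g E) = g (A * E)" if E: "E \<in> carrier_mat l n" for E
  proof (rule Zminus_eqI[OF L])
    have AE: "A * E \<in> carrier_mat l n" using c(1) E by (rule mult_carrier_mat)
    show "g (A * E) \<in> DA L" by (rule gDA[OF AE])
    fix z assume z: "z \<in> vertices L"
    have split: "g E z = (C * E) $$ (i, j) + (C * (Zplus_mat L R z * (A * E))) $$ (i, j)" if z: "z \<in> vertices L" for z
    proof -
      have "R z * E = 1\<^sub>m l * E + Zplus_mat L R z * A * E"
        by (subst R2[OF z]) (rule add_mult_distrib_mat[OF one_carrier_mat mult_carrier_mat[OF cZ c(1)] E])
      also have "\<dots> = E + Zplus_mat L R z * (A * E)"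
        using E assoc_mult_mat[OF cZ c(1) E] by simp
      finally have "C * (R z * E) = C * E + C * (Zplus_mat L R z * (A * E))"
        using mult_add_distrib_mat[OF c(3) E mult_carrier_mat[OF cZ AE]] by simp
      then show ?thesis unfolding g_def using ij carrier_matD[OF CZ[OF AE]] by (simp del: index_mult_mat(1))
    qed
    show "Zplus L (g (A * E)) z = g E z - g E 0"
      unfolding split[OF z] split[OF L(2)] Zg[OF AE] CZ0[OF AE] using ij by simp
  qed
  have iter: "(Zminus L ^^ Suc k) (\<lambda>z. f z $$ (i, j)) = g (mat_iter A k B)" for k
  proof (induction k)
    case (Suc k)
    then show ?case using step[OF mat_iter_carrier[OF c(1,2)], of k] by (simp add: mat_iter_Suc)
  qed (simp add: first)
  show ?thesis
  proof (cases k)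
    case 0
    then show ?thesis using L(2) c(4) ij CZ0[OF c(2)]
      by (simp add: markov_def f realization_fun_def R_def[symmetric])
  next
    case (Suc k')
    then show ?thesis
      using iter[of k'] left_mult_one_mat[OF mat_iter_carrier[OF c(1,2)]] by (simp add: markov_def g_def R0)
  qed
qed

lemma tau_realization:
  assumes L: "rhombic_lattice L" "0 \<in> vertices L" "unit_step_reachable L"
    and f: "is_realization L m n l A B C D f"
  shows "tau L f = Matrix.mat m n (\<lambda>(i, j). Abs_fps (\<lambda>k. markov A B C D k $$ (i, j)))"
proof -
  have "f 0 \<in> carrier_mat m n" using f DA_matD(1) unfolding is_realization_def by blast
  then show ?thesis unfolding tau_def
    by (intro eq_matI) (simp_all add: Zminus_funpow_realization[OF L f])
qed

text \<open>By induction along edges, the sequences \<open>C A\<^sup>k R B\<close> of the two realizations agree at every vertex.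
At index 0 this is the equality of the functions \<open>C R B\<close>; the realized functions are obtained from them
by applying \<open>Z\<^sub>+\<close> and adding \<open>D\<close>.\<close>

lemma realization_markov_unique:
  assumes L: "rhombic_lattice L" "0 \<in> vertices L"
    and f: "is_realization L m n l A B C D f" and f': "is_realization L m n l' A' B' C' D' f'"
    and eq: "\<And>k. markov A B C D k = markov A' B' C' D' k"
  shows "f = f'"
proof -
  have c: "A \<in> carrier_mat l l" "B \<in> carrier_mat l n" "C \<in> carrier_mat m l" "D \<in> carrier_mat m n"
    "S_set L \<inter> spectrum A = {}" and f: "f = realization_fun L m n A B C D"
    using f unfolding is_realization_iff[OF L] by simp_all
  have c': "A' \<in> carrier_mat l' l'" "B' \<in> carrier_mat l' n" "C' \<in> carrier_mat m l'" "D' \<in> carrier_mat m n"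
    "S_set L \<inter> spectrum A' = {}" and f': "f' = realization_fun L m n A' B' C' D'"
    using f' unfolding is_realization_iff[OF L] by simp_all
  have D: "D = D'" using eq[of 0] by (simp add: markov_def)
  have CB: "C * mat_iter A k B = C' * mat_iter A' k B'" for k using eq[of "Suc k"] by (simp add: markov_def)
  define R where "R = resolvent L A"
  define R' where "R' = resolvent L A'"
  have DR: "R \<in> DA_mat L l l" and R1: "\<And>z. z \<in> vertices L \<Longrightarrow> R z = 1\<^sub>m l + A * Zplus_mat L R z"
    using resolvent(1)[OF L c(1,5)] unfolding is_resolvent_def R_def by blast+
  have DR': "R' \<in> DA_mat L l' l'" and R1': "\<And>z. z \<in> vertices L \<Longrightarrow> R' z = 1\<^sub>m l' + A' * Zplus_mat L R' z"
    using resolvent(1)[OF L c'(1,5)] unfolding is_resolvent_def R'_def by blast+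
  note cR = DA_matD(1)[OF DR] and cR' = DA_matD(1)[OF DR']
  have recursion: "2 * (C * mat_iter A k (R b * B)) $$ (i, j) + (1 - (b - a)) * (C * mat_iter A (Suc k) (R b * B)) $$ (i, j) =
      2 * (C * mat_iter A k (R a * B)) $$ (i, j) + (1 + (b - a)) * (C * mat_iter A (Suc k) (R a * B)) $$ (i, j)"
    if ab: "(a, b) \<in> edges L" and ij: "i < m" "j < n"
      and A: "A \<in> carrier_mat l l" and B: "B \<in> carrier_mat l n" and C: "C \<in> carrier_mat m l"
      and DR: "R \<in> DA_mat L l l" and R1: "\<And>z. z \<in> vertices L \<Longrightarrow> R z = 1\<^sub>m l + A * Zplus_mat L R z"
    for a b i j k l A B C R
  proof -
    note cR = DA_matD(1)[OF DR]
    have RB: "R z * B \<in> carrier_mat l n" for z using cR B by (rule mult_carrier_mat)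
    have ARB: "A * (R z * B) \<in> carrier_mat l n" for z using A RB by (rule mult_carrier_mat)
    have I: "mat_iter A k (X :: complex mat) \<in> carrier_mat l n" if "X \<in> carrier_mat l n" for X k
      using A that by simp
    have expand: "C * mat_iter A k (step_mat A u * R z * B) =
        2 \<cdot>\<^sub>m (C * mat_iter A k (R z * B)) + (1 - u) \<cdot>\<^sub>m (C * mat_iter A (Suc k) (R z * B))" for u z
    proof -
      have "step_mat A u * R z * B = step_mat A u * (R z * B)"
        by (rule assoc_mult_mat[OF step_mat_carrier[OF A] cR B])
      also have "\<dots> = 2 \<cdot>\<^sub>m (R z * B) + (1 - u) \<cdot>\<^sub>m (A * (R z * B))"
        by (rule step_mat_mult[OF A RB])
      also have "mat_iter A k \<dots> = 2 \<cdot>\<^sub>m mat_iter A k (R z * B) + (1 - u) \<cdot>\<^sub>m mat_iter A (Suc k) (R z * B)"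
        using RB ARB by (simp add: mat_iter_add[OF A, of _ n] mat_iter_smult[OF A, of _ n] mat_iter_Suc')
      finally show ?thesis
        using mult_add_distrib_mat[OF C smult_carrier_mat[OF I[OF RB]] smult_carrier_mat[OF I[OF RB]]]
          mult_smult_distrib[OF C I[OF RB]] by simp
    qed
    have "step_mat A (b - a) * R b = step_mat A (- (b - a)) * R a"
      by (rule resolvent_edge[OF L A DR R1 ab])
    then have "C * mat_iter A k (step_mat A (b - a) * R b * B) = C * mat_iter A k (step_mat A (- (b - a)) * R a * B)"
      by simp
    from arg_cong[OF this[unfolded expand], of "\<lambda>M. M $$ (i, j)"] show ?thesis
      using ij carrier_matD[OF C] carrier_matD[OF I[OF RB]] by (simp del: index_mult_mat(1))
  qed
  have entry: "(C * mat_iter A k (R z * B)) $$ (i, j) = (C' * mat_iter A' k (R' z * B')) $$ (i, j)"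
    if "z \<in> vertices L" and ij: "i < m" "j < n" for z i j k
    using vertices_connected[OF L that(1)]
  proof (induction arbitrary: k rule: rtrancl_induct)
    case base
    show ?case
      using resolvent_at_0[OF L c(1) DR R1] resolvent_at_0[OF L c'(1) DR' R1'] CB[of k]
        left_mult_one_mat[OF c(2)] left_mult_one_mat[OF c'(2)] by simp
  next
    case (step a b)
    let ?x = "\<lambda>k. (C * mat_iter A k (R b * B)) $$ (i, j)" and ?y = "\<lambda>k. (C' * mat_iter A' k (R' b * B')) $$ (i, j)"
    define u where "u = b - a"
    have u: "u \<in> directions L" using step(2) unfolding u_def directions_def by blast
    \<comment> \<open>The right-hand sides of both recursions agree by the induction hypothesis.\<close>
    have w: "2 * (?x k - ?y k) + (1 - u) * (?x (Suc k) - ?y (Suc k)) = 0" for k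
    proof -
      have x: "2 * ?x k + (1 - u) * ?x (Suc k) = 2 * (C * mat_iter A k (R a * B)) $$ (i, j)
          + (1 + u) * (C * mat_iter A (Suc k) (R a * B)) $$ (i, j)"
        unfolding u_def by (rule recursion[OF step(2) ij c(1-3) DR R1])
      have y: "2 * ?y k + (1 - u) * ?y (Suc k) = 2 * (C * mat_iter A k (R a * B)) $$ (i, j)
          + (1 + u) * (C * mat_iter A (Suc k) (R a * B)) $$ (i, j)"
        unfolding u_def step(3) by (rule recursion[OF step(2) ij c'(1-3) DR' R1'])
      have "2 * (?x k - ?y k) + (1 - u) * (?x (Suc k) - ?y (Suc k)) =
        (2 * ?x k + (1 - u) * ?x (Suc k)) - (2 * ?y k + (1 - u) * ?y (Suc k))"
        by (simp only: right_diff_distrib) simp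
      then show ?thesis unfolding x y by simp
    qed
    show "?x k = ?y k"
    proof (cases "u = 1")
      case True
      then show ?thesis using w[of k] by simp
    next
      case False
      define t where "t = - 2 / (1 - u)"
      have t: "t * (1 - u) = - 2" using nonzero_eq_divide_eq[of "1 - u" t "- 2"] False t_def by simp
      have "t \<in> S_set L" unfolding t_def by (rule direction_S_set[OF L(1) u False])
      then have "\<not> eigenvalue A t" "\<not> eigenvalue A' t" using c(5) c'(5) unfolding spectrum_def by blast+
      then have roots: "poly (char_poly A) t \<noteq> 0" "poly (char_poly A') t \<noteq> 0"
        using eigenvalue_root_char_poly[OF c(1)] eigenvalue_root_char_poly[OF c'(1)] by blast+
      have "?x (Suc k) - ?y (Suc k) = t * (?x k - ?y k)" for k
      proof -
        have "(1 - u) * (?x (Suc k) - ?y (Suc k)) = (1 - u) * (t * (?x k - ?y k))"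
          using w[of k] t by (simp add: add_eq_0_iff2 mult.assoc[symmetric] mult.commute[of "1 - u" t])
        then show ?thesis using False by simp
      qed
      then have geo: "?x k - ?y k = t ^ k * (?x 0 - ?y 0)" for k
        by (induction k) (simp_all add: mult.assoc)
      have "?x 0 - ?y 0 = 0"
        by (rule geometric_annihilated[OF _ _ geo roots])
          (rule cayley_hamilton_markov[OF c(1) mult_carrier_mat[OF cR c(2)] c(3) ij]
            cayley_hamilton_markov[OF c'(1) mult_carrier_mat[OF cR' c'(2)] c'(3) ij])+
      then show ?thesis using geo[of k] by simp
    qed
  qed
  have RB: "R z * B \<in> carrier_mat l n" "R' z * B' \<in> carrier_mat l' n" for z
    by (rule mult_carrier_mat[OF cR c(2)], rule mult_carrier_mat[OF cR' c'(2)])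
  have "(\<lambda>z. C * (R z * B)) = (\<lambda>z. C' * (R' z * B'))"
  proof (rule DA_mat_eqI[of _ L m n])
    show "(\<lambda>z. C * (R z * B)) \<in> DA_mat L m n" "(\<lambda>z. C' * (R' z * B')) \<in> DA_mat L m n"
      by (rule DA_mat_mult_left[OF DA_mat_mult_right[OF DR c(2)] c(3)],
        rule DA_mat_mult_left[OF DA_mat_mult_right[OF DR' c'(2)] c'(3)])
    fix z assume z: "z \<in> vertices L"
    show "C * (R z * B) = C' * (R' z * B')"
    proof (rule eq_matI)
      fix i j assume "i < dim_row (C' * (R' z * B'))" "j < dim_col (C' * (R' z * B'))"
      then have "i < m" "j < n" using c' by simp_all
      from entry[OF z this, of 0] show "(C * (R z * B)) $$ (i, j) = (C' * (R' z * B')) $$ (i, j)" by simp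
    qed (use c c' in simp_all)
  qed
  then have "Zplus_mat L (\<lambda>z. C * (R z * B)) = Zplus_mat L (\<lambda>z. C' * (R' z * B'))" by simp
  moreover have "C * (Zplus_mat L R z * B) = Zplus_mat L (\<lambda>z. C * (R z * B)) z" for z
    unfolding Zplus_mat_mult_left[OF RB(1) c(3)] Zplus_mat_mult_right[OF cR c(2)] ..
  moreover have "C' * (Zplus_mat L R' z * B') = Zplus_mat L (\<lambda>z. C' * (R' z * B')) z" for z
    unfolding Zplus_mat_mult_left[OF RB(2) c'(3)] Zplus_mat_mult_right[OF cR' c'(2)] ..
  ultimately have "C * (Zplus_mat L R z * B) = C' * (Zplus_mat L R' z * B')" for z by simp
  then show ?thesis unfolding f f' realization_fun_def R_def R'_def D by (intro ext) simp
qed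

section \<open>The product realization\<close>

lemma append_cols_eq:
  assumes "X \<in> carrier_mat m n1" "Y \<in> carrier_mat m n2"
  shows "X @\<^sub>c Y = four_block_mat X Y (0\<^sub>m 0 n1) (0\<^sub>m 0 n2)"
  using assms by (simp add: append_cols_def)

lemma append_rows_eq:
  assumes "X \<in> carrier_mat n1 m" "Y \<in> carrier_mat n2 m"
  shows "X @\<^sub>r Y = four_block_mat X (0\<^sub>m n1 0) Y (0\<^sub>m n2 0)"
  using assms by (simp add: append_rows_def)

lemma block_mult_rows:
  assumes A: "A2 \<in> carrier_mat l2 l2" "G \<in> carrier_mat l1 l2" "A1 \<in> carrier_mat l1 l1"
    and X: "X \<in> carrier_mat l2 n" "Y \<in> carrier_mat l1 n"
  shows "four_block_mat A2 (0\<^sub>m l2 l1) G A1 * (X @\<^sub>r Y) = (A2 * X) @\<^sub>r (G * X + A1 * Y)"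
proof -
  have "four_block_mat A2 (0\<^sub>m l2 l1) G A1 * (X @\<^sub>r Y) =
    four_block_mat (A2 * X + 0\<^sub>m l2 l1 * Y) (A2 * 0\<^sub>m l2 0 + 0\<^sub>m l2 l1 * 0\<^sub>m l1 0)
      (G * X + A1 * Y) (G * 0\<^sub>m l2 0 + A1 * 0\<^sub>m l1 0)"
    unfolding append_rows_eq[OF X]
    by (rule mult_four_block_mat[OF A(1) zero_carrier_mat A(2,3) X(1) zero_carrier_mat X(2) zero_carrier_mat])
  also have "\<dots> = four_block_mat (A2 * X) (0\<^sub>m l2 0) (G * X + A1 * Y) (0\<^sub>m l1 0)"
    using A X by simp
  also have "\<dots> = (A2 * X) @\<^sub>r (G * X + A1 * Y)"
    by (rule append_rows_eq[symmetric]) (use A X in auto)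
  finally show ?thesis .
qed

lemma cols_mult_rows:
  assumes P: "P \<in> carrier_mat m l2" "Q \<in> carrier_mat m l1"
    and X: "X \<in> carrier_mat l2 n" "Y \<in> carrier_mat l1 n"
  shows "(P @\<^sub>c Q) * (X @\<^sub>r Y) = P * X + Q * Y"
proof -
  have "(P @\<^sub>c Q) * (X @\<^sub>r Y) = four_block_mat (P * X + Q * Y) (P * 0\<^sub>m l2 0 + Q * 0\<^sub>m l1 0)
     (0\<^sub>m 0 l2 * X + 0\<^sub>m 0 l1 * Y) (0\<^sub>m 0 l2 * 0\<^sub>m l2 0 + 0\<^sub>m 0 l1 * 0\<^sub>m l1 0)"
    unfolding append_rows_eq[OF X] append_cols_eq[OF P]
    by (rule mult_four_block_mat[OF P zero_carrier_mat zero_carrier_mat X(1) zero_carrier_mat X(2) zero_carrier_mat])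
  then show ?thesis using P X by (intro eq_matI) auto
qed

lemma eigenvalue_block:
  assumes A: "A2 \<in> carrier_mat l2 l2" "G \<in> carrier_mat l1 l2" "A1 \<in> carrier_mat l1 l1"
    and e: "eigenvalue (four_block_mat A2 (0\<^sub>m l2 l1) G A1) t"
  shows "eigenvalue A2 t \<or> eigenvalue A1 (t :: complex)"
proof -
  obtain v where v: "v \<in> carrier_vec (l2 + l1)" "v \<noteq> 0\<^sub>v (l2 + l1)"
    "four_block_mat A2 (0\<^sub>m l2 l1) G A1 *\<^sub>v v = t \<cdot>\<^sub>v v"
    using e A unfolding eigenvalue_def eigenvector_def by auto
  define x y where "x = vec_first v l2" and "y = vec_last v l1"
  have xy: "x \<in> carrier_vec l2" "y \<in> carrier_vec l1" "v = x @\<^sub>v y"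
    using vec_first_last_append[OF v(1)] by (simp_all add: x_def y_def)
  have Ax: "A2 *\<^sub>v x \<in> carrier_vec l2" using A(1) xy(1) by (rule mult_mat_vec_carrier)
  have "0\<^sub>m l2 l1 *\<^sub>v y = 0\<^sub>v l2" using xy(2) by (intro eq_vecI) auto
  then have "A2 *\<^sub>v x + 0\<^sub>m l2 l1 *\<^sub>v y = A2 *\<^sub>v x" using Ax by simp
  then have "(A2 *\<^sub>v x) @\<^sub>v (G *\<^sub>v x + A1 *\<^sub>v y) = t \<cdot>\<^sub>v (x @\<^sub>v y)"
    using v(3) four_block_mat_mult_vec[OF A(1) zero_carrier_mat A(2,3) xy(1,2)] unfolding xy(3) by simp
  also have "t \<cdot>\<^sub>v (x @\<^sub>v y) = (t \<cdot>\<^sub>v x) @\<^sub>v (t \<cdot>\<^sub>v y)" by (rule eq_vecI) auto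
  finally have "A2 *\<^sub>v x = t \<cdot>\<^sub>v x \<and> G *\<^sub>v x + A1 *\<^sub>v y = t \<cdot>\<^sub>v y"
    using append_vec_eq[OF Ax iffD2[OF smult_carrier_vec xy(1)]] by blast
  then have e2: "A2 *\<^sub>v x = t \<cdot>\<^sub>v x" and e1: "G *\<^sub>v x + A1 *\<^sub>v y = t \<cdot>\<^sub>v y" by simp_all
  show ?thesis
  proof (cases "x = 0\<^sub>v l2")
    case False
    then show ?thesis using e2 A xy unfolding eigenvalue_def eigenvector_def by auto
  next
    case True
    have "G *\<^sub>v 0\<^sub>v l2 = 0\<^sub>v l1" using A(2) by (intro eq_vecI) auto
    moreover have "0\<^sub>v l1 + A1 *\<^sub>v y = A1 *\<^sub>v y"
      using mult_mat_vec_carrier[OF A(3) xy(2)] by simp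
    ultimately have "A1 *\<^sub>v y = t \<cdot>\<^sub>v y" using e1 True by simp
    moreover have "y \<noteq> 0\<^sub>v l1" using v(2) xy(3) True by auto
    ultimately show ?thesis using A xy unfolding eigenvalue_def eigenvector_def by auto
  qed
qed

text \<open>The columns \<open>A\<^sup>k B\<close> of the block realization consist of \<open>A\<^sub>2\<^sup>k B\<^sub>2\<close> and a matrix \<open>y k\<close> with
\<open>y (k + 1) = A\<^sub>1 y k + B\<^sub>1 C\<^sub>2 A\<^sub>2\<^sup>k B\<^sub>2\<close>, whose solution is a convolution sum.\<close>

lemma markov_product:
  assumes c1: "A1 \<in> carrier_mat l1 l1" "B1 \<in> carrier_mat l1 n" "C1 \<in> carrier_mat m l1" "D1 \<in> carrier_mat m n"
    and c2: "A2 \<in> carrier_mat l2 l2" "B2 \<in> carrier_mat l2 p" "C2 \<in> carrier_mat n l2" "D2 \<in> carrier_mat n p"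
    and ij: "i < m" "j < p"
  shows "markov (four_block_mat A2 (0\<^sub>m l2 l1) (B1 * C2) A1) (B2 @\<^sub>r (B1 * D2)) ((D1 * C2) @\<^sub>c C1) (D1 * D2) k $$ (i, j)
    = (\<Sum>s = 0..k. (markov A1 B1 C1 D1 s * markov A2 B2 C2 D2 (k - s)) $$ (i, j))"
proof (cases k)
  case 0
  then show ?thesis by (simp add: markov_def)
next
  case (Suc k')
  let ?A = "four_block_mat A2 (0\<^sub>m l2 l1) (B1 * C2) A1" and ?B = "B2 @\<^sub>r (B1 * D2)"
  let ?x = "\<lambda>k. mat_iter A2 k B2" and ?m2 = "markov A2 B2 C2 D2"
  define y where "y = rec_nat (B1 * D2) (\<lambda>k Y. B1 * C2 * ?x k + A1 * Y)"
  have y: "y 0 = B1 * D2" "\<And>k. y (Suc k) = B1 * C2 * ?x k + A1 * y k" by (simp_all add: y_def)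
  have x: "?x k \<in> carrier_mat l2 p" for k using c2 by simp
  have yc: "y k \<in> carrier_mat l1 p" for k
    by (induction k) (use c1 c2 x in \<open>simp_all add: y\<close>)
  note m2 = markov_carrier[OF c2]
  have iter: "mat_iter ?A k ?B = ?x k @\<^sub>r y k" for k
  proof (induction k)
    case (Suc k)
    have "mat_iter ?A (Suc k) ?B = ?A * (?x k @\<^sub>r y k)" by (simp add: mat_iter_Suc Suc)
    also have "\<dots> = (A2 * ?x k) @\<^sub>r (B1 * C2 * ?x k + A1 * y k)"
      by (rule block_mult_rows[OF c2(1) mult_carrier_mat[OF c1(2) c2(3)] c1(1) x yc])
    finally show ?case by (simp add: y(2) mat_iter_Suc)
  qed (simp add: y(1))
  have y': "y (Suc k) = B1 * ?m2 (Suc k) + A1 * y k" for k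
    unfolding y(2) using assoc_mult_mat[OF c1(2) c2(3) x] by (simp add: markov_def)
  have Gy: "(G * y k) $$ (i, j) = (\<Sum>s = 0..k. (G * mat_iter A1 s B1 * ?m2 (k - s)) $$ (i, j))"
    if G: "G \<in> carrier_mat m l1" for G k
    using G
  proof (induction k arbitrary: G)
    case 0
    then show ?case using assoc_mult_mat[OF 0 c1(2) c2(4)] by (simp add: y(1) markov_def)
  next
    case (Suc k)
    have GA: "G * A1 \<in> carrier_mat m l1" using Suc(2) c1(1) by (rule mult_carrier_mat)
    have "G * y (Suc k) = G * (B1 * ?m2 (Suc k)) + G * (A1 * y k)"
      unfolding y' by (rule mult_add_distrib_mat[OF Suc(2) mult_carrier_mat[OF c1(2) m2] mult_carrier_mat[OF c1(1) yc]])
    also have "G * (B1 * ?m2 (Suc k)) = G * B1 * ?m2 (Suc k)"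
      by (rule assoc_mult_mat[OF Suc(2) c1(2) m2, symmetric])
    also have "G * (A1 * y k) = G * A1 * y k"
      by (rule assoc_mult_mat[OF Suc(2) c1(1) yc, symmetric])
    finally have "(G * y (Suc k)) $$ (i, j) = (G * B1 * ?m2 (Suc k)) $$ (i, j) + (G * A1 * y k) $$ (i, j)"
      using ij carrier_matD[OF GA] carrier_matD[OF yc[of k]] by (simp del: index_mult_mat(1))
    also have "(G * A1 * y k) $$ (i, j) = (\<Sum>s = 0..k. (G * mat_iter A1 (Suc s) B1 * ?m2 (k - s)) $$ (i, j))"
      unfolding Suc(1)[OF GA] mat_iter_Suc assoc_mult_mat[OF Suc(2) c1(1) mat_iter_carrier[OF c1(1,2)]] ..
    finally show ?case
      unfolding sum.atLeast0_atMost_Suc_shift by simp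
  qed
  have "markov ?A ?B ((D1 * C2) @\<^sub>c C1) (D1 * D2) k = D1 * C2 * ?x k' + C1 * y k'"
    unfolding Suc markov_def nat.case iter by (rule cols_mult_rows[OF mult_carrier_mat[OF c1(4) c2(3)] c1(3) x yc])
  then have "markov ?A ?B ((D1 * C2) @\<^sub>c C1) (D1 * D2) k $$ (i, j) = (D1 * C2 * ?x k') $$ (i, j) + (C1 * y k') $$ (i, j)"
    using ij carrier_matD[OF c1(3)] carrier_matD[OF yc[of k']] by (simp del: index_mult_mat(1))
  also have "D1 * C2 * ?x k' = markov A1 B1 C1 D1 0 * ?m2 k"
    unfolding Suc using assoc_mult_mat[OF c1(4) c2(3) x] by (simp add: markov_def)
  also have "(C1 * y k') $$ (i, j) = (\<Sum>s = 0..k'. (markov A1 B1 C1 D1 (Suc s) * ?m2 (k' - s)) $$ (i, j))"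
    unfolding Gy[OF c1(3)] by (simp add: markov_def)
  finally show ?thesis
    unfolding Suc sum.atLeast0_atMost_Suc_shift by simp
qed

lemma realization_product:
  assumes L: "rhombic_lattice L" "0 \<in> vertices L" "unit_step_reachable L"
    and f1: "is_realization L m n l1 A1 B1 C1 D1 f1" and f2: "is_realization L n p l2 A2 B2 C2 D2 f2"
  shows "is_realization L m p (l2 + l1)
           (four_block_mat A2 (0\<^sub>m l2 l1) (B1 * C2) A1)
           (B2 @\<^sub>r (B1 * D2)) ((D1 * C2) @\<^sub>c C1) (D1 * D2) (rational_conv L f1 f2)"
proof -
  have c1: "A1 \<in> carrier_mat l1 l1" "B1 \<in> carrier_mat l1 n" "C1 \<in> carrier_mat m l1" "D1 \<in> carrier_mat m n"
    "S_set L \<inter> spectrum A1 = {}" and "f1 \<in> DA_mat L m n"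
    using f1 unfolding is_realization_def by simp_all
  have c2: "A2 \<in> carrier_mat l2 l2" "B2 \<in> carrier_mat l2 p" "C2 \<in> carrier_mat n l2" "D2 \<in> carrier_mat n p"
    "S_set L \<inter> spectrum A2 = {}" and "f2 \<in> DA_mat L n p"
    using f2 unfolding is_realization_def by simp_all
  let ?A = "four_block_mat A2 (0\<^sub>m l2 l1) (B1 * C2) A1" and ?B = "B2 @\<^sub>r (B1 * D2)"
    and ?C = "(D1 * C2) @\<^sub>c C1" and ?D = "D1 * D2"
  have G: "B1 * C2 \<in> carrier_mat l1 l2" using c1(2) c2(3) by (rule mult_carrier_mat)
  have A: "?A \<in> carrier_mat (l2 + l1) (l2 + l1)" using c1(1) c2(1) by simp
  have B: "?B \<in> carrier_mat (l2 + l1) p" using c1 c2 by (intro carrier_append_rows) auto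
  have C: "?C \<in> carrier_mat m (l2 + l1)"
    unfolding append_cols_eq[OF mult_carrier_mat[OF c1(4) c2(3)] c1(3)]
    using four_block_carrier_mat[OF mult_carrier_mat[OF c1(4) c2(3)] zero_carrier_mat[of 0 l1]] by simp
  have D: "?D \<in> carrier_mat m p" using c1(4) c2(4) by (rule mult_carrier_mat)
  have "S_set L \<inter> spectrum ?A = {}"
    using c1(5) c2(5) eigenvalue_block[OF c2(1) G c1(1)] unfolding spectrum_def by blast
  define h where "h = realization_fun L m p ?A ?B ?C ?D"
  have h: "is_realization L m p (l2 + l1) ?A ?B ?C ?D h"
    unfolding is_realization_iff[OF L(1,2)] h_def
    using A B C D \<open>S_set L \<inter> spectrum ?A = {}\<close> by (intro conjI refl)
  have tau_h: "tau L h = tau L f1 * tau L f2"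
  proof (rule eq_matI)
    fix i j assume "i < dim_row (tau L f1 * tau L f2)" "j < dim_col (tau L f1 * tau L f2)"
    then have ij: "i < m" "j < p" by (simp_all add: tau_realization[OF L f1] tau_realization[OF L f2])
    let ?m1 = "markov A1 B1 C1 D1" and ?m2 = "markov A2 B2 C2 D2"
    have "(tau L f1 * tau L f2) $$ (i, j) =
        (\<Sum>q = 0..<n. Abs_fps (\<lambda>k. ?m1 k $$ (i, q)) * Abs_fps (\<lambda>k. ?m2 k $$ (q, j)))"
      using ij by (simp add: tau_realization[OF L f1] tau_realization[OF L f2] scalar_prod_def)
    also have "\<dots> = Abs_fps (\<lambda>k. \<Sum>s = 0..k. (?m1 s * ?m2 (k - s)) $$ (i, j))"
    proof (rule fps_ext)
      fix k
      have "fps_nth (\<Sum>q = 0..<n. Abs_fps (\<lambda>k. ?m1 k $$ (i, q)) * Abs_fps (\<lambda>k. ?m2 k $$ (q, j))) k =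
          (\<Sum>q = 0..<n. \<Sum>s = 0..k. ?m1 s $$ (i, q) * ?m2 (k - s) $$ (q, j))"
        by (simp add: fps_sum_nth fps_mult_nth)
      also have "\<dots> = (\<Sum>s = 0..k. (?m1 s * ?m2 (k - s)) $$ (i, j))"
        unfolding mult_entry[OF markov_carrier[OF c1(1-4)] markov_carrier[OF c2(1-4)] ij] by (rule sum.swap)
      finally show "fps_nth (\<Sum>q = 0..<n. Abs_fps (\<lambda>k. ?m1 k $$ (i, q)) * Abs_fps (\<lambda>k. ?m2 k $$ (q, j))) k =
        fps_nth (Abs_fps (\<lambda>k. \<Sum>s = 0..k. (?m1 s * ?m2 (k - s)) $$ (i, j))) k" by simp
    qed
    also have "\<dots> = tau L h $$ (i, j)"
      using ij by (simp add: tau_realization[OF L h] markov_product[OF c1(1-4) c2(1-4) ij])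
    finally show "tau L h $$ (i, j) = (tau L f1 * tau L f2) $$ (i, j)" ..
  qed (simp_all add: tau_realization[OF L f1] tau_realization[OF L f2] tau_realization[OF L h])
  have dims: "dim_row (f1 0) = m" "dim_col (f2 0) = p"
    using DA_matD(1)[OF \<open>f1 \<in> DA_mat L m n\<close>, of 0] DA_matD(1)[OF \<open>f2 \<in> DA_mat L n p\<close>, of 0] by simp_all
  have "rational_conv L f1 f2 = h"
    unfolding rational_conv_def dims
  proof (rule the_equality)
    show "rational_DA L m p h \<and> tau L h = tau L f1 * tau L f2"
      using h tau_h unfolding rational_DA_def by blast
  next
    fix g assume g: "rational_DA L m p g \<and> tau L g = tau L f1 * tau L f2"
    then obtain l A' B' C' D' where r: "is_realization L m p l A' B' C' D' g"
      unfolding rational_DA_def by blast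
    then have c': "A' \<in> carrier_mat l l" "B' \<in> carrier_mat l p" "C' \<in> carrier_mat m l" "D' \<in> carrier_mat m p"
      unfolding is_realization_def by simp_all
    have eq: "tau L g = tau L h" using g tau_h by simp
    show "g = h"
    proof (rule realization_markov_unique[OF L(1,2) r h])
      fix k show "markov A' B' C' D' k = markov ?A ?B ?C ?D k"
      proof (rule eq_matI)
        fix i j assume "i < dim_row (markov ?A ?B ?C ?D k)" "j < dim_col (markov ?A ?B ?C ?D k)"
        then have ij: "i < m" "j < p" using carrier_matD[OF markov_carrier[OF A B C D]] by simp_all
        have "fps_nth (tau L g $$ (i, j)) k = fps_nth (tau L h $$ (i, j)) k" by (simp add: eq)
        then show "markov A' B' C' D' k $$ (i, j) = markov ?A ?B ?C ?D k $$ (i, j)"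
          using ij by (simp add: tau_realization[OF L r] tau_realization[OF L h])
      qed (use carrier_matD[OF markov_carrier[OF A B C D]] carrier_matD[OF markov_carrier[OF c']] in simp_all)
    qed
  qed
  with h show ?thesis by simp
qed

theorem proposition5p9:
  fixes L :: "complex set set"
    and m n k l1 l2 :: nat
    and A1 B1 C1 D1 A2 B2 C2 D2 :: "complex mat"
    and f1 f2 :: "complex \<Rightarrow> complex mat"
  assumes "rhombic_lattice L"
    and "0 \<in> vertices L"
    and "\<And>z. z \<in> vertices L \<Longrightarrow> \<exists>N zs. N \<ge> 1 \<and> length zs = N + 1 \<and> is_path L zs \<and> zs ! 0 = z \<and>
           (\<forall>i\<in>{1..N - 1}. zs ! i - zs ! (i - 1) \<noteq> 1 \<and> zs ! i - zs ! (i - 1) \<noteq> - 1) \<and>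
           zs ! N - zs ! (N - 1) = 1"
    and "\<And>t. t \<in> S_set L \<Longrightarrow> \<not> Zminus_eigenvalue L t"
    and "is_realization L m n l1 A1 B1 C1 D1 f1"
    and "is_realization L n k l2 A2 B2 C2 D2 f2"
  shows "is_realization L m k (l2 + l1)
           (four_block_mat A2 (0\<^sub>m l2 l1) (B1 * C2) A1)
           (B2 @\<^sub>r (B1 * D2))
           ((D1 * C2) @\<^sub>c C1)
           (D1 * D2)
           (rational_conv L f1 f2)"
proof -
  have "unit_step_reachable L"
    unfolding unit_step_reachable_def using assms(3) by blast
  with assms(1,2) show ?thesis using assms(5,6) by (rule realization_product)
qed

end
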